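(* Let $\rho\in(-1,1)$, $a>0$, $c_1,c_2\in\mathbb{R}$ and $S_1,S_2>0$. If $a\le\rho$, then $$\lim_{u\to\infty}\mathscr{P}_{S_1,S_2}(c_1,c_2,u,au)=\frac{C_{\mathcal P}}{2},$$ where $$C_{\mathcal P}=\mathbb{E}\left\{\exp\left(\sup_{t\ge 0}\ \inf_{s\in[0,S_1/2]}\Big(\sqrt2\,B(t-s)-2|t-s|\,\mathbf 1(t>s)\Big)\right)\right\}\in(0,\infty)$$ and $B$ is a standard two-sided Brownian motion (with $B(0)=0$).
   Context: Let $B_1,B_2$ be independent standard Brownian motions on $[0,\infty)$ and $\rho\in(-1,1)$. Put $W_1(s)=B_1(s)$, $W_2(t)=\rho B_1(t)+\sqrt{1-\rho^2}\,B_2(t)$ for $s,t\ge0$, and $W_i^*(t)=W_i(t)-c_it$, $i=1,2$. For $u>0$ define the conditional (non-simultaneous) Parisian ruin probability $$\mathscr{P}_{S_1,S_2}(c_1,c_2,u,au)=\mathbb{P}\left\{\exists s',t'\in[0,1]\ \forall s\in[s',s'+\tfrac{S_1}{u^2}]\ \forall t\in[t',t'+\tfrac{S_2}{u^2}]:\ W_1^*(s)>u,\ W_2^*(t)>au\ \Big|\ \exists v,w\in[0,1]:\ W_1^*(v)>u,\ W_2^*(w)>au\right\}.$$ *)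

theory Defs
  imports "HOL-Probability.Probability"
begin

text \<open>
  Paths are required to be continuous for every outcome rather than almost surely, so that
  the path events below, which involve uncountable quantifiers, are measurable.
\<close>

definition standard_brownian_motion :: "'a measure \<Rightarrow> (real \<Rightarrow> 'a \<Rightarrow> real) \<Rightarrow> bool" where
  "standard_brownian_motion M B \<longleftrightarrow>
     prob_space M \<and>
     (\<forall>t\<ge>0. B t \<in> borel_measurable M) \<and>
     (\<forall>\<omega>\<in>space M. B 0 \<omega> = 0) \<and>
     (\<forall>\<omega>\<in>space M. continuous_on {0..} (\<lambda>t. B t \<omega>)) \<and>
     (\<forall>s t. 0 \<le> s \<longrightarrow> s < t \<longrightarrow>
        distributed M lborel (\<lambda>\<omega>. B t \<omega> - B s \<omega>) (normal_density 0 (sqrt (t - s)))) \<and>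
     (\<forall>(n::nat) \<tau>. 0 \<le> \<tau> 0 \<longrightarrow> (\<forall>i<n. \<tau> i \<le> \<tau> (Suc i)) \<longrightarrow>
        prob_space.indep_vars M (\<lambda>_. borel)
          (\<lambda>i \<omega>. B (\<tau> (Suc i)) \<omega> - B (\<tau> i) \<omega>) {..<n})"

text \<open>Only the restrictions of the processes to the index set \<open>[0,\<infinity>)\<close> enter; independence is
  that of the whole paths, with respect to the product sigma-algebra.\<close>

definition indep_processes ::
  "'a measure \<Rightarrow> (real \<Rightarrow> 'a \<Rightarrow> real) \<Rightarrow> (real \<Rightarrow> 'a \<Rightarrow> real) \<Rightarrow> bool" where
  "indep_processes M X Y \<longleftrightarrow>
     prob_space.indep_var M
       (\<Pi>\<^sub>M t\<in>{0..}. borel) (\<lambda>\<omega>. \<lambda>t\<in>{0..}. X t \<omega>)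
       (\<Pi>\<^sub>M t\<in>{0..}. borel) (\<lambda>\<omega>. \<lambda>t\<in>{0..}. Y t \<omega>)"

definition two_sided_brownian_motion :: "'a measure \<Rightarrow> (real \<Rightarrow> 'a \<Rightarrow> real) \<Rightarrow> bool" where
  "two_sided_brownian_motion M B \<longleftrightarrow>
     standard_brownian_motion M B \<and>
     standard_brownian_motion M (\<lambda>t. B (- t)) \<and>
     indep_processes M B (\<lambda>t. B (- t))"

definition correlated_bm ::
  "real \<Rightarrow> (real \<Rightarrow> 'a \<Rightarrow> real) \<Rightarrow> (real \<Rightarrow> 'a \<Rightarrow> real) \<Rightarrow> real \<Rightarrow> 'a \<Rightarrow> real" where
  "correlated_bm \<rho> B1 B2 t \<omega> = \<rho> * B1 t \<omega> + sqrt (1 - \<rho>\<^sup>2) * B2 t \<omega>"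

definition with_drift :: "real \<Rightarrow> (real \<Rightarrow> 'a \<Rightarrow> real) \<Rightarrow> real \<Rightarrow> 'a \<Rightarrow> real" where
  "with_drift c W t \<omega> = W t \<omega> - c * t"

text \<open>The first barrier \<open>u\<close> also scales the window lengths; \<open>v\<close> is the second barrier.\<close>

definition cond_parisian_ruin_prob ::
  "'a measure \<Rightarrow> (real \<Rightarrow> 'a \<Rightarrow> real) \<Rightarrow> (real \<Rightarrow> 'a \<Rightarrow> real) \<Rightarrow> real \<Rightarrow>
     real \<Rightarrow> real \<Rightarrow> real \<Rightarrow> real \<Rightarrow> real \<Rightarrow> real \<Rightarrow> real" where
  "cond_parisian_ruin_prob M B1 B2 \<rho> S1 S2 c1 c2 u v =
     (let W1 = with_drift c1 B1;
          W2 = with_drift c2 (correlated_bm \<rho> B1 B2)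
      in cond_prob M
           (\<lambda>\<omega>. \<exists>s'\<in>{0..1}. \<exists>t'\<in>{0..1}.
              \<forall>s\<in>{s'..s' + S1 / u\<^sup>2}. \<forall>t\<in>{t'..t' + S2 / u\<^sup>2}. W1 s \<omega> > u \<and> W2 t \<omega> > v)
           (\<lambda>\<omega>. \<exists>s\<in>{0..1}. \<exists>t\<in>{0..1}. W1 s \<omega> > u \<and> W2 t \<omega> > v))"

text \<open>The supremum over \<open>t \<ge> 0\<close> is a priori infinite, so it is taken in \<^typ>\<open>ereal\<close> and
  the expectation in \<^typ>\<open>ennreal\<close>.\<close>

definition exp_ereal :: "ereal \<Rightarrow> ennreal" where
  "exp_ereal x = (if x = \<infinity> then \<infinity> else if x = -\<infinity> then 0 else ennreal (exp (real_of_ereal x)))"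

definition parisian_constant :: "'a measure \<Rightarrow> (real \<Rightarrow> 'a \<Rightarrow> real) \<Rightarrow> real \<Rightarrow> ennreal" where
  "parisian_constant N B S =
     (\<integral>\<^sup>+ \<omega>. exp_ereal (SUP t\<in>{0..}. INF s\<in>{0..S / 2}.
         ereal (sqrt 2 * B (t - s) \<omega> - 2 * \<bar>t - s\<bar> * of_bool (t > s))) \<partial>N)"

end

theory Submission
  imports Defs "HOL-Real_Asymp.Real_Asymp"
begin

text \<open>
  Proof idea. The joint event splits into a condition on \<open>W\<^sub>1\<close> and a condition on \<open>W\<^sub>2\<close>.
  The latter reads \<open>\<rho> (W\<^sub>1\<^sup>*(t) - u) + (\<rho> - a) u + r B\<^sub>2(t) + d t > 0\<close> with
  \<open>r\<^sup>2 = 1 - \<rho>\<^sup>2\<close> and \<open>d = \<rho> c\<^sub>1 - c\<^sub>2\<close>; given that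
  \<open>W\<^sub>1\<^sup>*\<close> exceeds \<open>u\<close>, it does so near time 1 and by a small amount only, so by
  independence the condition contributes a factor \<open>p > 0\<close> that depends neither on \<open>S\<^sub>1\<close> nor on
  \<open>S\<^sub>2\<close> (\<open>p = 1\<close> if \<open>a < \<rho>\<close>, and \<open>p = P(r B\<^sub>2(1) + d > 0)\<close> if
  \<open>a = \<rho>\<close>). The denominator is the case \<open>S\<^sub>1 = S\<^sub>2 = 0\<close>, and \<open>p\<close> cancels.

  For \<open>W\<^sub>1\<close> alone, crossings before \<open>h = 1 - T / u\<^sup>2\<close> cost \<open>O(exp (- T / 2))\<close>
  relative to \<open>\<phi>(u + c) / u\<close> by a maximal inequality. After time \<open>h\<close> the increments, rescaled
  by \<open>u\<close>, form a Brownian motion \<open>X\<close> independent of \<open>B(h)\<close>, and Gaussian tail asymptotics give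
  the relative weight \<open>exp (- T / 2) E exp (sup inf X)\<close> on \<open>[0, T + S]\<close>. A Cameron-Martin shift
  followed by time reversal turns this into the truncation to \<open>t \<le> T / 2\<close> of the constant of the
  theorem. The constant for \<open>S = 0\<close> is 2 by the reflection principle for \<open>c = 0\<close>.
\<close>

subsection \<open>The Gaussian tail\<close>

text \<open>The hypotheses give Gaussian independent increments and continuous paths, nothing more.
  Equality of laws, independence from the past, change of measure and maximal inequalities are
  therefore proved for finitely many Gaussian variables on a grid and carried to paths as the mesh
  shrinks. A window starting before time 1 may end after it, so the rescaled horizon is
  \<open>T + S\<close>. In the lower bound the second window is placed at time 1, and
  \<open>W1\<close> must then stay above \<open>u - \<eta>\<close> for a while; a cap with slack
  \<open>K\<close> enforces this, and \<open>K\<close> tends to infinity only after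
  \<open>u\<close>. The factor \<open>exp (- T / 2)\<close> reflects the variance
  \<open>1 - T / u^2\<close> of the motion at \<open>h\<close>. The shift creates unit drift up to
  \<open>T\<close> and none later. Seen backwards from \<open>T\<close>, with rescaled time
  \<open>T - 2 t\<close>, this is \<open>sqrt 2 * B t\<close> with drift \<open>- 2 t\<close> for
  positive \<open>t\<close> only: hence the \<open>sqrt 2\<close>, the window length
  \<open>S / 2\<close> and the indicator. The truncated constants do not contain the drift, so their
  value for \<open>S = 0\<close> may be computed from driftless motion.\<close>

definition gtail :: "real \<Rightarrow> real" where
  "gtail x = measure std_normal_distribution {x<..}"

lemma gtail_nonneg [simp]: "0 \<le> gtail x"
  by (simp add: gtail_def)

lemma gtail_le_1 [simp]: "gtail x \<le> 1"
  unfolding gtail_def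
  by (rule prob_space.prob_le_1) (simp add: prob_space_normal_density)

lemma real_distribution_std_normal: "real_distribution std_normal_distribution"
  by (intro real_distribution.intro prob_space_normal_density real_distribution_axioms.intro) auto

lemma std_normal_measure_singleton: "measure std_normal_distribution {x} = 0"
  by (simp add: measure_def emeasure_density)

lemma gtail_eq_cdf: "gtail x = 1 - cdf std_normal_distribution x"
proof -
  interpret real_distribution std_normal_distribution by (rule real_distribution_std_normal)
  have "{x<..} = space std_normal_distribution - {..x}" by auto
  then show ?thesis unfolding gtail_def cdf_def
    by (metis atMost_borel borel_UNIV events_eq_borel prob_compl)
qed

lemma gtail_atLeast: "measure std_normal_distribution {x..} = gtail x"
proof -
  interpret real_distribution std_normal_distribution by (rule real_distribution_std_normal)
  have "{x..} = {x} \<union> {x<..}" by auto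
  then have "measure std_normal_distribution {x..} =
      measure std_normal_distribution {x} + measure std_normal_distribution {x<..}"
    by (subst finite_measure_Union[symmetric]) auto
  then show ?thesis by (simp add: std_normal_measure_singleton gtail_def)
qed

lemma isCont_gtail: "isCont gtail x"
proof -
  interpret real_distribution std_normal_distribution by (rule real_distribution_std_normal)
  have "isCont (cdf std_normal_distribution) x"
    by (simp add: isCont_cdf std_normal_measure_singleton)
  then show ?thesis unfolding gtail_eq_cdf[abs_def] by (intro continuous_intros)
qed

lemma borel_measurable_gtail [measurable]: "gtail \<in> borel_measurable borel"
  by (intro borel_measurable_continuous_onI continuous_at_imp_continuous_on ballI isCont_gtail)

lemma gtail_antimono: "x \<le> y \<Longrightarrow> gtail y \<le> gtail x"
proof -
  interpret real_distribution std_normal_distribution by (rule real_distribution_std_normal)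
  show "x \<le> y \<Longrightarrow> gtail y \<le> gtail x" unfolding gtail_def by (rule finite_measure_mono) auto
qed

lemma gtail_nn_integral:
  "ennreal (gtail x) = (\<integral>\<^sup>+t. ennreal (std_normal_density t) * indicator {x..} t \<partial>lborel)"
proof -
  interpret real_distribution std_normal_distribution by (rule real_distribution_std_normal)
  show ?thesis
    by (subst gtail_atLeast[symmetric], subst emeasure_eq_measure[symmetric], subst emeasure_density) auto
qed

lemma gtail_pos: "0 < gtail x"
proof (rule ccontr)
  assume "\<not> 0 < gtail x"
  then have "gtail x = 0" using gtail_nonneg[of x] by linarith
  then have "(\<integral>\<^sup>+t. ennreal (std_normal_density t) * indicator {x..} t \<partial>lborel) = 0"
    using gtail_nn_integral[of x] by simp
  then have "AE t in lborel. ennreal (std_normal_density t) * indicator {x..} t = 0"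
    by (subst (asm) nn_integral_0_iff_AE) auto
  then have "AE t in lborel. t \<notin> {x..}"
    by eventually_elim (use normal_density_pos[of 1 0] in \<open>auto simp: indicator_def not_le less_le split: if_splits\<close>)
  then have "emeasure lborel {t. t \<in> {x..}} = 0"
    by (subst (asm) AE_iff_measurable[OF _ refl]) auto
  moreover have "emeasure lborel {x..x+1} \<le> emeasure lborel {t. t \<in> {x..}}"
    by (rule emeasure_mono) auto
  ultimately show False by simp
qed

lemma gtail_minus: "gtail (- x) = 1 - gtail x"
proof -
  interpret real_distribution std_normal_distribution by (rule real_distribution_std_normal)
  have "ennreal (gtail (-x)) = (\<integral>\<^sup>+t. ennreal (std_normal_density t) * indicator {-x..} t \<partial>lborel)"
    by (rule gtail_nn_integral)
  also have "\<dots> = (\<integral>\<^sup>+t. ennreal (std_normal_density t) * indicator {..x} t \<partial>lborel)"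
    by (subst nn_integral_real_affine[of _ "-1" 0])
      (auto simp: normal_density_def indicator_def intro!: nn_integral_cong)
  also have "\<dots> = emeasure std_normal_distribution {..x}"
    by (simp add: emeasure_density)
  finally have "ennreal (gtail (-x)) = ennreal (cdf std_normal_distribution x)"
    by (simp add: emeasure_eq_measure cdf_def)
  then have "gtail (-x) = cdf std_normal_distribution x"
    by (simp add: cdf_nonneg)
  then show ?thesis by (simp add: gtail_eq_cdf)
qed

lemma gtail_0: "gtail 0 = 1/2"
  using gtail_minus[of 0] by simp

text \<open>The logarithm of the density is concave, so the density lies below the exponential
  touching it at \<open>\<theta>\<close>; integrating that exponential gives the bound. Keeping
  \<open>\<theta>\<close> free matters: \<open>\<theta> = x\<close> is the sharp Mills bound, while
  a fixed \<open>\<theta>\<close> gives exponential decay in \<open>x\<close>.\<close>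

lemma gtail_chernoff:
  assumes "0 < \<theta>"
  shows "gtail x \<le> std_normal_density \<theta> / \<theta> * exp (\<theta> * (\<theta> - x))"
proof -
  have le: "std_normal_density t \<le> std_normal_density \<theta> * exp (- \<theta> * (t - \<theta>))" for t
  proof -
    have "- t\<^sup>2 / 2 \<le> - \<theta>\<^sup>2 / 2 + (- \<theta> * (t - \<theta>))"
      using zero_le_power2[of "t - \<theta>"] by (simp add: power2_eq_square algebra_simps)
    then have "exp (- t\<^sup>2 / 2) \<le> exp (- \<theta>\<^sup>2 / 2) * exp (- \<theta> * (t - \<theta>))"
      by (simp add: exp_add[symmetric])
    then have "(1 / sqrt (2 * pi)) * exp (- t\<^sup>2 / 2) \<le>
        (1 / sqrt (2 * pi)) * (exp (- \<theta>\<^sup>2 / 2) * exp (- \<theta> * (t - \<theta>)))"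
      by (intro mult_left_mono) auto
    then show ?thesis by (simp add: std_normal_density_def)
  qed
  let ?F = "\<lambda>t. - (std_normal_density \<theta> / \<theta> * exp (\<theta> * (\<theta> - t)))"
  have "ennreal (gtail x) \<le>
     (\<integral>\<^sup>+t. ennreal (std_normal_density \<theta> * exp (- \<theta> * (t - \<theta>))) * indicator {x..} t \<partial>lborel)"
    unfolding gtail_nn_integral
    by (intro nn_integral_mono mult_right_mono ennreal_leI le) auto
  also have "\<dots> = ennreal (0 - ?F x)"
  proof (rule nn_integral_FTC_atLeast)
    show "(?F \<longlongrightarrow> 0) at_top"
      using assms by real_asymp
    show "DERIV ?F t :> std_normal_density \<theta> * exp (- \<theta> * (t - \<theta>))" for t
      using assms by (auto intro!: derivative_eq_intros simp: field_simps)
  qed auto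
  finally show ?thesis
    using assms by (simp add: divide_nonneg_pos)
qed

text \<open>The derivative of \<open>- std_normal_density t / t\<close> is the density times
  \<open>1 + 1 / t^2\<close>, a factor that is largest at the left end of
  \<open>[x, \<infinity>)\<close>.\<close>

lemma gtail_lower:
  assumes "0 < x"
  shows "std_normal_density x / x \<le> (1 + 1 / x\<^sup>2) * gtail x"
proof -
  let ?F = "\<lambda>t. - (std_normal_density t / t)"
  have "ennreal (0 - ?F x) = (\<integral>\<^sup>+t. ennreal (std_normal_density t * (1 + 1 / t\<^sup>2)) * indicator {x..} t \<partial>lborel)"
  proof (rule nn_integral_FTC_atLeast[symmetric])
    show "(?F \<longlongrightarrow> 0) at_top"
      unfolding std_normal_density_def by real_asymp
    show "DERIV ?F t :> std_normal_density t * (1 + 1 / t\<^sup>2)" if "x \<le> t" for t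
    proof -
      define k :: real where "k = 1 / sqrt (2 * pi)"
      have *: "std_normal_density = (\<lambda>t. k * exp (- t\<^sup>2 / 2))"
        by (simp add: fun_eq_iff std_normal_density_def k_def)
      show ?thesis
        using assms that unfolding *
        by (auto intro!: derivative_eq_intros simp: field_simps power2_eq_square)
    qed
  qed auto
  also have "\<dots> \<le> (\<integral>\<^sup>+t. ennreal (1 + 1 / x\<^sup>2) * (ennreal (std_normal_density t) * indicator {x..} t) \<partial>lborel)"
  proof (rule nn_integral_mono)
    fix t
    have "std_normal_density t * (1 + 1 / t\<^sup>2) \<le> (1 + 1 / x\<^sup>2) * std_normal_density t" if "x \<le> t"
    proof -
      have "1 / t\<^sup>2 \<le> 1 / x\<^sup>2" using that assms by (intro divide_left_mono power_mono mult_pos_pos) auto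
      then have "(1 + 1 / t\<^sup>2) * std_normal_density t \<le> (1 + 1 / x\<^sup>2) * std_normal_density t"
        by (intro mult_right_mono) auto
      then show ?thesis by (simp add: mult.commute)
    qed
    then have "ennreal (std_normal_density t * (1 + 1 / t\<^sup>2)) \<le>
        ennreal (1 + 1 / x\<^sup>2) * ennreal (std_normal_density t)" if "x \<le> t"
      using that by (subst ennreal_mult'[symmetric]) (auto intro!: ennreal_leI)
    then show "ennreal (std_normal_density t * (1 + 1 / t\<^sup>2)) * indicator {x..} t \<le>
        ennreal (1 + 1 / x\<^sup>2) * (ennreal (std_normal_density t) * indicator {x..} t)"
      by (cases "x \<le> t") auto
  qed
  also have "\<dots> = ennreal ((1 + 1 / x\<^sup>2) * gtail x)"
    by (subst nn_integral_cmult) (auto simp: gtail_nn_integral[symmetric] ennreal_mult')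
  finally show ?thesis
    by (subst (asm) ennreal_le_iff) auto
qed

lemma gtail_asymp: "((\<lambda>x. x * gtail x / std_normal_density x) \<longlongrightarrow> 1) at_top"
proof (rule tendsto_sandwich)
  show "((\<lambda>x::real. 1 / (1 + 1 / x\<^sup>2)) \<longlongrightarrow> 1) at_top" by real_asymp
  show "((\<lambda>x::real. 1) \<longlongrightarrow> 1) at_top" by simp
  show "\<forall>\<^sub>F x in at_top. 1 / (1 + 1 / x\<^sup>2) \<le> x * gtail x / std_normal_density x"
    using eventually_gt_at_top[of 0]
  proof eventually_elim
    case (elim x)
    have "0 < std_normal_density x" "0 < 1 + 1 / x\<^sup>2"
      by (auto intro: normal_density_pos add_pos_nonneg)
    with gtail_lower[OF elim] elim show ?case by (simp add: field_simps)
  qed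
  show "\<forall>\<^sub>F x in at_top. x * gtail x / std_normal_density x \<le> 1"
    using eventually_gt_at_top[of 0]
  proof eventually_elim
    case (elim x)
    have "0 < std_normal_density x" by (auto intro: normal_density_pos)
    with gtail_chernoff[OF elim, of x] elim show ?case by (simp add: field_simps)
  qed
qed

text \<open>The reciprocal of the leading order \<open>\<phi>(u + c) / u\<close> of \<open>P(B(1) - c > u)\<close>.\<close>

definition gscale :: "real \<Rightarrow> real \<Rightarrow> real" where
  "gscale c u = u / std_normal_density (u + c)"

lemma std_normal_density_ratio:
  "std_normal_density y = std_normal_density x * exp (x\<^sup>2 / 2 - y\<^sup>2 / 2)"
  unfolding std_normal_density_def by (simp add: exp_add[symmetric])

text \<open>By the Mills ratio the product is asymptotic to the quotient of the densities at
  \<open>x u\<close> and \<open>u + c\<close>; since \<open>u / x u\<close> tends to 1, only the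
  difference of the squares survives.\<close>

lemma gscale_gtail_tendsto:
  assumes "filterlim x at_top at_top" "((\<lambda>u. u / x u) \<longlongrightarrow> 1) at_top"
    and "((\<lambda>u. (u + c)\<^sup>2 / 2 - (x u)\<^sup>2 / 2) \<longlongrightarrow> l) at_top"
  shows "((\<lambda>u. gscale c u * gtail (x u)) \<longlongrightarrow> exp l) at_top"
proof -
  have "((\<lambda>u. (x u * gtail (x u) / std_normal_density (x u)) * (u / x u) *
      exp ((u + c)\<^sup>2 / 2 - (x u)\<^sup>2 / 2)) \<longlongrightarrow> 1 * 1 * exp l) at_top"
    by (intro tendsto_intros assms(2,3) filterlim_compose[OF gtail_asymp assms(1)])
  then show ?thesis
  proof (rule Lim_transform_eventually[THEN tendsto_eq_rhs])
    show "\<forall>\<^sub>F u in at_top. (x u * gtail (x u) / std_normal_density (x u)) * (u / x u) *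
      exp ((u + c)\<^sup>2 / 2 - (x u)\<^sup>2 / 2) = gscale c u * gtail (x u)"
      using filterlim_at_top_dense[THEN iffD1, OF assms(1), rule_format, of 0]
    proof eventually_elim
      case (elim u)
      have "0 < std_normal_density (u + c)" "0 < std_normal_density (x u)" by (auto intro: normal_density_pos)
      with elim show ?case
        unfolding gscale_def using std_normal_density_ratio[of "x u" "u + c"]
        by (simp add: field_simps)
    qed
  qed simp
qed

text \<open>The upper Mills bound suffices here: \<open>x u \<ge> k * u\<close> controls the
  prefactor, and the exponent does the rest.\<close>

lemma gscale_gtail_null:
  assumes "\<forall>\<^sub>F u in at_top. x u \<ge> k * u" "0 < k"
    and "filterlim (\<lambda>u. (u + c)\<^sup>2 / 2 - (x u)\<^sup>2 / 2) at_bot at_top"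
  shows "((\<lambda>u. gscale c u * gtail (x u)) \<longlongrightarrow> 0) at_top"
proof (rule tendsto_sandwich[where f = "\<lambda>_. 0"])
  show "((\<lambda>u. 1 / k * exp ((u + c)\<^sup>2 / 2 - (x u)\<^sup>2 / 2)) \<longlongrightarrow> 0) at_top"
    by (rule tendsto_eq_rhs[OF tendsto_mult[OF tendsto_const filterlim_compose[OF exp_at_bot assms(3)]]]) simp
  show "\<forall>\<^sub>F u in at_top. 0 \<le> gscale c u * gtail (x u)"
    using eventually_gt_at_top[of 0] by eventually_elim (auto simp: gscale_def)
  show "\<forall>\<^sub>F u in at_top. gscale c u * gtail (x u) \<le> 1 / k * exp ((u + c)\<^sup>2 / 2 - (x u)\<^sup>2 / 2)"
    using assms(1) eventually_gt_at_top[of 0]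
  proof eventually_elim
    case (elim u)
    have x: "0 < x u" using elim assms(2) by (smt (verit) mult_pos_pos)
    have p: "0 < std_normal_density (u + c)" by (auto intro: normal_density_pos)
    have "gscale c u * gtail (x u) \<le> gscale c u * (std_normal_density (x u) / x u)"
      using gtail_chernoff[OF x, of "x u"] elim p
      by (intro mult_left_mono) (auto simp: gscale_def)
    also have "\<dots> = (u / x u) * exp ((u + c)\<^sup>2 / 2 - (x u)\<^sup>2 / 2)"
      using x p unfolding gscale_def std_normal_density_ratio[of "x u" "u + c"] by (simp add: field_simps)
    also have "\<dots> \<le> 1 / k * exp ((u + c)\<^sup>2 / 2 - (x u)\<^sup>2 / 2)"
      using elim x assms(2) by (intro mult_right_mono) (auto simp: field_simps)
    finally show ?case .
  qed
qed (rule tendsto_const)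

lemma gscale_nonneg: "0 \<le> u \<Longrightarrow> 0 \<le> gscale c u"
  by (simp add: gscale_def)

lemma distributed_normal_tail:
  assumes X: "distributed M lborel X (normal_density \<mu> \<sigma>)" and "0 < \<sigma>" and M: "prob_space M"
  shows "measure M {\<omega>\<in>space M. X \<omega> > x} = gtail ((x - \<mu>) / \<sigma>)"
    and "measure M {\<omega>\<in>space M. X \<omega> \<ge> x} = gtail ((x - \<mu>) / \<sigma>)"
proof -
  interpret prob_space M by fact
  have Y: "distributed M lborel (\<lambda>\<omega>. (X \<omega> - \<mu>) / \<sigma>) std_normal_density"
    using X normal_standard_normal_convert[OF assms(2)] by simp
  have *: "measure M ((\<lambda>\<omega>. (X \<omega> - \<mu>) / \<sigma>) -` A \<inter> space M) = measure std_normal_distribution A"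
    if "A \<in> sets borel" for A
    using distributed_measurable[OF Y] that
    by (subst distributed_distr_eq_density[OF Y, symmetric], subst measure_distr) auto
  have "{\<omega>\<in>space M. X \<omega> > x} = (\<lambda>\<omega>. (X \<omega> - \<mu>) / \<sigma>) -` {(x - \<mu>) / \<sigma><..} \<inter> space M"
    using assms(2) by (auto simp: divide_simps)
  then show "measure M {\<omega>\<in>space M. X \<omega> > x} = gtail ((x - \<mu>) / \<sigma>)"
    by (simp only: *[of "{(x - \<mu>) / \<sigma><..}", simplified] gtail_def)
  have "{\<omega>\<in>space M. X \<omega> \<ge> x} = (\<lambda>\<omega>. (X \<omega> - \<mu>) / \<sigma>) -` {(x - \<mu>) / \<sigma>..} \<inter> space M"
    using assms(2) by (auto simp: divide_simps)
  then show "measure M {\<omega>\<in>space M. X \<omega> \<ge> x} = gtail ((x - \<mu>) / \<sigma>)"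
    by (simp only: *[of "{(x - \<mu>) / \<sigma>..}", simplified] gtail_atLeast)
qed

subsection \<open>Window functionals of paths\<close>

text \<open>
  These functionals are monotone and translation equivariant, hence 1-Lipschitz in the supremum
  norm on \<open>[0, R]\<close>, so they can be evaluated by sampling continuous paths on grids.
\<close>

definition shift_mono :: "real \<Rightarrow> ((real \<Rightarrow> real) \<Rightarrow> real) \<Rightarrow> bool" where
  "shift_mono R G \<longleftrightarrow> (\<forall>f g e. bounded (f ` {0..R}) \<longrightarrow> bounded (g ` {0..R}) \<longrightarrow>
     (\<forall>t\<in>{0..R}. f t \<le> g t + e) \<longrightarrow> G f \<le> G g + e)"

lemma shift_monoD:
  assumes "shift_mono R G" "bounded (f ` {0..R})" "bounded (g ` {0..R})"
    and "\<And>t. 0 \<le> t \<Longrightarrow> t \<le> R \<Longrightarrow> f t \<le> g t + e"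
  shows "G f \<le> G g + e"
  using assms unfolding shift_mono_def by auto

lemma shift_mono_lipschitz:
  assumes "shift_mono R G" "bounded (f ` {0..R})" "bounded (g ` {0..R})"
    and "\<And>t. 0 \<le> t \<Longrightarrow> t \<le> R \<Longrightarrow> \<bar>f t - g t\<bar> \<le> e"
  shows "\<bar>G f - G g\<bar> \<le> e"
proof -
  have "G f \<le> G g + e" "G g \<le> G f + e"
    by (rule shift_monoD[OF assms(1)]; use assms in \<open>fastforce simp: abs_le_iff\<close>)+
  then show ?thesis by linarith
qed

lemma shift_mono_cong:
  assumes "shift_mono R G" "bounded (f ` {0..R})" "\<And>t. 0 \<le> t \<Longrightarrow> t \<le> R \<Longrightarrow> f t = g t"
  shows "G f = G g"
proof -
  have "f ` {0..R} = g ` {0..R}" using assms(3) by (intro image_cong) auto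
  then have "\<bar>G f - G g\<bar> \<le> 0"
    using assms by (intro shift_mono_lipschitz[OF assms(1)]) auto
  then show ?thesis by simp
qed

lemma bounded_image_add_const:
  fixes f :: "real \<Rightarrow> real"
  shows "bounded (f ` A) \<Longrightarrow> bounded ((\<lambda>t. f t + e) ` A)"
  by (rule bounded_plus_comp) (auto simp: image_constant_conv)

lemma shift_mono_add:
  assumes "shift_mono R G" "bounded (f ` {0..R})"
  shows "G (\<lambda>t. f t + e) = G f + e"
proof -
  have b: "bounded ((\<lambda>t. f t + e) ` {0..R})" using assms(2) by (rule bounded_image_add_const)
  have "G (\<lambda>t. f t + e) \<le> G f + e"
    by (rule shift_monoD[OF assms(1) b assms(2)]) simp
  moreover have "G f \<le> G (\<lambda>t. f t + e) + (- e)"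
    by (rule shift_monoD[OF assms(1) assms(2) b]) simp
  ultimately show ?thesis by simp
qed

text \<open>The windows start in \<open>[a, b]\<close> but look at the path up to
  \<open>b + S\<close>. For \<open>S = 0\<close> this is the running maximum, for
  \<open>a = b\<close> the minimum over a single window; both special cases are used.\<close>

definition window_sup :: "real \<Rightarrow> real \<Rightarrow> real \<Rightarrow> (real \<Rightarrow> real) \<Rightarrow> real" where
  "window_sup S a b f = (SUP t\<in>{a..b}. INF s\<in>{t..t+S}. f s)"

lemma window_sup_bdd:
  fixes f :: "real \<Rightarrow> real"
  assumes "0 \<le> a" "b + S \<le> R" "0 \<le> S" "bounded (f ` {0..R})"
  shows "\<And>t. a \<le> t \<Longrightarrow> t \<le> b \<Longrightarrow> bdd_below (f ` {t..t+S})"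
    and "bdd_above ((\<lambda>t. INF s\<in>{t..t+S}. f s) ` {a..b})"
proof -
  show bb: "bdd_below (f ` {t..t+S})" if "a \<le> t" "t \<le> b" for t
    using assms that
    by (intro bdd_below_mono[OF bounded_imp_bdd_below[OF assms(4)]] image_mono) auto
  obtain K where K: "\<And>s. s \<in> {0..R} \<Longrightarrow> f s \<le> K"
    using bounded_imp_bdd_above[OF assms(4)] unfolding bdd_above_def by blast
  have "(INF s\<in>{t..t+S}. f s) \<le> K" if "a \<le> t" "t \<le> b" for t
    using that assms by (intro cINF_lower2[OF bb, of t t] K) auto
  then show "bdd_above ((\<lambda>t. INF s\<in>{t..t+S}. f s) ` {a..b})"
    by (intro bdd_aboveI2[of _ _ K]) auto
qed

lemma shift_mono_window_sup:
  assumes "0 \<le> a" "a \<le> b" "0 \<le> S" "b + S \<le> R"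
  shows "shift_mono R (window_sup S a b)"
  unfolding shift_mono_def
proof (intro allI impI)
  fix f g :: "real \<Rightarrow> real" and e
  assume f: "bounded (f ` {0..R})" and g: "bounded (g ` {0..R})"
    and le: "\<forall>t\<in>{0..R}. f t \<le> g t + e"
  note bf = window_sup_bdd[OF assms(1,4,3) f] and bg = window_sup_bdd[OF assms(1,4,3) g]
  show "window_sup S a b f \<le> window_sup S a b g + e"
    unfolding window_sup_def
  proof (rule cSUP_least)
    show "{a..b} \<noteq> {}" using assms by auto
    fix t assume t: "t \<in> {a..b}"
    have "(INF s\<in>{t..t+S}. f s) - e \<le> (INF s\<in>{t..t+S}. g s)"
    proof (rule cINF_greatest)
      show "{t..t+S} \<noteq> {}" using assms by auto
      fix s assume s: "s \<in> {t..t+S}"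
      have "(INF s\<in>{t..t+S}. f s) \<le> f s" using bf(1) t s by (intro cINF_lower) auto
      also have "f s \<le> g s + e" using le s t assms by auto
      finally show "(INF s\<in>{t..t+S}. f s) - e \<le> g s" by simp
    qed
    also have "\<dots> \<le> (SUP t\<in>{a..b}. INF s\<in>{t..t+S}. g s)"
      using t bg(2) by (intro cSUP_upper)
    finally show "(INF s\<in>{t..t+S}. f s) \<le> (SUP t\<in>{a..b}. INF s\<in>{t..t+S}. g s) + e" by simp
  qed
qed

lemma window_sup_zero [simp]:
  assumes "a \<le> b" "0 \<le> S"
  shows "window_sup S a b (\<lambda>_. 0) = 0"
proof -
  have "(INF s\<in>{t..t+S}. 0::real) = 0" for t using assms by (subst cINF_const) auto
  then show ?thesis unfolding window_sup_def using assms by simp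
qed

text \<open>Closure under this operation lets one functional encode a crossing together with the
  demand that the path stay above a lower level afterwards.\<close>

lemma shift_mono_min:
  assumes "shift_mono R G" "shift_mono R H"
  shows "shift_mono R (\<lambda>f. min (G f) (K + H f))"
  unfolding shift_mono_def
proof (intro allI impI)
  fix f g :: "real \<Rightarrow> real" and e
  assume *: "bounded (f ` {0..R})" "bounded (g ` {0..R})" "\<forall>t\<in>{0..R}. f t \<le> g t + e"
  have "G f \<le> G g + e" "H f \<le> H g + e"
    using * by (auto intro: shift_monoD[OF assms(1)] shift_monoD[OF assms(2)])
  then show "min (G f) (K + H f) \<le> min (G g) (K + H g) + e" by linarith
qed

text \<open>A continuous path attains its infimum on a window, so strict inequalities survive the
  infimum; suprema respect them anyway. This is the bridge between path events and
  functionals.\<close>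

lemma less_window_sup_iff:
  assumes "0 \<le> a" "a \<le> b" "0 \<le> S" "continuous_on {0..} f"
  shows "x < window_sup S a b f \<longleftrightarrow> (\<exists>t\<in>{a..b}. \<forall>s\<in>{t..t+S}. x < f s)"
proof -
  define R where "R = b + S"
  have "compact (f ` {0..R})"
    by (intro compact_continuous_image continuous_on_subset[OF assms(4)]) auto
  then have f: "bounded (f ` {0..R})" by (rule compact_imp_bounded)
  note bf = window_sup_bdd[OF assms(1) _ assms(3) f, of b, unfolded R_def, simplified]
  have inf: "x < (INF s\<in>{t..t+S}. f s) \<longleftrightarrow> (\<forall>s\<in>{t..t+S}. x < f s)" if t: "t \<in> {a..b}" for t
  proof
    assume "x < (INF s\<in>{t..t+S}. f s)"
    then show "\<forall>s\<in>{t..t+S}. x < f s"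
      using bf(1) t by (meson atLeastAtMost_iff less_cINF_D)
  next
    assume gt: "\<forall>s\<in>{t..t+S}. x < f s"
    have "continuous_on {t..t+S} f" using t assms by (intro continuous_on_subset[OF assms(4)]) auto
    then obtain r where r: "r \<in> {t..t+S}" "\<And>s. s \<in> {t..t+S} \<Longrightarrow> f r \<le> f s"
      using continuous_attains_inf[of "{t..t+S}" f] assms(3) by auto
    have "f r \<le> (INF s\<in>{t..t+S}. f s)"
      using r assms(3) by (intro cINF_greatest) auto
    with gt r(1) show "x < (INF s\<in>{t..t+S}. f s)" by (auto intro: less_le_trans)
  qed
  have "x < window_sup S a b f \<longleftrightarrow> (\<exists>t\<in>{a..b}. x < (INF s\<in>{t..t+S}. f s))"
    unfolding window_sup_def using assms(2) bf(2) by (intro less_cSUP_iff) auto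
  also have "\<dots> \<longleftrightarrow> (\<exists>t\<in>{a..b}. \<forall>s\<in>{t..t+S}. x < f s)"
    using inf by blast
  finally show ?thesis .
qed

section \<open>Sampling paths on grids\<close>

definition step_path :: "nat \<Rightarrow> (nat \<Rightarrow> real) \<Rightarrow> real \<Rightarrow> real" where
  "step_path n v t = v (nat \<lfloor>real n * t\<rfloor>)"

definition sample :: "nat \<Rightarrow> (real \<Rightarrow> real) \<Rightarrow> nat \<Rightarrow> real" where
  "sample n f j = f (real j / real n)"

lemma bounded_step_path [simp]: "bounded (step_path n v ` {0..R})"
proof -
  have "step_path n v ` {0..R} \<subseteq> v ` {..nat \<lfloor>real n * R\<rfloor>}"
    unfolding step_path_def by (auto intro!: imageI nat_mono floor_mono mult_left_mono)
  then show ?thesis by (meson bounded_subset finite_imageI finite_imp_bounded finite_atMost)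
qed

lemma step_path_cong:
  assumes "shift_mono R G" "\<And>j. real j \<le> real n * R \<Longrightarrow> v j = w j"
  shows "G (step_path n v) = G (step_path n w)"
proof (rule shift_mono_cong[OF assms(1)])
  fix t assume t: "0 \<le> t" "t \<le> R"
  have "real (nat \<lfloor>real n * t\<rfloor>) \<le> real n * t" using t by simp
  also have "\<dots> \<le> real n * R" using t by (intro mult_left_mono) auto
  finally show "step_path n v t = step_path n w t"
    unfolding step_path_def by (rule assms(2))
qed simp

text \<open>Uniform continuity on \<open>[0, R]\<close> makes the step paths converge uniformly
  there, and \<open>G\<close> is 1-Lipschitz for the supremum norm.\<close>

lemma tendsto_step_path:
  assumes G: "shift_mono R G" and f: "continuous_on {0..} f"
  shows "(\<lambda>n. G (step_path n (sample n f))) \<longlonglongrightarrow> G f"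
proof (rule LIMSEQ_I)
  fix e :: real assume "0 < e"
  have c: "continuous_on {0..R} f" by (rule continuous_on_subset[OF f]) auto
  have b: "bounded (f ` {0..R})" using c by (intro compact_imp_bounded compact_continuous_image) auto
  have "uniformly_continuous_on {0..R} f"
    using c by (intro compact_uniformly_continuous) auto
  then obtain d where d: "d > 0" "\<And>s t. s \<in> {0..R} \<Longrightarrow> t \<in> {0..R} \<Longrightarrow> dist t s < d \<Longrightarrow> dist (f t) (f s) < e/2"
    using \<open>0 < e\<close> unfolding uniformly_continuous_on_def by (metis half_gt_zero)
  obtain N :: nat where N: "1 / d < real N" using reals_Archimedean2 by blast
  show "\<exists>N. \<forall>n\<ge>N. norm (G (step_path n (sample n f)) - G f) < e"
  proof (intro exI allI impI)
    fix n assume n: "n \<ge> N"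
    have pos: "0 < real N" using N d(1) by (meson divide_pos_pos less_trans zero_less_one)
    then have npos: "0 < real n" using n by linarith
    have nd: "1 / real n < d"
    proof -
      have "1 / d < real n" using N n by linarith
      then show ?thesis using d(1) npos by (simp add: field_simps)
    qed
    have "\<bar>G (step_path n (sample n f)) - G f\<bar> \<le> e/2"
    proof (rule shift_mono_lipschitz[OF G bounded_step_path b])
      fix t assume t: "0 \<le> t" "t \<le> R"
      define s where "s = real (nat \<lfloor>real n * t\<rfloor>) / real n"
      have fl: "real (nat \<lfloor>real n * t\<rfloor>) \<le> real n * t" "real n * t < real (nat \<lfloor>real n * t\<rfloor>) + 1"
        using t npos by auto
      have s: "s \<le> t" "t < s + 1 / real n" "0 \<le> s"
        using fl npos by (auto simp: s_def field_simps)
      have "dist (f s) (f t) < e/2"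
        using s t nd by (intro d(2)) (auto simp: dist_real_def)
      then show "\<bar>step_path n (sample n f) t - f t\<bar> \<le> e/2"
        by (simp add: step_path_def sample_def s_def dist_real_def)
    qed
    then show "norm (G (step_path n (sample n f)) - G f) < e" using \<open>0 < e\<close> by simp
  qed
qed

text \<open>By the Lipschitz property, \<open>G\<close> of a step path is continuous in the finitely many step values.\<close>

lemma borel_measurable_step_path:
  assumes G: "shift_mono R G"
  shows "(\<lambda>v. G (step_path n v)) \<in> borel_measurable (\<Pi>\<^sub>M i\<in>UNIV. borel)"
proof -
  define L where "L = nat \<lfloor>real n * R\<rfloor>"
  have lip: "\<bar>G (step_path n w) - G (step_path n v)\<bar> \<le> (\<Sum>j\<le>L. \<bar>w j - v j\<bar>)" for v w
  proof (rule shift_mono_lipschitz[OF G])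
    fix t assume t: "0 \<le> t" "t \<le> R"
    have "nat \<lfloor>real n * t\<rfloor> \<le> L" unfolding L_def using t
      by (intro nat_mono floor_mono mult_left_mono) auto
    then show "\<bar>step_path n w t - step_path n v t\<bar> \<le> (\<Sum>j\<le>L. \<bar>w j - v j\<bar>)"
      unfolding step_path_def by (intro member_le_sum[where f = "\<lambda>j. \<bar>w j - v j\<bar>"]) auto
  qed auto
  have "continuous_on UNIV (\<lambda>v. G (step_path n v))"
  proof (intro continuous_at_imp_continuous_on ballI)
    fix v :: "nat \<Rightarrow> real"
    have p: "((\<lambda>w. w j) \<longlongrightarrow> v j) (at v)" for j
      using continuous_on_product_coordinates[of j]
      by (metis continuous_on_eq_continuous_at isCont_def open_UNIV UNIV_I)
    have "((\<lambda>w. \<Sum>j\<le>L. \<bar>w j - v j\<bar>) \<longlongrightarrow> (\<Sum>j\<le>L. \<bar>v j - v j\<bar>)) (at v)"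
      by (intro tendsto_intros p)
    then have "((\<lambda>w. \<Sum>j\<le>L. \<bar>w j - v j\<bar>) \<longlongrightarrow> 0) (at v)" by simp
    then have "((\<lambda>w. G (step_path n w) - G (step_path n v)) \<longlongrightarrow> 0) (at v)"
      by (rule Lim_null_comparison[rotated]) (simp add: lip)
    then show "isCont (\<lambda>v. G (step_path n v)) v"
      unfolding isCont_def by (rule Lim_null[THEN iffD2])
  qed
  then have "(\<lambda>v. G (step_path n v)) \<in> borel_measurable borel"
    by (rule borel_measurable_continuous_onI)
  then show ?thesis
    by (subst measurable_cong_sets[OF sets_PiM_equal_borel refl])
qed

lemma borel_measurable_step_path_comp [measurable (raw)]:
  assumes G: "shift_mono R G" and v: "\<And>j. (\<lambda>\<omega>. v \<omega> j) \<in> borel_measurable K"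
  shows "(\<lambda>\<omega>. G (step_path n (v \<omega>))) \<in> borel_measurable K"
  by (rule measurable_compose[OF _ borel_measurable_step_path[OF G]])
    (use measurable_PiM_single'[of UNIV v] v in \<open>auto intro!: measurable_PiM_single'\<close>)

lemma borel_measurable_shift_mono:
  assumes G: "shift_mono R G" and X: "\<And>t. 0 \<le> t \<Longrightarrow> X t \<in> borel_measurable K"
    and c: "\<And>\<omega>. \<omega> \<in> space K \<Longrightarrow> continuous_on {0..} (\<lambda>t. X t \<omega>)"
  shows "(\<lambda>\<omega>. G (\<lambda>t. X t \<omega>)) \<in> borel_measurable K"
proof (rule borel_measurable_LIMSEQ_real)
  show "(\<lambda>n. G (step_path n (sample n (\<lambda>t. X t \<omega>)))) \<longlonglongrightarrow> G (\<lambda>t. X t \<omega>)"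
    if "\<omega> \<in> space K" for \<omega>
    by (rule tendsto_step_path[OF G c[OF that]])
  show "(\<lambda>\<omega>. G (step_path n (sample n (\<lambda>t. X t \<omega>)))) \<in> borel_measurable K" for n
    by (rule borel_measurable_step_path_comp[OF G]) (auto simp: sample_def intro!: X)
qed

subsection \<open>Laws of functionals of Brownian motion\<close>

abbreviation grid_law :: "nat \<Rightarrow> nat \<Rightarrow> (nat \<Rightarrow> real) measure" where
  "grid_law n L \<equiv> \<Pi>\<^sub>M i\<in>{..<L}. density lborel (normal_density 0 (sqrt (1 / real n)))"

definition grid_incr :: "nat \<Rightarrow> nat \<Rightarrow> (real \<Rightarrow> 'a \<Rightarrow> real) \<Rightarrow> 'a \<Rightarrow> nat \<Rightarrow> real" where
  "grid_incr n L X \<omega> = (\<lambda>i\<in>{..<L}. X (real (Suc i) / real n) \<omega> - X (real i / real n) \<omega>)"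

text \<open>
  Only increments on the uniform grids \<open>\<int> / n\<close> are prescribed: by sampling they determine the law of
  every functional above, and they are easy to verify for the reversed two-sided motion.
\<close>

definition bm_on :: "'a measure \<Rightarrow> (real \<Rightarrow> 'a \<Rightarrow> real) \<Rightarrow> bool" where
  "bm_on M X \<longleftrightarrow> prob_space M \<and> (\<forall>t\<ge>0. X t \<in> borel_measurable M) \<and>
     (\<forall>\<omega>\<in>space M. X 0 \<omega> = 0) \<and>
     (\<forall>\<omega>\<in>space M. continuous_on {0..} (\<lambda>t. X t \<omega>)) \<and>
     (\<forall>n>0. \<forall>L>0. distr M (\<Pi>\<^sub>M i\<in>{..<L}. borel) (grid_incr n L X) = grid_law n L)"

definition psum :: "(nat \<Rightarrow> real) \<Rightarrow> nat \<Rightarrow> real" where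
  "psum \<xi> j = (\<Sum>i<j. \<xi> i)"

lemma bm_onD:
  assumes "bm_on M X"
  shows "prob_space M" "\<And>t. 0 \<le> t \<Longrightarrow> X t \<in> borel_measurable M"
    "\<And>\<omega>. \<omega> \<in> space M \<Longrightarrow> X 0 \<omega> = 0"
    "\<And>\<omega>. \<omega> \<in> space M \<Longrightarrow> continuous_on {0..} (\<lambda>t. X t \<omega>)"
    "\<And>n L. 0 < n \<Longrightarrow> 0 < L \<Longrightarrow> distr M (\<Pi>\<^sub>M i\<in>{..<L}. borel) (grid_incr n L X) = grid_law n L"
  using assms unfolding bm_on_def by auto

lemma measurable_grid_incr:
  assumes "\<And>t. 0 \<le> t \<Longrightarrow> X t \<in> borel_measurable M"
  shows "grid_incr n L X \<in> measurable M (\<Pi>\<^sub>M i\<in>{..<L}. borel)"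
  unfolding grid_incr_def by (intro measurable_restrict borel_measurable_diff assms) auto

lemma psum_grid_incr:
  assumes "X 0 \<omega> = 0" "j \<le> L"
  shows "psum (grid_incr n L X \<omega>) j = sample n (\<lambda>t. X t \<omega>) j"
proof -
  have "psum (grid_incr n L X \<omega>) j = (\<Sum>i<j. X (real (Suc i) / real n) \<omega> - X (real i / real n) \<omega>)"
    unfolding psum_def grid_incr_def using assms(2) by (intro sum.cong) auto
  also have "\<dots> = X (real j / real n) \<omega> - X (real 0 / real n) \<omega>"
    by (rule sum_lessThan_telescope)
  finally show ?thesis using assms(1) by (simp add: sample_def)
qed

lemma psum_measurable [measurable]:
  assumes "j \<le> L"
  shows "(\<lambda>\<xi>. psum \<xi> j) \<in> borel_measurable (\<Pi>\<^sub>M i\<in>{..<L}. borel)"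
  unfolding psum_def using assms by (intro borel_measurable_sum measurable_component_singleton) auto

lemma step_psum_measurable:
  assumes G: "shift_mono R G" and L: "real n * R \<le> real L"
  shows "(\<lambda>\<xi>. G (step_path n (psum \<xi>))) \<in> borel_measurable (\<Pi>\<^sub>M i\<in>{..<L}. borel)"
proof -
  \<comment> \<open>Only indices up to \<open>n * R\<close> are seen by \<open>G\<close>. Capping
    them at \<open>L\<close> makes every coordinate measurable on the finite product, also those
    that \<open>G\<close> ignores.\<close>
  have "G (step_path n (psum \<xi>)) = G (step_path n (\<lambda>j. psum \<xi> (min j L)))" for \<xi>
    using L by (intro step_path_cong[OF G]) auto
  moreover have "(\<lambda>\<xi>. G (step_path n (\<lambda>j. psum \<xi> (min j L)))) \<in> borel_measurable (\<Pi>\<^sub>M i\<in>{..<L}. borel)"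
    by (intro borel_measurable_step_path_comp[OF G] psum_measurable) auto
  ultimately show ?thesis by simp
qed

lemma step_grid_incr:
  assumes G: "shift_mono R G" and L: "real n * R \<le> real L" and "X 0 \<omega> = 0"
  shows "G (step_path n (psum (grid_incr n L X \<omega>))) = G (step_path n (sample n (\<lambda>t. X t \<omega>)))"
  using assms(3) L by (intro step_path_cong[OF G] psum_grid_incr) auto

lemma sets_grid_law [simp, measurable_cong]:
  "sets (grid_law n L) = sets (\<Pi>\<^sub>M i\<in>{..<L}. borel)"
  by (intro sets_PiM_cong) auto

lemma space_grid_law [simp]: "space (grid_law n L) = space (\<Pi>\<^sub>M i\<in>{..<L}. borel)"
  by (rule sets_eq_imp_space_eq) simp

lemma bm_on_nn_integral:
  assumes X: "bm_on M X" "0 < n" "0 < L" and F: "F \<in> borel_measurable (\<Pi>\<^sub>M i\<in>{..<L}. borel)"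
  shows "(\<integral>\<^sup>+\<omega>. F (grid_incr n L X \<omega>) \<partial>M) = (\<integral>\<^sup>+\<xi>. F \<xi> \<partial>grid_law n L)"
  by (subst bm_onD(5)[OF X, symmetric], subst nn_integral_distr)
    (auto intro!: measurable_grid_incr bm_onD(2)[OF X(1)] simp: F)

text \<open>On each grid the characteristic function of \<open>G\<close> of the sampled path is an
  integral against \<open>grid_law\<close>, which knows nothing of the process. The mesh goes to 0
  by dominated convergence, and Levy's uniqueness theorem concludes.\<close>

lemma bm_on_law:
  assumes X: "bm_on M X" and Y: "bm_on N Y" and G: "shift_mono R G"
  shows "distr M borel (\<lambda>\<omega>. G (\<lambda>t. X t \<omega>)) = distr N borel (\<lambda>\<omega>. G (\<lambda>t. Y t \<omega>))"
proof -
  have lim: "(\<lambda>n. \<integral>\<xi>. iexp (t * G (step_path (Suc n) (psum \<xi>))) \<partial>grid_law (Suc n) (nat \<lceil>Suc n * R\<rceil> + 1))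
      \<longlonglongrightarrow> char (distr M borel (\<lambda>\<omega>. G (\<lambda>t. X t \<omega>))) t"
    if X: "bm_on M X" for M :: "'c measure" and X t
  proof -
    interpret prob_space M by (rule bm_onD(1)[OF X])
    note meas = borel_measurable_shift_mono[OF G bm_onD(2)[OF X] bm_onD(4)[OF X]]
    have meas': "(\<lambda>\<omega>. G (step_path n (sample n (\<lambda>t. X t \<omega>)))) \<in> borel_measurable M" for n
      by (rule borel_measurable_step_path_comp[OF G]) (auto simp: sample_def intro!: bm_onD(2)[OF X])
    have "(\<lambda>n. \<integral>\<omega>. iexp (t * G (step_path (Suc n) (sample (Suc n) (\<lambda>t. X t \<omega>)))) \<partial>M) \<longlonglongrightarrow>
       (\<integral>\<omega>. iexp (t * G (\<lambda>t. X t \<omega>)) \<partial>M)"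
    proof (rule integral_dominated_convergence[where w = "\<lambda>_. 1"])
      show "AE \<omega> in M. (\<lambda>n. iexp (t * G (step_path (Suc n) (sample (Suc n) (\<lambda>t. X t \<omega>)))))
          \<longlonglongrightarrow> iexp (t * G (\<lambda>t. X t \<omega>))"
        by (intro AE_I2 tendsto_intros LIMSEQ_Suc[OF tendsto_step_path[OF G bm_onD(4)[OF X]]])
    qed (use meas meas' in \<open>auto intro!: AE_I2\<close>)
    also have "(\<lambda>n. \<integral>\<omega>. iexp (t * G (step_path (Suc n) (sample (Suc n) (\<lambda>t. X t \<omega>)))) \<partial>M) =
      (\<lambda>n. \<integral>\<xi>. iexp (t * G (step_path (Suc n) (psum \<xi>))) \<partial>grid_law (Suc n) (nat \<lceil>Suc n * R\<rceil> + 1))"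
    proof
      fix n
      \<comment> \<open>The extra cell keeps \<open>L\<close> positive, as \<open>bm_onD(5)\<close>
        requires, even if \<open>R\<close> is not.\<close>
      define L where "L = nat \<lceil>Suc n * R\<rceil> + 1"
      have L: "real (Suc n) * R \<le> real L" "0 < L" unfolding L_def by linarith+
      have "(\<integral>\<xi>. iexp (t * G (step_path (Suc n) (psum \<xi>))) \<partial>grid_law (Suc n) L) =
         (\<integral>\<omega>. iexp (t * G (step_path (Suc n) (psum (grid_incr (Suc n) L X \<omega>)))) \<partial>M)"
        using step_psum_measurable[OF G L(1)]
        by (subst bm_onD(5)[OF X _ L(2), symmetric], simp, subst integral_distr)
          (auto intro!: measurable_grid_incr bm_onD(2)[OF X])
      also have "\<dots> = (\<integral>\<omega>. iexp (t * G (step_path (Suc n) (sample (Suc n) (\<lambda>t. X t \<omega>)))) \<partial>M)"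
        by (intro Bochner_Integration.integral_cong refl)
          (simp add: step_grid_incr[OF G L(1)] bm_onD(3)[OF X])
      finally show "(\<integral>\<omega>. iexp (t * G (step_path (Suc n) (sample (Suc n) (\<lambda>t. X t \<omega>)))) \<partial>M) =
        (\<integral>\<xi>. iexp (t * G (step_path (Suc n) (psum \<xi>))) \<partial>grid_law (Suc n) (nat \<lceil>Suc n * R\<rceil> + 1))"
        by (simp add: L_def)
    qed
    also have "(\<integral>\<omega>. iexp (t * G (\<lambda>t. X t \<omega>)) \<partial>M) = char (distr M borel (\<lambda>\<omega>. G (\<lambda>t. X t \<omega>))) t"
      unfolding char_def using meas by (subst integral_distr) auto
    finally show ?thesis .
  qed
  have rd: "real_distribution (distr M borel (\<lambda>\<omega>. G (\<lambda>t. X t \<omega>)))"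
    if X: "bm_on M X" for M :: "'c measure" and X
  proof -
    interpret prob_space M by (rule bm_onD(1)[OF X])
    show ?thesis by (rule real_distribution_distr) (rule borel_measurable_shift_mono[OF G bm_onD(2)[OF X] bm_onD(4)[OF X]])
  qed
  show ?thesis
    by (intro Levy_uniqueness rd X Y ext LIMSEQ_unique[OF lim[OF X] lim[OF Y]])
qed

lemma bm_on_nn_integral_eq:
  assumes X: "bm_on M X" and Y: "bm_on N Y" and G: "shift_mono R G" and h: "h \<in> borel_measurable borel"
  shows "(\<integral>\<^sup>+\<omega>. h (G (\<lambda>t. X t \<omega>)) \<partial>M) = (\<integral>\<^sup>+\<omega>. h (G (\<lambda>t. Y t \<omega>)) \<partial>N)"
proof -
  have *: "(\<integral>\<^sup>+\<omega>. h (G (\<lambda>t. X t \<omega>)) \<partial>M) = (\<integral>\<^sup>+x. h x \<partial>distr M borel (\<lambda>\<omega>. G (\<lambda>t. X t \<omega>)))"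
    if X: "bm_on M X" for M :: "'c measure" and X
    by (rule nn_integral_distr[symmetric]) (auto intro!: borel_measurable_shift_mono[OF G bm_onD(2)[OF X] bm_onD(4)[OF X]] h)
  show ?thesis by (simp only: *[OF X] *[OF Y] bm_on_law[OF X Y G])
qed

section \<open>Change of measure: the Cameron-Martin shift\<close>

lemma normal_tilt:
  assumes "0 < v" and A: "A \<in> sets borel"
  shows "(\<integral>\<^sup>+x. ennreal (exp (x - v / 2)) * indicator A x \<partial>density lborel (normal_density 0 (sqrt v))) =
    emeasure (density lborel (normal_density 0 (sqrt v))) {x. x + v \<in> A}"
proof -
  have [measurable]: "A \<in> sets borel" by fact
  \<comment> \<open>Completing the square: the weight \<open>exp (x - v / 2)\<close> moves the mean
    of the normal law from 0 to its variance \<open>v\<close>.\<close>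
  have eq: "normal_density 0 (sqrt v) (x + v) * exp (x + v - v / 2) = normal_density 0 (sqrt v) x" for x
  proof -
    have "- (x + v)\<^sup>2 / (2 * v) + (x + v - v / 2) = - x\<^sup>2 / (2 * v)"
      using assms(1) by (simp add: field_simps power2_eq_square)
    then show ?thesis
      using assms(1) unfolding normal_density_def by (simp add: exp_add[symmetric])
  qed
  have "(\<integral>\<^sup>+x. ennreal (exp (x - v / 2)) * indicator A x \<partial>density lborel (normal_density 0 (sqrt v))) =
    (\<integral>\<^sup>+x. ennreal (normal_density 0 (sqrt v) x) * (ennreal (exp (x - v / 2)) * indicator A x) \<partial>lborel)"
    by (subst nn_integral_density) auto
  also have "\<dots> = (\<integral>\<^sup>+x. ennreal (normal_density 0 (sqrt v) (x + v)) *
       (ennreal (exp (x + v - v / 2)) * indicator A (x + v)) \<partial>lborel)"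
    by (subst nn_integral_real_affine[of _ 1 v]) (auto simp: add.commute)
  also have "\<dots> = (\<integral>\<^sup>+x. ennreal (normal_density 0 (sqrt v) x) * indicator {x. x + v \<in> A} x \<partial>lborel)"
  proof (rule nn_integral_cong)
    fix x
    have "ennreal (normal_density 0 (sqrt v) (x + v)) * ennreal (exp (x + v - v / 2)) =
        ennreal (normal_density 0 (sqrt v) x)"
      by (subst ennreal_mult'[symmetric]) (simp_all only: eq normal_density_nonneg)
    then show "ennreal (normal_density 0 (sqrt v) (x + v)) * (ennreal (exp (x + v - v / 2)) * indicator A (x + v)) =
        ennreal (normal_density 0 (sqrt v) x) * indicator {x. x + v \<in> A} x"
      by (simp add: indicator_def)
  qed
  also have "\<dots> = emeasure (density lborel (normal_density 0 (sqrt v))) {x. x + v \<in> A}"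
    by (subst emeasure_density) auto
  finally show ?thesis .
qed

text \<open>The density factors over the first \<open>k\<close> increments, and each factor moves
  the mean of its increment to the variance \<open>1 / n\<close>. In terms of paths this is a drift
  of slope 1 that stops at time \<open>k / n\<close>.\<close>

lemma grid_girsanov:
  assumes "0 < n" "k \<le> L" and F: "F \<in> borel_measurable (\<Pi>\<^sub>M i\<in>{..<L}. borel)"
  shows "(\<integral>\<^sup>+\<xi>. ennreal (exp (psum \<xi> k - real k / real n / 2)) * F \<xi> \<partial>grid_law n L) =
    (\<integral>\<^sup>+\<xi>. F (\<lambda>i\<in>{..<L}. \<xi> i + (if i < k then 1 / real n else 0)) \<partial>grid_law n L)"
proof -
  define v where "v = 1 / real n"
  have v: "0 < v" using assms(1) by (simp add: v_def)
  let ?\<mu> = "density lborel (normal_density 0 (sqrt v))"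
  define s where "s i = (if i < k then v else 0)" for i :: nat
  define e where "e i x = ennreal (exp (if i < k then x - v / 2 else 0))" for i :: nat and x
  interpret \<mu>: prob_space ?\<mu> using v by (intro prob_space_normal_density) auto
  interpret product_prob_space "\<lambda>_. ?\<mu>" "{..<L}" ..
  have Pi: "(\<Pi>\<^sub>M i\<in>{..<L}. ?\<mu>) = grid_law n L" by (simp add: v_def)
  define \<nu> where "\<nu> i = distr ?\<mu> borel (\<lambda>x. x + s i)" for i
  interpret \<nu>: prob_space "\<nu> i" for i unfolding \<nu>_def by (rule \<mu>.prob_space_distr) simp
  interpret N: product_prob_space \<nu> "{..<L}" ..
  let ?sh = "\<lambda>\<xi>. \<lambda>i\<in>{..<L}. \<xi> i + s i"
  have sh: "?sh \<in> measurable (grid_law n L) (\<Pi>\<^sub>M i\<in>{..<L}. borel)"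
    by (intro measurable_restrict) measurable
  have tilt: "(\<integral>\<^sup>+x. e i x * indicator A x \<partial>?\<mu>) = emeasure (\<nu> i) A" if A: "A \<in> sets borel" for i A
  proof (cases "i < k")
    case True
    then show ?thesis using normal_tilt[OF v A] A
      by (simp add: e_def s_def \<nu>_def emeasure_distr vimage_def)
  next
    case False
    then show ?thesis using A by (simp add: e_def s_def \<nu>_def emeasure_distr vimage_def)
  qed
  have e_prod: "ennreal (exp (psum \<xi> k - real k / real n / 2)) = (\<Prod>i<L. e i (\<xi> i))" for \<xi>
  proof -
    have "(\<Prod>i<L. e i (\<xi> i)) = ennreal (exp (\<Sum>i<L. if i < k then \<xi> i - v / 2 else 0))"
      by (subst exp_sum) (auto simp: e_def prod_ennreal)
    also have "(\<Sum>i<L. if i < k then \<xi> i - v / 2 else 0) = (\<Sum>i<k. \<xi> i - v / 2)"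
      using assms(2) by (intro sum.mono_neutral_cong_right) auto
    also have "\<dots> = psum \<xi> k - real k / real n / 2"
      by (simp add: psum_def sum_subtractf v_def)
    finally show ?thesis by simp
  qed
  have e_meas [measurable]: "e i \<in> borel_measurable borel" for i unfolding e_def by measurable
  have E_meas: "(\<lambda>\<xi>. ennreal (exp (psum \<xi> k - real k / real n / 2))) \<in> borel_measurable (grid_law n L)"
    using psum_measurable[OF assms(2)] by measurable
  \<comment> \<open>The tilted law here and the shifted law in \<open>B\<close> are both recognised
    as the product of the \<open>\<nu> i\<close> by their values on boxes, where the tilt splits
    into one-dimensional integrals.\<close>
  have A: "density (grid_law n L) (\<lambda>\<xi>. ennreal (exp (psum \<xi> k - real k / real n / 2))) = PiM {..<L} \<nu>"
  proof (rule N.PiM_eqI)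
    show "sets (density (grid_law n L) (\<lambda>\<xi>. ennreal (exp (psum \<xi> k - real k / real n / 2)))) = sets (PiM {..<L} \<nu>)"
      by (simp add: \<nu>_def cong: sets_PiM_cong)
    fix A :: "nat \<Rightarrow> real set" assume "\<And>i. i \<in> {..<L} \<Longrightarrow> A i \<in> sets (\<nu> i)"
    then have A: "i < L \<Longrightarrow> A i \<in> sets borel" for i by (auto simp: \<nu>_def)
    have box: "Pi\<^sub>E {..<L} A \<in> sets (grid_law n L)"
      using A by (auto intro!: sets_PiM_I_finite)
    have "emeasure (density (grid_law n L) (\<lambda>\<xi>. ennreal (exp (psum \<xi> k - real k / real n / 2)))) (Pi\<^sub>E {..<L} A)
      = (\<integral>\<^sup>+\<xi>. (\<Prod>i<L. e i (\<xi> i) * indicator (A i) (\<xi> i)) \<partial>grid_law n L)"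
    proof (subst emeasure_density[OF E_meas box], rule nn_integral_cong)
      fix \<xi> assume "\<xi> \<in> space (grid_law n L)"
      then have "\<xi> \<in> Pi\<^sub>E {..<L} A \<longleftrightarrow> (\<forall>i<L. \<xi> i \<in> A i)"
        by (auto simp: PiE_iff space_PiM)
      then have "indicator (Pi\<^sub>E {..<L} A) \<xi> = (\<Prod>i<L. indicator (A i) (\<xi> i) :: ennreal)"
        by (auto simp: indicator_def prod_zero_iff)
      then show "ennreal (exp (psum \<xi> k - real k / real n / 2)) * indicator (Pi\<^sub>E {..<L} A) \<xi> =
          (\<Prod>i<L. e i (\<xi> i) * indicator (A i) (\<xi> i))"
        by (simp only: e_prod prod.distrib)
    qed
    also have "\<dots> = (\<Prod>i<L. \<integral>\<^sup>+x. e i x * indicator (A i) x \<partial>?\<mu>)"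
      unfolding Pi[symmetric] by (rule product_nn_integral_prod) (use A in auto)
    also have "\<dots> = (\<Prod>i<L. emeasure (\<nu> i) (A i))"
      using A by (intro prod.cong tilt) auto
    finally show "emeasure (density (grid_law n L) (\<lambda>\<xi>. ennreal (exp (psum \<xi> k - real k / real n / 2)))) (Pi\<^sub>E {..<L} A)
      = (\<Prod>i<L. emeasure (\<nu> i) (A i))" .
  qed simp
  have B: "distr (grid_law n L) (\<Pi>\<^sub>M i\<in>{..<L}. borel) ?sh = PiM {..<L} \<nu>"
  proof (rule N.PiM_eqI)
    show "sets (distr (grid_law n L) (\<Pi>\<^sub>M i\<in>{..<L}. borel) ?sh) = sets (PiM {..<L} \<nu>)"
      by (simp add: \<nu>_def cong: sets_PiM_cong)
    fix A :: "nat \<Rightarrow> real set" assume "\<And>i. i \<in> {..<L} \<Longrightarrow> A i \<in> sets (\<nu> i)"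
    then have A: "i < L \<Longrightarrow> A i \<in> sets borel" for i by (auto simp: \<nu>_def)
    have box: "Pi\<^sub>E {..<L} A \<in> sets (\<Pi>\<^sub>M i\<in>{..<L}. borel)"
      using A by (auto intro!: sets_PiM_I_finite)
    have "?sh -` Pi\<^sub>E {..<L} A \<inter> space (grid_law n L) = Pi\<^sub>E {..<L} (\<lambda>i. (\<lambda>x. x + s i) -` A i)"
      by (auto simp: space_PiM PiE_iff)
    then have "emeasure (distr (grid_law n L) (\<Pi>\<^sub>M i\<in>{..<L}. borel) ?sh) (Pi\<^sub>E {..<L} A) =
      emeasure (\<Pi>\<^sub>M i\<in>{..<L}. ?\<mu>) (Pi\<^sub>E {..<L} (\<lambda>i. (\<lambda>x. x + s i) -` A i))"
      by (subst emeasure_distr[OF sh box]) (simp add: v_def)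
    also have "\<dots> = (\<Prod>i<L. emeasure ?\<mu> ((\<lambda>x. x + s i) -` A i))"
    proof (rule emeasure_PiM)
      fix i assume "i \<in> {..<L}"
      then have "A i \<in> sets borel" using A by auto
      then show "(\<lambda>x. x + s i) -` A i \<in> sets ?\<mu>"
        using measurable_sets[of "\<lambda>x. x + s i" borel borel "A i"] by simp
    qed simp
    also have "\<dots> = (\<Prod>i<L. emeasure (\<nu> i) (A i))"
      using A by (intro prod.cong refl) (auto simp: \<nu>_def emeasure_distr)
    finally show "emeasure (distr (grid_law n L) (\<Pi>\<^sub>M i\<in>{..<L}. borel) ?sh) (Pi\<^sub>E {..<L} A) =
      (\<Prod>i<L. emeasure (\<nu> i) (A i))" .
  qed simp
  have F': "F \<in> borel_measurable (grid_law n L)"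
    using F by (simp add: measurable_cong_sets[OF sets_grid_law refl])
  have "(\<integral>\<^sup>+\<xi>. ennreal (exp (psum \<xi> k - real k / real n / 2)) * F \<xi> \<partial>grid_law n L) =
     (\<integral>\<^sup>+\<xi>. F \<xi> \<partial>density (grid_law n L) (\<lambda>\<xi>. ennreal (exp (psum \<xi> k - real k / real n / 2))))"
    by (rule nn_integral_density[symmetric, OF E_meas F'])
  also have "\<dots> = (\<integral>\<^sup>+\<xi>. F \<xi> \<partial>distr (grid_law n L) (\<Pi>\<^sub>M i\<in>{..<L}. borel) ?sh)"
    by (simp only: A B)
  also have "\<dots> = (\<integral>\<^sup>+\<xi>. F (?sh \<xi>) \<partial>grid_law n L)"
    by (rule nn_integral_distr[OF sh]) (use F in simp)
  finally show ?thesis by (simp only: s_def v_def)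
qed

lemma continuous_add_min:
  fixes f :: "real \<Rightarrow> real"
  assumes "continuous_on {0..} f"
  shows "continuous_on {0..} (\<lambda>t. f t + min t T)"
  using assms by (intro continuous_intros)

text \<open>Writing \<open>exp G\<close> as \<open>exp X_T\<close> times
  \<open>exp (G - X_T)\<close> isolates the density of the shift. Capping the second factor at
  \<open>K\<close> provides the majorants needed when the mesh goes to 0: \<open>K\<close> times the
  density before the shift, the constant \<open>K\<close> after it.\<close>

lemma bm_girsanov_truncated:
  fixes T :: nat and K :: nat and X :: "real \<Rightarrow> 'a \<Rightarrow> real" and G :: "(real \<Rightarrow> real) \<Rightarrow> real"
  assumes X: "bm_on M X" and G: "shift_mono R G" and T: "real T \<le> R"
  shows "(\<integral>\<^sup>+\<omega>. ennreal (exp (X T \<omega> - T / 2) * min (exp (G (\<lambda>t. X t \<omega>) - X T \<omega>)) K) \<partial>M) =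
    (\<integral>\<^sup>+\<omega>. ennreal (min (exp (G (\<lambda>t. X t \<omega> + min t T) - X T \<omega> - T)) K) \<partial>M)"
proof -
  interpret prob_space M by (rule bm_onD(1)[OF X])
  define Y where "Y t \<omega> = X t \<omega> + min t (real T)" for t \<omega>
  have XT [measurable]: "X (real T) \<in> borel_measurable M" by (rule bm_onD(2)[OF X]) simp
  have Xt: "(\<lambda>\<omega>. X t \<omega>) \<in> borel_measurable M" if "0 \<le> t" for t by (rule bm_onD(2)[OF X that])
  have cX: "continuous_on {0..} (\<lambda>t. X t \<omega>)" if "\<omega> \<in> space M" for \<omega> by (rule bm_onD(4)[OF X that])
  have cY: "continuous_on {0..} (\<lambda>t. Y t \<omega>)" if "\<omega> \<in> space M" for \<omega>
    unfolding Y_def by (rule continuous_add_min[OF cX[OF that]])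
  have sX [measurable]: "(\<lambda>\<omega>. G (step_path n (sample n (\<lambda>t. X t \<omega>)))) \<in> borel_measurable M" for n
    by (rule borel_measurable_step_path_comp[OF G]) (auto simp: sample_def intro!: Xt)
  have sY [measurable]: "(\<lambda>\<omega>. G (step_path n (sample n (\<lambda>t. Y t \<omega>)))) \<in> borel_measurable M" for n
    by (rule borel_measurable_step_path_comp[OF G]) (auto simp: sample_def Y_def intro!: borel_measurable_add Xt)
  have grid: "(\<integral>\<^sup>+\<omega>. ennreal (exp (X T \<omega> - T / 2)) * ennreal (min (exp (G (step_path n (sample n (\<lambda>t. X t \<omega>))) - X T \<omega>)) K) \<partial>M) =
    (\<integral>\<^sup>+\<omega>. ennreal (min (exp (G (step_path n (sample n (\<lambda>t. Y t \<omega>))) - Y T \<omega>)) K) \<partial>M)"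
    if n: "0 < n" for n
  proof -
    define L where "L = nat \<lceil>real n * R\<rceil> + 1"
    have L: "real n * R \<le> real L" "0 < L" unfolding L_def by linarith+
    have "real n * real T \<le> real n * R" using T by (intro mult_left_mono) auto
    then have "real (n * T) \<le> real L" using L(1) by simp
    then have nT: "n * T \<le> L" by (simp only: of_nat_le_iff)
    define F where "F \<xi> = ennreal (min (exp (G (step_path n (psum \<xi>)) - psum \<xi> (n * T))) K)" for \<xi>
    have F: "F \<in> borel_measurable (\<Pi>\<^sub>M i\<in>{..<L}. borel)"
      unfolding F_def using step_psum_measurable[OF G L(1)] psum_measurable[OF nT] by measurable
    have E: "(\<lambda>\<xi>. ennreal (exp (psum \<xi> (n * T) - real (n * T) / real n / 2))) \<in> borel_measurable (\<Pi>\<^sub>M i\<in>{..<L}. borel)"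
      using psum_measurable[OF nT] by measurable
    let ?sh = "\<lambda>\<xi>. \<lambda>i\<in>{..<L}. \<xi> i + (if i < n * T then 1 / real n else 0)"
    have shm: "?sh \<in> measurable (\<Pi>\<^sub>M i\<in>{..<L}. borel) (\<Pi>\<^sub>M i\<in>{..<L}. borel)"
      by (intro measurable_restrict) measurable
    \<comment> \<open>Since \<open>T\<close> is a natural number it lies on every grid, at index
      \<open>n * T\<close>. The kink of \<open>min t T\<close> thus never falls inside a cell: each
      cell gains all of \<open>1 / n\<close> or nothing.\<close>
    have sh: "grid_incr n L Y \<omega> = ?sh (grid_incr n L X \<omega>)" for \<omega>
    proof (rule ext)
      fix i
      consider "i < n * T" | "n * T \<le> i" by linarith
      then show "grid_incr n L Y \<omega> i = ?sh (grid_incr n L X \<omega>) i"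
      proof cases
        case 1
        then have "real (Suc i) \<le> real (n * T)" by (simp only: of_nat_le_iff)
        then have "real (Suc i) / real n \<le> real T" using n by (simp add: field_simps)
        moreover have "real i / real n \<le> real (Suc i) / real n" by (intro divide_right_mono) auto
        ultimately have "min (real i / real n) (real T) = real i / real n"
          "min (real (Suc i) / real n) (real T) = real (Suc i) / real n" by auto
        with 1 show ?thesis by (simp add: grid_incr_def Y_def add_divide_distrib)
      next
        case 2
        then have "real (n * T) \<le> real i" by (simp only: of_nat_le_iff)
        then have "real T \<le> real i / real n" using n by (simp add: field_simps)
        moreover have "real i / real n \<le> real (Suc i) / real n" by (intro divide_right_mono) auto
        ultimately have "min (real i / real n) (real T) = real T"
          "min (real (Suc i) / real n) (real T) = real T" by auto
        with 2 show ?thesis by (simp add: grid_incr_def Y_def)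
      qed
    qed
    have 1: "psum (grid_incr n L X \<omega>) (n * T) = X T \<omega>" if "\<omega> \<in> space M" for \<omega>
      using bm_onD(3)[OF X that] nT n by (simp add: psum_grid_incr sample_def)
    have 2: "psum (grid_incr n L Y \<omega>) (n * T) = Y T \<omega>" if "\<omega> \<in> space M" for \<omega>
      using bm_onD(3)[OF X that] nT n by (simp add: psum_grid_incr sample_def Y_def)
    have "(\<integral>\<^sup>+\<omega>. ennreal (exp (X T \<omega> - T / 2)) * ennreal (min (exp (G (step_path n (sample n (\<lambda>t. X t \<omega>))) - X T \<omega>)) K) \<partial>M)
      = (\<integral>\<^sup>+\<omega>. ennreal (exp (psum (grid_incr n L X \<omega>) (n * T) - real (n * T) / real n / 2)) * F (grid_incr n L X \<omega>) \<partial>M)"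
      using n by (intro nn_integral_cong) (simp add: 1 F_def step_grid_incr[OF G L(1)] bm_onD(3)[OF X])
    also have "\<dots> = (\<integral>\<^sup>+\<xi>. ennreal (exp (psum \<xi> (n * T) - real (n * T) / real n / 2)) * F \<xi> \<partial>grid_law n L)"
      by (rule bm_on_nn_integral[OF X n L(2)]) (intro borel_measurable_times_ennreal E F)
    also have "\<dots> = (\<integral>\<^sup>+\<xi>. F (?sh \<xi>) \<partial>grid_law n L)"
      by (rule grid_girsanov[OF n nT F])
    also have "\<dots> = (\<integral>\<^sup>+\<omega>. F (?sh (grid_incr n L X \<omega>)) \<partial>M)"
      by (rule bm_on_nn_integral[OF X n L(2), symmetric]) (rule measurable_compose[OF shm F])
    also have "\<dots> = (\<integral>\<^sup>+\<omega>. F (grid_incr n L Y \<omega>) \<partial>M)" by (simp only: sh)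
    also have "\<dots> = (\<integral>\<^sup>+\<omega>. ennreal (min (exp (G (step_path n (sample n (\<lambda>t. Y t \<omega>))) - Y T \<omega>)) K) \<partial>M)"
      by (intro nn_integral_cong) (simp add: 2 F_def step_grid_incr[OF G L(1)] bm_onD(3)[OF X] Y_def)
    finally show ?thesis .
  qed
  \<comment> \<open>The total mass of the density follows from the grid identity with constant
    \<open>F\<close> and mesh 1.\<close>
  have one: "(\<integral>\<^sup>+\<omega>. ennreal (exp (X T \<omega> - T / 2)) \<partial>M) = 1"
  proof -
    have T1: "T \<le> T + 1" by simp
    have E: "(\<lambda>\<xi>. ennreal (exp (psum \<xi> T - real T / real 1 / 2)) * 1) \<in> borel_measurable (\<Pi>\<^sub>M i\<in>{..<T+1}. borel)"
      using psum_measurable[OF T1] by measurable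
    interpret g: prob_space "grid_law 1 (T+1)"
      by (subst bm_onD(5)[OF X, symmetric]) (auto intro!: prob_space_distr measurable_grid_incr Xt)
    have "(\<integral>\<^sup>+\<omega>. ennreal (exp (X T \<omega> - T / 2)) \<partial>M) =
        (\<integral>\<^sup>+\<omega>. ennreal (exp (psum (grid_incr 1 (T+1) X \<omega>) T - real T / real 1 / 2)) * 1 \<partial>M)"
      by (intro nn_integral_cong) (simp add: psum_grid_incr bm_onD(3)[OF X] sample_def)
    also have "\<dots> = 1"
      using grid_girsanov[of 1 T "T + 1" "\<lambda>_. 1"] g.emeasure_space_1
      by (subst bm_on_nn_integral[OF X _ _ E]) (simp_all del: space_grid_law)
    finally show ?thesis .
  qed
  have lim1: "(\<lambda>n. \<integral>\<^sup>+\<omega>. ennreal (exp (X T \<omega> - T / 2)) * ennreal (min (exp (G (step_path (Suc n) (sample (Suc n) (\<lambda>t. X t \<omega>))) - X T \<omega>)) K) \<partial>M)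
     \<longlonglongrightarrow> (\<integral>\<^sup>+\<omega>. ennreal (exp (X T \<omega> - T / 2)) * ennreal (min (exp (G (\<lambda>t. X t \<omega>) - X T \<omega>)) K) \<partial>M)"
  proof (rule nn_integral_dominated_convergence[where w = "\<lambda>\<omega>. ennreal K * ennreal (exp (X T \<omega> - T / 2))"])
    show "(\<integral>\<^sup>+\<omega>. ennreal K * ennreal (exp (X T \<omega> - T / 2)) \<partial>M) < \<infinity>"
      by (subst nn_integral_cmult) (auto simp: one)
    show "AE \<omega> in M. (\<lambda>n. ennreal (exp (X T \<omega> - T / 2)) * ennreal (min (exp (G (step_path (Suc n) (sample (Suc n) (\<lambda>t. X t \<omega>))) - X T \<omega>)) K))
       \<longlonglongrightarrow> ennreal (exp (X T \<omega> - T / 2)) * ennreal (min (exp (G (\<lambda>t. X t \<omega>) - X T \<omega>)) K)"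
      by (auto intro!: AE_I2 ennreal_tendsto_cmult tendsto_ennrealI tendsto_intros LIMSEQ_Suc[OF tendsto_step_path[OF G cX]])
    show "AE \<omega> in M. ennreal (exp (X T \<omega> - T / 2)) * ennreal (min (exp (G (step_path (Suc n) (sample (Suc n) (\<lambda>t. X t \<omega>))) - X T \<omega>)) K)
       \<le> ennreal K * ennreal (exp (X T \<omega> - T / 2))" for n
      by (subst mult.commute) (auto intro!: AE_I2 mult_right_mono ennreal_leI)
  qed (use borel_measurable_shift_mono[OF G Xt cX] in measurable)
  have lim2: "(\<lambda>n. \<integral>\<^sup>+\<omega>. ennreal (min (exp (G (step_path (Suc n) (sample (Suc n) (\<lambda>t. Y t \<omega>))) - Y T \<omega>)) K) \<partial>M)
     \<longlonglongrightarrow> (\<integral>\<^sup>+\<omega>. ennreal (min (exp (G (\<lambda>t. Y t \<omega>) - Y T \<omega>)) K) \<partial>M)"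
  proof (rule nn_integral_dominated_convergence[where w = "\<lambda>\<omega>. ennreal K"])
    show "AE \<omega> in M. (\<lambda>n. ennreal (min (exp (G (step_path (Suc n) (sample (Suc n) (\<lambda>t. Y t \<omega>))) - Y T \<omega>)) K))
       \<longlonglongrightarrow> ennreal (min (exp (G (\<lambda>t. Y t \<omega>) - Y T \<omega>)) K)"
      by (auto intro!: AE_I2 tendsto_ennrealI tendsto_intros LIMSEQ_Suc[OF tendsto_step_path[OF G cY]])
    have [measurable]: "Y (real T) \<in> borel_measurable M" unfolding Y_def by measurable
    have [measurable]: "(\<lambda>\<omega>. G (\<lambda>t. Y t \<omega>)) \<in> borel_measurable M"
      by (rule borel_measurable_shift_mono[OF G _ cY]) (auto simp: Y_def intro!: borel_measurable_add Xt)
    show "(\<lambda>\<omega>. ennreal (min (exp (G (\<lambda>t. Y t \<omega>) - Y T \<omega>)) K)) \<in> borel_measurable M" by measurable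
    show "(\<lambda>\<omega>. ennreal (min (exp (G (step_path (Suc n) (sample (Suc n) (\<lambda>t. Y t \<omega>))) - Y T \<omega>)) K)) \<in> borel_measurable M" for n
      by measurable
  qed (auto intro!: AE_I2 ennreal_leI simp: emeasure_space_1 ennreal_mult_less_top)
  have "(\<integral>\<^sup>+\<omega>. ennreal (exp (X T \<omega> - T / 2)) * ennreal (min (exp (G (\<lambda>t. X t \<omega>) - X T \<omega>)) K) \<partial>M) =
     (\<integral>\<^sup>+\<omega>. ennreal (min (exp (G (\<lambda>t. Y t \<omega>) - Y T \<omega>)) K) \<partial>M)"
    by (rule LIMSEQ_unique[OF lim1 lim2[folded grid[OF zero_less_Suc]]])
  then show ?thesis
    by (simp only: Y_def min.idem diff_diff_eq ennreal_mult'[OF exp_ge_zero])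
qed

text \<open>Monotone convergence in \<open>K\<close> removes the cap on both sides, so no
  integrability has to be known beforehand.\<close>

lemma bm_girsanov:
  fixes T :: nat and X :: "real \<Rightarrow> 'a \<Rightarrow> real" and G :: "(real \<Rightarrow> real) \<Rightarrow> real"
  assumes X: "bm_on M X" and G: "shift_mono R G" and T: "real T \<le> R"
  shows "(\<integral>\<^sup>+\<omega>. ennreal (exp (G (\<lambda>t. X t \<omega>) - T / 2)) \<partial>M) =
    (\<integral>\<^sup>+\<omega>. ennreal (exp (G (\<lambda>t. X t \<omega> + min t T) - X T \<omega> - T)) \<partial>M)"
proof -
  have XT [measurable]: "X (real T) \<in> borel_measurable M" by (rule bm_onD(2)[OF X]) simp
  have [measurable]: "(\<lambda>\<omega>. G (\<lambda>t. X t \<omega>)) \<in> borel_measurable M"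
    by (rule borel_measurable_shift_mono[OF G bm_onD(2)[OF X] bm_onD(4)[OF X]])
  have [measurable]: "(\<lambda>\<omega>. G (\<lambda>t. X t \<omega> + min t T)) \<in> borel_measurable M"
    by (rule borel_measurable_shift_mono[OF G])
      (auto intro!: borel_measurable_add bm_onD(2)[OF X] continuous_add_min bm_onD(4)[OF X])
  have min_lim: "(\<lambda>K. ennreal (c * min y (real K))) \<longlonglongrightarrow> ennreal (c * y)" for c y :: real
  proof (rule tendsto_eventually)
    obtain N :: nat where "y \<le> real N" using real_arch_simple by blast
    then show "\<forall>\<^sub>F K in sequentially. ennreal (c * min y (real K)) = ennreal (c * y)"
      by (intro eventually_sequentiallyI[of N]) (simp add: min_def)
  qed
  have inc: "incseq (\<lambda>K \<omega>. ennreal (c \<omega> * min (y \<omega>) (real K)))" if "\<And>\<omega>. 0 \<le> c \<omega>" for c y :: "'a \<Rightarrow> real"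
    using that by (auto simp: incseq_def le_fun_def intro!: ennreal_leI mult_left_mono)
  have l1: "(\<lambda>K::nat. \<integral>\<^sup>+\<omega>. ennreal (exp (X T \<omega> - T / 2) * min (exp (G (\<lambda>t. X t \<omega>) - X T \<omega>)) K) \<partial>M)
     \<longlonglongrightarrow> (\<integral>\<^sup>+\<omega>. ennreal (exp (X T \<omega> - T / 2) * exp (G (\<lambda>t. X t \<omega>) - X T \<omega>)) \<partial>M)"
    by (rule nn_integral_LIMSEQ[OF inc _ min_lim]) auto
  have l2: "(\<lambda>K::nat. \<integral>\<^sup>+\<omega>. ennreal (1 * min (exp (G (\<lambda>t. X t \<omega> + min t T) - X T \<omega> - T)) K) \<partial>M)
     \<longlonglongrightarrow> (\<integral>\<^sup>+\<omega>. ennreal (1 * exp (G (\<lambda>t. X t \<omega> + min t T) - X T \<omega> - T)) \<partial>M)"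
    by (rule nn_integral_LIMSEQ[OF inc _ min_lim]) auto
  show ?thesis
    using LIMSEQ_unique[OF l1 l2[simplified, folded bm_girsanov_truncated[OF X G T]]]
    by (simp add: exp_add[symmetric])
qed

subsection \<open>Maximal inequalities\<close>

lemma sbmD:
  assumes "standard_brownian_motion M B"
  shows "prob_space M" "\<And>t. 0 \<le> t \<Longrightarrow> B t \<in> borel_measurable M"
    "\<And>\<omega>. \<omega> \<in> space M \<Longrightarrow> B 0 \<omega> = 0"
    "\<And>\<omega>. \<omega> \<in> space M \<Longrightarrow> continuous_on {0..} (\<lambda>t. B t \<omega>)"
    "\<And>s t. 0 \<le> s \<Longrightarrow> s < t \<Longrightarrow>
        distributed M lborel (\<lambda>\<omega>. B t \<omega> - B s \<omega>) (normal_density 0 (sqrt (t - s)))"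
    "\<And>(n::nat) \<tau>. 0 \<le> \<tau> 0 \<Longrightarrow> (\<And>i. i < n \<Longrightarrow> \<tau> i \<le> \<tau> (Suc i)) \<Longrightarrow>
        prob_space.indep_vars M (\<lambda>_. borel) (\<lambda>i \<omega>. B (\<tau> (Suc i)) \<omega> - B (\<tau> i) \<omega>) {..<n}"
  using assms unfolding standard_brownian_motion_def by auto

lemma sbm_at:
  assumes B: "standard_brownian_motion M B" and "0 < t"
  shows "measure M {\<omega>\<in>space M. B t \<omega> > x} = gtail (x / sqrt t)"
proof -
  have "{\<omega>\<in>space M. B t \<omega> > x} = {\<omega>\<in>space M. B t \<omega> - B 0 \<omega> > x}"
    using sbmD(3)[OF B] by auto
  then show ?thesis
    using distributed_normal_tail(1)[OF sbmD(5)[OF B order_refl assms(2)] _ sbmD(1)[OF B]] assms(2) by simp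
qed

text \<open>Fatou's lemma for events: \<open>E\<close> lies in the increasing union of the tail
  intersections \<open>D N\<close>. The bound is asked at \<open>Suc n\<close> because the events
  come from grids or thresholds involving \<open>1 / n\<close>.\<close>

lemma (in prob_space) prob_eventually_le:
  assumes "\<And>n. A n \<in> events" "\<And>\<omega>. \<omega> \<in> E \<Longrightarrow> eventually (\<lambda>n. \<omega> \<in> A n) sequentially"
    and "\<And>n. prob (A (Suc n)) \<le> c"
  shows "prob E \<le> c"
proof -
  define D where "D N = (\<Inter>n\<in>{N..}. A (Suc n))" for N
  have D: "D N \<in> events" for N unfolding D_def using assms(1) by auto
  have "incseq D" unfolding D_def incseq_def by (auto intro: INF_superset_mono)
  then have "(\<lambda>N. prob (D N)) \<longlonglongrightarrow> prob (\<Union>N. D N)"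
    using D by (intro finite_Lim_measure_incseq) auto
  moreover have "prob (D N) \<le> c" for N
    using finite_measure_mono[OF _ assms(1), of "D N" "Suc N"] assms(3)[of N] unfolding D_def by force
  ultimately have "prob (\<Union>N. D N) \<le> c" by (intro LIMSEQ_le_const2) auto
  moreover have "E \<subseteq> (\<Union>N. D N)"
  proof
    fix \<omega> assume "\<omega> \<in> E"
    from assms(2)[OF this] obtain N where "\<And>n. n \<ge> N \<Longrightarrow> \<omega> \<in> A n" by (auto simp: eventually_sequentially)
    then show "\<omega> \<in> (\<Union>N. D N)" unfolding D_def by (intro UN_I[of N]) auto
  qed
  ultimately show ?thesis
    using finite_measure_mono[of E "\<Union>N. D N"] D by (meson order_trans sets.countable_UN image_subsetI)
qed

lemma (in prob_space) prob_eventually_null: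
  assumes "\<And>n. A n \<in> events" "\<And>\<omega>. \<omega> \<in> space M \<Longrightarrow> eventually (\<lambda>n. \<omega> \<notin> A n) sequentially"
  shows "(\<lambda>n. prob (A n)) \<longlonglongrightarrow> 0"
proof -
  have "(\<lambda>n. \<integral>\<omega>. indicator (A n) \<omega> \<partial>M) \<longlonglongrightarrow> (\<integral>\<omega>. (0::real) \<partial>M)"
  proof (rule integral_dominated_convergence[where w = "\<lambda>_. 1"])
    show "AE \<omega> in M. (\<lambda>n. indicator (A n) \<omega> :: real) \<longlonglongrightarrow> 0"
    proof (rule AE_I2)
      fix \<omega> assume "\<omega> \<in> space M"
      from assms(2)[OF this] show "(\<lambda>n. indicator (A n) \<omega> :: real) \<longlonglongrightarrow> 0"
        by (intro tendsto_eventually) (auto elim: eventually_mono)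
    qed
  qed (use assms(1) in auto)
  then show ?thesis using assms(1) sets.sets_into_space by (simp add: Int_absorb2)
qed

section \<open>Decomposition at the first passage, in discrete time\<close>

context prob_space
begin

text \<open>The events \<open>E k\<close> take the place of a stopping time: each is a condition on
  the walk up to \<open>k\<close>, and they partition the event that the level is exceeded by time
  \<open>n\<close>.\<close>

lemma first_passage:
  fixes S :: "nat \<Rightarrow> 'a \<Rightarrow> real" and x :: real
  assumes S: "\<And>k. S k \<in> borel_measurable M"
  defines "E \<equiv> \<lambda>k. {\<omega>\<in>space M. S k \<omega> > x \<and> (\<forall>j<k. S j \<omega> \<le> x)}"
  shows "E k \<in> events" and "(\<Sum>k\<le>n. prob (E k)) = prob {\<omega>\<in>space M. \<exists>k\<le>n. S k \<omega> > x}"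
    and "A \<in> events \<Longrightarrow> A \<subseteq> {\<omega>\<in>space M. \<exists>k\<le>n. S k \<omega> > x} \<Longrightarrow> (\<Sum>k\<le>n. prob (E k \<inter> A)) = prob A"
proof -
  note S[measurable]
  show E: "E k \<in> events" for k unfolding E_def by measurable
  have disj: "disjoint_family_on E {..n}"
    unfolding disjoint_family_on_def E_def by (auto simp: not_less) (metis linorder_neqE_nat not_less)
  have un: "(\<Union>k\<le>n. E k) = {\<omega>\<in>space M. \<exists>k\<le>n. S k \<omega> > x}"
  proof (intro equalityI subsetI)
    fix \<omega> assume "\<omega> \<in> {\<omega>\<in>space M. \<exists>k\<le>n. S k \<omega> > x}"
    then obtain k where k: "\<omega> \<in> space M" "k \<le> n" "S k \<omega> > x" by auto
    define l where "l = (LEAST k. S k \<omega> > x)"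
    have "S l \<omega> > x" unfolding l_def using k(3) by (rule LeastI)
    moreover have "l \<le> k" unfolding l_def using k(3) by (rule Least_le)
    moreover have "\<forall>j<l. S j \<omega> \<le> x" unfolding l_def using not_less_Least not_less by blast
    ultimately show "\<omega> \<in> (\<Union>k\<le>n. E k)" using k by (auto simp: E_def)
  qed (auto simp: E_def)
  show "(\<Sum>k\<le>n. prob (E k)) = prob {\<omega>\<in>space M. \<exists>k\<le>n. S k \<omega> > x}"
    unfolding un[symmetric] using E by (intro finite_measure_finite_Union[symmetric] disj) auto
  assume A: "A \<in> events" "A \<subseteq> {\<omega>\<in>space M. \<exists>k\<le>n. S k \<omega> > x}"
  have "(\<Sum>k\<le>n. prob (E k \<inter> A)) = prob (\<Union>k\<le>n. E k \<inter> A)"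
    using E A(1) by (intro finite_measure_finite_Union[symmetric] disjoint_family_on_bisimulation[OF disj]) auto
  also have "(\<Union>k\<le>n. E k \<inter> A) = A" using A(2) un by auto
  finally show "(\<Sum>k\<le>n. prob (E k \<inter> A)) = prob A" .
qed

text \<open>If the walk does not fall between its first passage and time \<open>n\<close>, it ends
  above \<open>x\<close> as well. The number \<open>\<kappa>\<close> bounds the conditional
  probability of this from below.\<close>

lemma maximal_upper:
  fixes S :: "nat \<Rightarrow> 'a \<Rightarrow> real" and x :: real
  assumes S: "\<And>k. S k \<in> borel_measurable M"
    and ind: "\<And>k. k \<le> n \<Longrightarrow> \<kappa> * prob {\<omega>\<in>space M. S k \<omega> > x \<and> (\<forall>j<k. S j \<omega> \<le> x)} \<le>
      prob ({\<omega>\<in>space M. S k \<omega> > x \<and> (\<forall>j<k. S j \<omega> \<le> x)} \<inter> {\<omega>\<in>space M. S n \<omega> - S k \<omega> \<ge> 0})"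
  shows "\<kappa> * prob {\<omega>\<in>space M. \<exists>k\<le>n. S k \<omega> > x} \<le> prob {\<omega>\<in>space M. S n \<omega> > x}"
proof -
  note S[measurable]
  define E where "E k = {\<omega>\<in>space M. S k \<omega> > x \<and> (\<forall>j<k. S j \<omega> \<le> x)}" for k
  have E[measurable]: "E k \<in> events" for k unfolding E_def by (rule first_passage(1)[OF S])
  have "\<kappa> * prob {\<omega>\<in>space M. \<exists>k\<le>n. S k \<omega> > x} = (\<Sum>k\<le>n. \<kappa> * prob (E k))"
    unfolding E_def first_passage(2)[OF S, symmetric] by (simp add: sum_distrib_left)
  also have "\<dots> \<le> (\<Sum>k\<le>n. prob (E k \<inter> {\<omega>\<in>space M. S n \<omega> - S k \<omega> \<ge> 0}))"
    unfolding E_def by (intro sum_mono ind) auto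
  also have "\<dots> \<le> (\<Sum>k\<le>n. prob (E k \<inter> {\<omega>\<in>space M. S n \<omega> > x}))"
    by (intro sum_mono finite_measure_mono) (auto simp: E_def)
  also have "\<dots> = prob {\<omega>\<in>space M. S n \<omega> > x}"
    unfolding E_def by (rule first_passage(3)[OF S]) auto
  finally show ?thesis .
qed

text \<open>To end above \<open>x + \<epsilon>\<close> the walk must either rise after its first
  passage, which has conditional probability at most 1/2, or contain a single step larger than
  \<open>\<epsilon>\<close>.\<close>

lemma maximal_lower:
  fixes S :: "nat \<Rightarrow> 'a \<Rightarrow> real" and x :: real
  assumes S: "\<And>k. S k \<in> borel_measurable M"
    and S0: "\<And>\<omega>. \<omega> \<in> space M \<Longrightarrow> S 0 \<omega> \<le> x" and "0 < \<epsilon>"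
    and ind: "\<And>k. k \<le> n \<Longrightarrow>
      prob ({\<omega>\<in>space M. S k \<omega> > x \<and> (\<forall>j<k. S j \<omega> \<le> x)} \<inter> {\<omega>\<in>space M. S n \<omega> - S k \<omega> > 0}) \<le>
      1 / 2 * prob {\<omega>\<in>space M. S k \<omega> > x \<and> (\<forall>j<k. S j \<omega> \<le> x)}"
  shows "prob {\<omega>\<in>space M. S n \<omega> > x + \<epsilon>} \<le>
    1 / 2 * prob {\<omega>\<in>space M. \<exists>k\<le>n. S k \<omega> > x} + prob {\<omega>\<in>space M. \<exists>k<n. S (Suc k) \<omega> - S k \<omega> > \<epsilon>}"
proof -
  note S[measurable]
  define E where "E k = {\<omega>\<in>space M. S k \<omega> > x \<and> (\<forall>j<k. S j \<omega> \<le> x)}" for k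
  have E[measurable]: "E k \<in> events" for k unfolding E_def by (rule first_passage(1)[OF S])
  define J where "J = {\<omega>\<in>space M. S n \<omega> > x + \<epsilon> \<and> (\<exists>k<n. S (Suc k) \<omega> - S k \<omega> > \<epsilon>)}"
  have J[measurable]: "J \<in> events" unfolding J_def by measurable
  have "prob {\<omega>\<in>space M. S n \<omega> > x + \<epsilon>} = (\<Sum>k\<le>n. prob (E k \<inter> {\<omega>\<in>space M. S n \<omega> > x + \<epsilon>}))"
    unfolding E_def by (rule first_passage(3)[OF S, symmetric]) (use assms(3) in force)+
  also have "\<dots> \<le> (\<Sum>k\<le>n. prob (E k \<inter> {\<omega>\<in>space M. S n \<omega> - S k \<omega> > 0}) + prob (E k \<inter> J))"
  proof (rule sum_mono)
    fix k assume k: "k \<in> {..n}"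
    have "E k \<inter> {\<omega>\<in>space M. S n \<omega> > x + \<epsilon>} \<subseteq> E k \<inter> {\<omega>\<in>space M. S n \<omega> - S k \<omega> > 0} \<union> E k \<inter> J"
    proof
      fix \<omega> assume \<omega>: "\<omega> \<in> E k \<inter> {\<omega>\<in>space M. S n \<omega> > x + \<epsilon>}"
      show "\<omega> \<in> E k \<inter> {\<omega>\<in>space M. S n \<omega> - S k \<omega> > 0} \<union> E k \<inter> J"
      proof (cases "S n \<omega> - S k \<omega> > 0")
        case False
        \<comment> \<open>Without a later rise the walk is already above
          \<open>x + \<epsilon>\<close> at its first passage. One index earlier it was at most
          \<open>x\<close>, and there is an earlier index by the assumption on
          \<open>S 0\<close>.\<close>
        with \<omega> have "S k \<omega> > x + \<epsilon>" by auto
        moreover have "k \<noteq> 0" using \<omega> S0[of \<omega>] unfolding E_def by (intro notI) force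
        then obtain l where l: "k = Suc l" using not0_implies_Suc by auto
        moreover have "S l \<omega> \<le> x" using \<omega> l by (auto simp: E_def)
        ultimately have "S (Suc l) \<omega> - S l \<omega> > \<epsilon>" by auto
        then show ?thesis using \<omega> k l by (auto simp: J_def)
      qed (use \<omega> in auto)
    qed
    then have "prob (E k \<inter> {\<omega>\<in>space M. S n \<omega> > x + \<epsilon>}) \<le> prob (E k \<inter> {\<omega>\<in>space M. S n \<omega> - S k \<omega> > 0} \<union> E k \<inter> J)"
      by (intro finite_measure_mono) auto
    also have "\<dots> \<le> prob (E k \<inter> {\<omega>\<in>space M. S n \<omega> - S k \<omega> > 0}) + prob (E k \<inter> J)"
      by (intro measure_Un_le) auto
    finally show "prob (E k \<inter> {\<omega>\<in>space M. S n \<omega> > x + \<epsilon>}) \<le> \<dots>" .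
  qed
  also have "\<dots> = (\<Sum>k\<le>n. prob (E k \<inter> {\<omega>\<in>space M. S n \<omega> - S k \<omega> > 0})) + (\<Sum>k\<le>n. prob (E k \<inter> J))"
    by (rule sum.distrib)
  also have "\<dots> \<le> (\<Sum>k\<le>n. 1 / 2 * prob (E k)) + prob {\<omega>\<in>space M. \<exists>k<n. S (Suc k) \<omega> - S k \<omega> > \<epsilon>}"
  proof (rule add_mono)
    show "(\<Sum>k\<le>n. prob (E k \<inter> {\<omega>\<in>space M. S n \<omega> - S k \<omega> > 0})) \<le> (\<Sum>k\<le>n. 1 / 2 * prob (E k))"
      unfolding E_def by (intro sum_mono ind) auto
    have "(\<Sum>k\<le>n. prob (E k \<inter> J)) = prob J"
      unfolding E_def by (rule first_passage(3)[OF S J]) (use assms(3) in \<open>force simp: J_def\<close>)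
    also have "\<dots> \<le> prob {\<omega>\<in>space M. \<exists>k<n. S (Suc k) \<omega> - S k \<omega> > \<epsilon>}"
      by (intro finite_measure_mono) (auto simp: J_def)
    finally show "(\<Sum>k\<le>n. prob (E k \<inter> J)) \<le> prob {\<omega>\<in>space M. \<exists>k<n. S (Suc k) \<omega> - S k \<omega> > \<epsilon>}" .
  qed
  also have "(\<Sum>k\<le>n. 1 / 2 * prob (E k)) = 1 / 2 * prob {\<omega>\<in>space M. \<exists>k\<le>n. S k \<omega> > x}"
    unfolding E_def first_passage(2)[OF S, symmetric] by (simp add: sum_distrib_left)
  finally show ?thesis .
qed

end

text \<open>The time points are the grid up to index \<open>k\<close>, followed directly by
  \<open>h\<close>. The passage event is then a function of the first \<open>k\<close> increments,
  and the whole remaining stretch is the single increment number \<open>k\<close>.\<close>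

lemma sbm_first_passage_indep:
  fixes h c x :: real and n k :: nat
  assumes B: "standard_brownian_motion M B" and h: "0 < h" and k: "k < n" and A: "A \<in> sets borel"
  defines "S \<equiv> \<lambda>i \<omega>. B (real i * h / real n) \<omega> - c * (real i * h / real n)"
  shows "measure M ({\<omega>\<in>space M. S k \<omega> > x \<and> (\<forall>j<k. S j \<omega> \<le> x)} \<inter> {\<omega>\<in>space M. B h \<omega> - B (real k * h / real n) \<omega> \<in> A}) =
    measure M {\<omega>\<in>space M. S k \<omega> > x \<and> (\<forall>j<k. S j \<omega> \<le> x)} *
    measure M {\<omega>\<in>space M. B h \<omega> - B (real k * h / real n) \<omega> \<in> A}"
proof -
  interpret prob_space M by (rule sbmD(1)[OF B])
  define \<tau> where "\<tau> i = (if i \<le> k then real i * h / real n else h)" for i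
  define X where "X i \<omega> = B (\<tau> (Suc i)) \<omega> - B (\<tau> i) \<omega>" for i \<omega>
  have mono: "\<tau> i \<le> \<tau> (Suc i)" for i
  proof (cases "Suc i \<le> k")
    case True
    have "real i * h / real n \<le> real (Suc i) * h / real n"
      using h by (intro divide_right_mono mult_right_mono) auto
    then show ?thesis using True by (auto simp: \<tau>_def)
  next
    case False
    have "real i * h / real n \<le> h" if "i \<le> k" using that k h by (simp add: field_simps)
    then show ?thesis using False by (simp add: \<tau>_def)
  qed
  have "indep_vars (\<lambda>_. borel) X {..<Suc k}"
    unfolding X_def by (rule sbmD(6)[OF B]) (auto simp: mono, simp add: \<tau>_def)
  then have ind: "indep_var (PiM {..<k} (\<lambda>_. borel)) (\<lambda>\<omega>. restrict (\<lambda>i. X i \<omega>) {..<k})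
      (PiM {k} (\<lambda>_. borel)) (\<lambda>\<omega>. restrict (\<lambda>i. X i \<omega>) {k})"
    by (rule indep_var_restrict) auto
  define P where "P \<xi> i = psum \<xi> i - c * (real i * h / real n)" for \<xi> i
  have [measurable]: "(\<lambda>\<xi>. P \<xi> i) \<in> borel_measurable (PiM {..<k} (\<lambda>_. borel))" if "i \<le> k" for i
    unfolding P_def using psum_measurable[OF that] by measurable
  define E where "E = {\<xi>\<in>space (PiM {..<k} (\<lambda>_. borel)). P \<xi> k > x \<and> (\<forall>j\<in>{..<k}. P \<xi> j \<le> x)}"
  have E: "E \<in> sets (PiM {..<k} (\<lambda>_. borel))" unfolding E_def by measurable
  define F where "F = {\<xi>\<in>space (PiM {k} (\<lambda>_. borel)). \<xi> k \<in> A}"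
  have F: "F \<in> sets (PiM {k} (\<lambda>_. borel))" unfolding F_def using A by measurable
  have PS: "P (restrict (\<lambda>i. X i \<omega>) {..<k}) i = S i \<omega>" if "i \<le> k" "\<omega> \<in> space M" for i \<omega>
  proof -
    have "psum (restrict (\<lambda>i. X i \<omega>) {..<k}) i = (\<Sum>j<i. B (\<tau> (Suc j)) \<omega> - B (\<tau> j) \<omega>)"
      unfolding psum_def X_def using that by (intro sum.cong) auto
    also have "\<dots> = B (\<tau> i) \<omega> - B (\<tau> 0) \<omega>" by (rule sum_lessThan_telescope)
    finally show ?thesis using that sbmD(3)[OF B] by (simp add: P_def S_def \<tau>_def)
  qed
  have 1: "(\<lambda>\<omega>. restrict (\<lambda>i. X i \<omega>) {..<k}) -` E \<inter> space M = {\<omega>\<in>space M. S k \<omega> > x \<and> (\<forall>j<k. S j \<omega> \<le> x)}"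
    by (auto simp: E_def space_PiM PS)
  have 2: "(\<lambda>\<omega>. restrict (\<lambda>i. X i \<omega>) {k}) -` F \<inter> space M = {\<omega>\<in>space M. B h \<omega> - B (real k * h / real n) \<omega> \<in> A}"
    by (auto simp: F_def space_PiM X_def \<tau>_def)
  have 3: "(\<lambda>\<omega>. (restrict (\<lambda>i. X i \<omega>) {..<k}, restrict (\<lambda>i. X i \<omega>) {k})) -` (E \<times> F) \<inter> space M =
    {\<omega>\<in>space M. S k \<omega> > x \<and> (\<forall>j<k. S j \<omega> \<le> x)} \<inter> {\<omega>\<in>space M. B h \<omega> - B (real k * h / real n) \<omega> \<in> A}"
    unfolding 1[symmetric] 2[symmetric] by auto
  show ?thesis
    using indep_varD[OF ind E F] unfolding 1 2 3 .
qed

text \<open>Evaluation at \<open>s / h\<close> is itself a functional with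
  \<open>shift_mono\<close>, so the sampling limit applies to the path run at speed
  \<open>h\<close>.\<close>

lemma tendsto_floor_path:
  fixes f :: "real \<Rightarrow> real"
  assumes f: "continuous_on {0..} f" and "0 < h" "0 \<le> s" "s \<le> h"
  shows "(\<lambda>n. f (real (nat \<lfloor>real n * (s / h)\<rfloor>) * h / real n)) \<longlonglongrightarrow> f s"
proof -
  have "shift_mono 1 (\<lambda>g. g (s / h))"
    using assms unfolding shift_mono_def by auto
  moreover have "continuous_on {0..} (\<lambda>t. f (t * h))"
    using assms(2) by (intro continuous_on_compose2[OF f] continuous_intros) auto
  ultimately have "(\<lambda>n. step_path n (sample n (\<lambda>t. f (t * h))) (s / h)) \<longlonglongrightarrow> f (s / h * h)"
    by (rule tendsto_step_path)
  then show ?thesis using assms(2) by (simp add: step_path_def sample_def)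
qed

text \<open>Through \<open>window_sup\<close> the uncountable quantifiers become a superlevel set of
  a measurable functional. The measurable space \<open>K\<close> is arbitrary because the same fact
  is needed for the sigma-algebra generated by one of the two processes.\<close>

lemma exceed_event_measurable:
  fixes X :: "real \<Rightarrow> 'a \<Rightarrow> real" and a b S x :: real
  assumes X: "\<And>t. 0 \<le> t \<Longrightarrow> X t \<in> borel_measurable K"
    and c: "\<And>\<omega>. \<omega> \<in> space K \<Longrightarrow> continuous_on {0..} (\<lambda>t. X t \<omega>)"
    and "0 \<le> a" "a \<le> b" "0 \<le> S"
  shows "{\<omega>\<in>space K. \<exists>t\<in>{a..b}. \<forall>s\<in>{t..t+S}. x < X s \<omega>} \<in> sets K"
proof -
  have [measurable]: "(\<lambda>\<omega>. window_sup S a b (\<lambda>t. X t \<omega>)) \<in> borel_measurable K"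
    by (rule borel_measurable_shift_mono[OF shift_mono_window_sup[OF assms(3-5) order_refl] X c])
  have "{\<omega>\<in>space K. \<exists>t\<in>{a..b}. \<forall>s\<in>{t..t+S}. x < X s \<omega>} = {\<omega>\<in>space K. x < window_sup S a b (\<lambda>t. X t \<omega>)}"
    using less_window_sup_iff[OF assms(3-5) c] by auto
  then show ?thesis by simp
qed

lemma sup_event_measurable:
  fixes X :: "real \<Rightarrow> 'a \<Rightarrow> real" and a b x :: real
  assumes X: "\<And>t. 0 \<le> t \<Longrightarrow> X t \<in> borel_measurable K"
    and c: "\<And>\<omega>. \<omega> \<in> space K \<Longrightarrow> continuous_on {0..} (\<lambda>t. X t \<omega>)"
    and "0 \<le> a" "a \<le> b"
  shows "{\<omega>\<in>space K. \<exists>t\<in>{a..b}. x < X t \<omega>} \<in> sets K"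
  using exceed_event_measurable[OF assms, of 0] by simp

lemma sbm_drift:
  assumes B: "standard_brownian_motion M B"
  shows "\<And>t. 0 \<le> t \<Longrightarrow> (\<lambda>\<omega>. B t \<omega> - c * t) \<in> borel_measurable M"
    and "\<And>\<omega>. \<omega> \<in> space M \<Longrightarrow> continuous_on {0..} (\<lambda>t. B t \<omega> - c * t)"
  using sbmD(2,4)[OF B] by (auto intro!: continuous_intros)

text \<open>From a first passage at time \<open>t\<close>, the drifted motion ends no lower with
  probability \<open>gtail (c * sqrt (h - t))\<close>, which is at least
  \<open>gtail (\<bar>c\<bar> * sqrt h)\<close>. For \<open>c = 0\<close> this factor is 1/2 and the
  bound is the upper half of the reflection principle.\<close>

lemma sbm_sup_tail:
  assumes B: "standard_brownian_motion M B" and h: "0 < h"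
  shows "gtail (\<bar>c\<bar> * sqrt h) * measure M {\<omega>\<in>space M. \<exists>s\<in>{0..h}. B s \<omega> - c * s > x} \<le> gtail ((x + c * h) / sqrt h)"
proof -
  interpret prob_space M by (rule sbmD(1)[OF B])
  define \<kappa> where "\<kappa> = gtail (\<bar>c\<bar> * sqrt h)"
  have \<kappa>: "0 < \<kappa>" unfolding \<kappa>_def by (rule gtail_pos)
  define A where "A n = {\<omega>\<in>space M. \<exists>k\<le>n. B (real k * h / real n) \<omega> - c * (real k * h / real n) > x}" for n
  have [measurable]: "(\<lambda>\<omega>. B (real k * h / real n) \<omega>) \<in> borel_measurable M" for k n
    using h by (intro sbmD(2)[OF B]) auto
  have [measurable]: "B h \<in> borel_measurable M" using h by (intro sbmD(2)[OF B]) auto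
  have Am: "A n \<in> events" for n unfolding A_def by measurable
  have bound: "\<kappa> * prob (A n) \<le> prob {\<omega>\<in>space M. B h \<omega> - c * h > x}" if n: "0 < n" for n
  proof -
    define S where "S i \<omega> = B (real i * h / real n) \<omega> - c * (real i * h / real n)" for i \<omega>
    have S_meas: "S i \<in> borel_measurable M" for i unfolding S_def by measurable
    have Sn: "S n \<omega> = B h \<omega> - c * h" for \<omega> using n by (simp add: S_def)
    have "\<kappa> * prob {\<omega>\<in>space M. \<exists>k\<le>n. S k \<omega> > x} \<le> prob {\<omega>\<in>space M. S n \<omega> > x}"
    proof (rule maximal_upper[OF S_meas])
      fix k assume "k \<le> n"
      let ?E = "{\<omega>\<in>space M. S k \<omega> > x \<and> (\<forall>j<k. S j \<omega> \<le> x)}"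
      show "\<kappa> * prob ?E \<le> prob (?E \<inter> {\<omega>\<in>space M. S n \<omega> - S k \<omega> \<ge> 0})"
      proof (cases "k = n")
        case True
        have "prob ?E * \<kappa> \<le> prob ?E" unfolding \<kappa>_def by (intro mult_left_le) auto
        moreover have "?E \<inter> {\<omega>\<in>space M. S n \<omega> - S k \<omega> \<ge> 0} = ?E" unfolding True by auto
        ultimately show ?thesis by (simp only: mult.commute)
      next
        case False
        with \<open>k \<le> n\<close> have k: "k < n" by simp
        define t where "t = real k * h / real n"
        have Sk: "S k \<omega> = B t \<omega> - c * t" for \<omega> by (simp only: S_def t_def)
        have t: "0 \<le> t" "t < h" using k h by (auto simp: t_def field_simps)
        have "{\<omega>\<in>space M. S n \<omega> - S k \<omega> \<ge> 0} = {\<omega>\<in>space M. B h \<omega> - B t \<omega> \<in> {c * (h - t)..}}"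
          by (auto simp: Sn Sk right_diff_distrib)
        then have "prob (?E \<inter> {\<omega>\<in>space M. S n \<omega> - S k \<omega> \<ge> 0}) =
            prob ?E * prob {\<omega>\<in>space M. B h \<omega> - B t \<omega> \<ge> c * (h - t)}"
          using sbm_first_passage_indep[OF B h k, of "{c * (h - t)..}" x c]
          unfolding t_def[symmetric] S_def[symmetric] Sk by simp
        also have "prob {\<omega>\<in>space M. B h \<omega> - B t \<omega> \<ge> c * (h - t)} = gtail ((c * (h - t) - 0) / sqrt (h - t))"
          using t by (intro distributed_normal_tail sbmD(5)[OF B] prob_space_axioms) auto
        also have "(c * (h - t) - 0) / sqrt (h - t) = c * sqrt (h - t)"
          using t by (simp add: times_divide_eq_right[symmetric] real_div_sqrt del: times_divide_eq_right)
        finally have "prob (?E \<inter> {\<omega>\<in>space M. S n \<omega> - S k \<omega> \<ge> 0}) = prob ?E * gtail (c * sqrt (h - t))" .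
        moreover have "\<kappa> \<le> gtail (c * sqrt (h - t))"
          unfolding \<kappa>_def
        proof (rule gtail_antimono)
          have "c * sqrt (h - t) \<le> \<bar>c\<bar> * sqrt (h - t)" using t by (intro mult_right_mono) auto
          also have "\<dots> \<le> \<bar>c\<bar> * sqrt h" using t by (intro mult_left_mono) auto
          finally show "c * sqrt (h - t) \<le> \<bar>c\<bar> * sqrt h" .
        qed
        ultimately show ?thesis by (simp only: mult.commute[of \<kappa>]) (intro mult_left_mono measure_nonneg)
      qed
    qed
    then show ?thesis unfolding Sn A_def by (simp only: S_def)
  qed
  \<comment> \<open>Exceeding strictly at \<open>s\<close> means exceeding at the nearest grid point
    below \<open>s\<close> on all fine grids, so the grid bound, uniform in \<open>n\<close>, passes
    to all times.\<close>
  have "prob {\<omega>\<in>space M. \<exists>s\<in>{0..h}. B s \<omega> - c * s > x} \<le> prob {\<omega>\<in>space M. B h \<omega> - c * h > x} / \<kappa>"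
  proof (rule prob_eventually_le[OF Am])
    show "prob (A (Suc n)) \<le> prob {\<omega>\<in>space M. B h \<omega> - c * h > x} / \<kappa>" for n
      using bound[of "Suc n"] \<kappa> by (simp add: field_simps)
    fix \<omega> assume "\<omega> \<in> {\<omega>\<in>space M. \<exists>s\<in>{0..h}. B s \<omega> - c * s > x}"
    then obtain s where \<omega>: "\<omega> \<in> space M" and s: "0 \<le> s" "s \<le> h" "B s \<omega> - c * s > x" by auto
    have "eventually (\<lambda>n. B (real (nat \<lfloor>real n * (s / h)\<rfloor>) * h / real n) \<omega> -
        c * (real (nat \<lfloor>real n * (s / h)\<rfloor>) * h / real n) > x) sequentially"
      using order_tendstoD(1)[OF tendsto_floor_path[OF sbm_drift(2)[OF B \<omega>] h s(1,2)] s(3)] .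
    then show "eventually (\<lambda>n. \<omega> \<in> A n) sequentially"
    proof eventually_elim
      case (elim n)
      have "real n * (s / h) \<le> real n * 1" using s h by (intro mult_left_mono) auto
      then have "nat \<lfloor>real n * (s / h)\<rfloor> \<le> n" by linarith
      with elim \<omega> show ?case by (auto simp: A_def)
    qed
  qed
  also have "{\<omega>\<in>space M. B h \<omega> - c * h > x} = {\<omega>\<in>space M. B h \<omega> > x + c * h}" by auto
  also have "prob \<dots> = gtail ((x + c * h) / sqrt h)" by (rule sbm_at[OF B h])
  finally show ?thesis using \<kappa> by (simp add: \<kappa>_def field_simps)
qed

text \<open>The lower half of the reflection principle. On a grid, the first passage may overshoot
  the level; the slack \<open>\<epsilon>\<close> absorbs this and is removed at the end by
  continuity of \<open>gtail\<close>.\<close>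

lemma sbm_reflection_lower:
  assumes B: "standard_brownian_motion M B" and x: "0 \<le> x"
  shows "gtail x \<le> 1 / 2 * measure M {\<omega>\<in>space M. \<exists>s\<in>{0..1}. B s \<omega> > x}"
proof -
  interpret prob_space M by (rule sbmD(1)[OF B])
  have [measurable]: "(\<lambda>\<omega>. B (real k / real n) \<omega>) \<in> borel_measurable M" for k n
    by (intro sbmD(2)[OF B]) auto
  have [measurable]: "B 1 \<in> borel_measurable M" by (intro sbmD(2)[OF B]) auto
  have sup_m: "{\<omega>\<in>space M. \<exists>s\<in>{0..1}. B s \<omega> > x} \<in> events"
    by (rule sup_event_measurable[OF sbmD(2,4)[OF B]]) auto
  have eps: "gtail (x + \<epsilon>) \<le> 1 / 2 * prob {\<omega>\<in>space M. \<exists>s\<in>{0..1}. B s \<omega> > x}" if \<epsilon>: "0 < \<epsilon>" for \<epsilon>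
  proof -
    define J where "J n = {\<omega>\<in>space M. \<exists>k<n. B (real (Suc k) / real n) \<omega> - B (real k / real n) \<omega> > \<epsilon>}" for n
    have J: "J n \<in> events" for n unfolding J_def by measurable
    have bound: "gtail (x + \<epsilon>) \<le> 1 / 2 * prob {\<omega>\<in>space M. \<exists>s\<in>{0..1}. B s \<omega> > x} + prob (J n)" if n: "0 < n" for n
    proof -
      define S where "S i \<omega> = B (real i / real n) \<omega>" for i \<omega>
      have S_meas: "S i \<in> borel_measurable M" for i unfolding S_def by measurable
      have Sn: "S n \<omega> = B 1 \<omega>" for \<omega> using n by (simp add: S_def)
      have "gtail (x + \<epsilon>) = prob {\<omega>\<in>space M. S n \<omega> > x + \<epsilon>}"
        using sbm_at[OF B, of 1 "x + \<epsilon>"] by (simp add: Sn)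
      also have "\<dots> \<le> 1 / 2 * prob {\<omega>\<in>space M. \<exists>k\<le>n. S k \<omega> > x} + prob {\<omega>\<in>space M. \<exists>k<n. S (Suc k) \<omega> - S k \<omega> > \<epsilon>}"
      proof (rule maximal_lower[OF S_meas _ \<epsilon>])
        show "S 0 \<omega> \<le> x" if "\<omega> \<in> space M" for \<omega> using sbmD(3)[OF B that] x by (simp add: S_def)
        fix k assume "k \<le> n"
        let ?E = "{\<omega>\<in>space M. S k \<omega> > x \<and> (\<forall>j<k. S j \<omega> \<le> x)}"
        show "prob (?E \<inter> {\<omega>\<in>space M. S n \<omega> - S k \<omega> > 0}) \<le> 1 / 2 * prob ?E"
        proof (cases "k = n")
          case False
          with \<open>k \<le> n\<close> have k: "k < n" by simp
          define t where "t = real k / real n"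
          have Sk: "S k \<omega> = B t \<omega>" for \<omega> by (simp only: S_def t_def)
          have t: "0 \<le> t" "t < 1" using k by (auto simp: t_def field_simps)
          have "{\<omega>\<in>space M. S n \<omega> - S k \<omega> > 0} = {\<omega>\<in>space M. B 1 \<omega> - B t \<omega> \<in> {0<..}}"
            by (auto simp: Sn Sk)
          moreover have "prob (?E \<inter> {\<omega>\<in>space M. B 1 \<omega> - B t \<omega> \<in> {0<..}}) =
              prob ?E * prob {\<omega>\<in>space M. B 1 \<omega> - B t \<omega> \<in> {0<..}}"
            using sbm_first_passage_indep[OF B zero_less_one k, of "{0<..}" x 0] by (simp add: S_def t_def)
          ultimately have "prob (?E \<inter> {\<omega>\<in>space M. S n \<omega> - S k \<omega> > 0}) =
              prob ?E * prob {\<omega>\<in>space M. B 1 \<omega> - B t \<omega> > 0}"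
            by (simp only: greaterThan_iff)
          also have "prob {\<omega>\<in>space M. B 1 \<omega> - B t \<omega> > 0} = gtail ((0 - 0) / sqrt (1 - t))"
            using t by (intro distributed_normal_tail sbmD(5)[OF B] prob_space_axioms) auto
          finally show ?thesis by (simp add: gtail_0)
        qed (simp add: measure_nonneg)
      qed
      also have "prob {\<omega>\<in>space M. \<exists>k\<le>n. S k \<omega> > x} \<le> prob {\<omega>\<in>space M. \<exists>s\<in>{0..1}. B s \<omega> > x}"
      proof (rule finite_measure_mono[OF _ sup_m], safe)
        fix \<omega> k assume "\<omega> \<in> space M" "k \<le> n" "S k \<omega> > x"
        then show "\<exists>s\<in>{0..1}. B s \<omega> > x" using n by (intro bexI[of _ "real k / real n"]) (auto simp: S_def)
      qed
      finally show ?thesis by (simp add: J_def S_def)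
    qed
    \<comment> \<open>Each path is uniformly continuous on \<open>[0, 1]\<close>, so its steps on
      fine grids are all below \<open>\<epsilon>\<close>.\<close>
    have "(\<lambda>n. prob (J n)) \<longlonglongrightarrow> 0"
    proof (rule prob_eventually_null[OF J])
      fix \<omega> assume \<omega>: "\<omega> \<in> space M"
      have "uniformly_continuous_on {0..1} (\<lambda>t. B t \<omega>)"
        by (intro compact_uniformly_continuous continuous_on_subset[OF sbmD(4)[OF B \<omega>]]) auto
      then obtain d where d: "d > 0" "\<And>s t. s \<in> {0..1} \<Longrightarrow> t \<in> {0..1} \<Longrightarrow> dist t s < d \<Longrightarrow> dist (B t \<omega>) (B s \<omega>) < \<epsilon>"
        using \<epsilon> unfolding uniformly_continuous_on_def by metis
      have "eventually (\<lambda>n. 1 / real n < d) sequentially"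
        using order_tendstoD(2)[OF lim_1_over_n d(1)] by simp
      then show "eventually (\<lambda>n. \<omega> \<notin> J n) sequentially"
        using eventually_gt_at_top[of 0]
      proof eventually_elim
        case (elim n)
        have "\<not> B (real (Suc k) / real n) \<omega> - B (real k / real n) \<omega> > \<epsilon>" if "k < n" for k
        proof -
          have "dist (B (real (Suc k) / real n) \<omega>) (B (real k / real n) \<omega>) < \<epsilon>"
            using that elim by (intro d(2)) (auto simp: dist_real_def diff_divide_distrib[symmetric])
          then show ?thesis by (simp add: dist_real_def)
        qed
        then show ?case by (auto simp: J_def)
      qed
    qed
    then have "(\<lambda>n. 1 / 2 * prob {\<omega>\<in>space M. \<exists>s\<in>{0..1}. B s \<omega> > x} + prob (J n)) \<longlonglongrightarrow>
        1 / 2 * prob {\<omega>\<in>space M. \<exists>s\<in>{0..1}. B s \<omega> > x} + 0"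
      by (intro tendsto_intros)
    then show ?thesis
      using bound by (intro LIMSEQ_le_const[where a = "gtail (x + \<epsilon>)"]) (auto intro!: exI[of _ 1])
  qed
  have "(\<lambda>n. gtail (x + 1 / real (Suc n))) \<longlonglongrightarrow> gtail (x + 0)"
    by (intro isCont_tendsto_compose[OF isCont_gtail] tendsto_intros LIMSEQ_Suc[OF lim_1_over_n])
  then show ?thesis
    using eps by (intro LIMSEQ_le_const2[of "\<lambda>n. gtail (x + 1 / real (Suc n))"]) auto
qed

subsection \<open>Rescaling and time reversal\<close>

text \<open>Brownian scaling of the motion after time \<open>h\<close>: time by \<open>u^2\<close>,
  space by \<open>u\<close>. The windows of length \<open>S / u^2\<close> become windows of length
  \<open>S\<close>.\<close>

definition rescaled :: "(real \<Rightarrow> 'a \<Rightarrow> real) \<Rightarrow> real \<Rightarrow> real \<Rightarrow> real \<Rightarrow> 'a \<Rightarrow> real" where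
  "rescaled B h u \<tau> \<omega> = u * (B (h + \<tau> / u\<^sup>2) \<omega> - B h \<omega>)"

lemma grid_incr_rescaled:
  "grid_incr n L (rescaled B h u) \<omega> =
    (\<lambda>i\<in>{..<L}. u * (B (h + real (Suc i) / real n / u\<^sup>2) \<omega> - B (h + real i / real n / u\<^sup>2) \<omega>))"
  by (auto simp: grid_incr_def rescaled_def right_diff_distrib fun_eq_iff)

lemma (in prob_space) distr_grid_lawI:
  assumes ind: "indep_vars (\<lambda>_. borel) Z {..<L}" and "0 < L"
    and d: "\<And>i. i < L \<Longrightarrow> distributed M lborel (Z i) (normal_density 0 (sqrt (1 / real n)))"
  shows "distr M (\<Pi>\<^sub>M i\<in>{..<L}. borel) (\<lambda>\<omega>. \<lambda>i\<in>{..<L}. Z i \<omega>) = grid_law n L"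
proof -
  have Z: "random_variable borel (Z i)" if "i \<in> {..<L}" for i
    using distributed_measurable[OF d] that by simp
  have "distr M (\<Pi>\<^sub>M i\<in>{..<L}. borel) (\<lambda>\<omega>. \<lambda>i\<in>{..<L}. Z i \<omega>) = (\<Pi>\<^sub>M i\<in>{..<L}. distr M borel (Z i))"
    using indep_vars_iff_distr_eq_PiM'[where I = "{..<L}" and X = Z and M' = "\<lambda>_. borel"] Z ind assms(2) by auto
  also have "\<dots> = grid_law n L"
  proof (rule PiM_cong)
    fix i assume "i \<in> {..<L}"
    then have "distr M lborel (Z i) = density lborel (normal_density 0 (sqrt (1 / real n)))"
      by (intro distributed_distr_eq_density d) auto
    moreover have "distr M lborel (Z i) = distr M borel (Z i)" by (rule distr_cong) auto
    ultimately show "distr M borel (Z i) = density lborel (normal_density 0 (sqrt (1 / real n)))" by simp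
  qed simp
  finally show ?thesis .
qed

lemma bm_on_rescaled:
  assumes B: "standard_brownian_motion M B" and h: "0 \<le> h" and u: "0 < u"
  shows "bm_on M (rescaled B h u)"
proof -
  interpret prob_space M by (rule sbmD(1)[OF B])
  have law: "distr M (\<Pi>\<^sub>M i\<in>{..<L}. borel) (grid_incr n L (rescaled B h u)) = grid_law n L"
    if n: "0 < n" and L: "0 < L" for n L
  proof -
    define \<tau> where "\<tau> i = h + real i / real n / u\<^sup>2" for i
    have \<tau>: "0 \<le> \<tau> i" "\<tau> i < \<tau> (Suc i)" for i
      using h u n by (auto simp: \<tau>_def intro!: divide_strict_right_mono add_nonneg_nonneg)
    define X where "X i \<omega> = B (\<tau> (Suc i)) \<omega> - B (\<tau> i) \<omega>" for i \<omega>
    have "indep_vars (\<lambda>_. borel) X {..<L}"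
      unfolding X_def by (rule sbmD(6)[OF B]) (auto simp: \<tau> intro: less_imp_le)
    then have ind: "indep_vars (\<lambda>_. borel) (\<lambda>i \<omega>. u * X i \<omega>) {..<L}"
      by (rule indep_vars_compose2) measurable
    have "distributed M lborel (\<lambda>\<omega>. u * X i \<omega>) (normal_density 0 (sqrt (1 / real n)))" for i
    proof -
      have pos: "0 < sqrt (\<tau> (Suc i) - \<tau> i)" using \<tau>(2)[of i] by simp
      have "\<tau> (Suc i) - \<tau> i = 1 / real n / u\<^sup>2"
        by (simp add: \<tau>_def diff_divide_distrib[symmetric])
      then have "u * sqrt (\<tau> (Suc i) - \<tau> i) = sqrt (1 / real n)"
        using u by (simp add: real_sqrt_divide real_sqrt_mult)
      then show ?thesis
        using normal_density_affine[OF sbmD(5)[OF B \<tau>(1)[of i] \<tau>(2)[of i]] pos, of u 0] u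
        by (simp add: X_def)
    qed
    from distr_grid_lawI[OF ind L this]
    have "distr M (\<Pi>\<^sub>M i\<in>{..<L}. borel) (\<lambda>\<omega>. \<lambda>i\<in>{..<L}. u * X i \<omega>) = grid_law n L" .
    moreover have "grid_incr n L (rescaled B h u) = (\<lambda>\<omega>. \<lambda>i\<in>{..<L}. u * X i \<omega>)"
      by (auto simp: fun_eq_iff grid_incr_rescaled X_def \<tau>_def)
    ultimately show ?thesis by (simp only:)
  qed
  have "continuous_on {0..} (\<lambda>t. rescaled B h u t \<omega>)" if "\<omega> \<in> space M" for \<omega>
    unfolding rescaled_def using h u
    by (intro continuous_intros continuous_on_compose2[OF sbmD(4)[OF B that]]) auto
  moreover have "rescaled B h u t \<in> borel_measurable M" if "0 \<le> t" for t
    unfolding rescaled_def using h u that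
    by (intro borel_measurable_times borel_measurable_diff borel_measurable_const sbmD(2)[OF B]) auto
  ultimately show ?thesis
    unfolding bm_on_def using law prob_space_axioms by (simp add: rescaled_def)
qed

lemma bm_on_cong:
  assumes X: "bm_on M X" and eq: "\<And>t \<omega>. \<omega> \<in> space M \<Longrightarrow> X t \<omega> = Y t \<omega>"
  shows "bm_on M Y"
  unfolding bm_on_def
proof (intro conjI allI ballI impI)
  show "prob_space M" by (rule bm_onD(1)[OF X])
  show "Y t \<in> borel_measurable M" if "0 \<le> t" for t
    using bm_onD(2)[OF X that] by (rule measurable_cong[THEN iffD1, rotated]) (rule eq)
  show "Y 0 \<omega> = 0" if "\<omega> \<in> space M" for \<omega> using bm_onD(3)[OF X that] eq[OF that] by simp
  show "continuous_on {0..} (\<lambda>t. Y t \<omega>)" if "\<omega> \<in> space M" for \<omega>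
    using bm_onD(4)[OF X that] eq[OF that] by simp
  fix n L :: nat assume nL: "0 < n" "0 < L"
  have "distr M (\<Pi>\<^sub>M i\<in>{..<L}. borel) (grid_incr n L Y) = distr M (\<Pi>\<^sub>M i\<in>{..<L}. borel) (grid_incr n L X)"
    by (rule distr_cong) (auto simp: grid_incr_def eq)
  then show "distr M (\<Pi>\<^sub>M i\<in>{..<L}. borel) (grid_incr n L Y) = grid_law n L"
    using bm_onD(5)[OF X nL] by simp
qed

lemma bm_on_sbm:
  assumes "standard_brownian_motion M B"
  shows "bm_on M B"
  by (rule bm_on_cong[OF bm_on_rescaled[OF assms order_refl zero_less_one]])
    (simp add: rescaled_def sbmD(3)[OF assms])

lemma rescaled_indep_grid:
  assumes B: "standard_brownian_motion M B" and h: "0 \<le> h" and u: "0 < u" and n: "0 < n"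
    and F: "F \<in> borel_measurable (\<Pi>\<^sub>M i\<in>{..<L}. borel)"
  shows "prob_space.indep_var M borel (B h) borel (\<lambda>\<omega>. F (grid_incr n L (rescaled B h u) \<omega>) :: real)"
proof -
  interpret prob_space M by (rule sbmD(1)[OF B])
  \<comment> \<open>Starting at 0 and jumping to \<open>h\<close> makes \<open>B h\<close> increment
    number 0, independent of all the grid increments after \<open>h\<close>.\<close>
  define \<tau> where "\<tau> i = (case i of 0 \<Rightarrow> 0 | Suc j \<Rightarrow> h + real j / real n / u\<^sup>2)" for i
  have \<tau>: "\<tau> i \<le> \<tau> (Suc i)" for i
    using h u n by (auto simp: \<tau>_def split: nat.split intro!: divide_right_mono)
  define X where "X i \<omega> = B (\<tau> (Suc i)) \<omega> - B (\<tau> i) \<omega>" for i \<omega>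
  have "indep_vars (\<lambda>_. borel) X {..<Suc L}"
    unfolding X_def by (rule sbmD(6)[OF B]) (auto simp: \<tau>, simp add: \<tau>_def)
  then have "indep_var (PiM {0} (\<lambda>_. borel)) (\<lambda>\<omega>. restrict (\<lambda>i. X i \<omega>) {0})
      (PiM {1..L} (\<lambda>_. borel)) (\<lambda>\<omega>. restrict (\<lambda>i. X i \<omega>) {1..L})"
    by (rule indep_var_restrict) auto
  then have *: "indep_var borel ((\<lambda>f. f 0) \<circ> (\<lambda>\<omega>. restrict (\<lambda>i. X i \<omega>) {0}))
      borel ((\<lambda>f. F (\<lambda>i\<in>{..<L}. u * f (Suc i))) \<circ> (\<lambda>\<omega>. restrict (\<lambda>i. X i \<omega>) {1..L}))"
    by (rule indep_var_compose)
      (auto intro!: measurable_compose[OF _ F] measurable_restrict borel_measurable_times measurable_component_singleton)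
  have 1: "\<omega> \<in> space M \<Longrightarrow> ((\<lambda>f. f 0) \<circ> (\<lambda>\<omega>. restrict (\<lambda>i. X i \<omega>) {0})) \<omega> = B h \<omega>" for \<omega>
    using sbmD(3)[OF B] by (simp add: X_def \<tau>_def)
  have 2: "((\<lambda>f. F (\<lambda>i\<in>{..<L}. u * f (Suc i))) \<circ> (\<lambda>\<omega>. restrict (\<lambda>i. X i \<omega>) {1..L})) =
      (\<lambda>\<omega>. F (grid_incr n L (rescaled B h u) \<omega>))"
    by (auto simp: fun_eq_iff grid_incr_rescaled X_def \<tau>_def intro!: arg_cong[where f = F])
  \<comment> \<open>Increment number 0 agrees with \<open>B h\<close> only on
    \<open>space M\<close>, so independence is transferred through the generating preimages rather
    than by equality of functions.\<close>
  have "{((\<lambda>f. f 0) \<circ> (\<lambda>\<omega>. restrict (\<lambda>i. X i \<omega>) {0})) -` A \<inter> space M |A. A \<in> sets borel} =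
      {B h -` A \<inter> space M |A. A \<in> sets borel}"
    using 1 by (intro Collect_cong ex_cong1 conj_cong refl) (auto simp del: comp_apply)
  moreover have "B h \<in> borel_measurable M" by (rule sbmD(2)[OF B h])
  ultimately show ?thesis
    using * unfolding 2 indep_var_eq by (simp del: comp_apply)
qed

text \<open>Conditioning on an event of \<open>Y\<close> does not change the characteristic function
  of any \<open>Zn n\<close>, and dominated convergence hands this on to \<open>Z\<close>. By Levy's
  uniqueness theorem \<open>Z\<close> then has the same law under the conditional measure, which is
  independence.\<close>

lemma (in prob_space) indep_var_real_limit:
  fixes Y Z :: "'a \<Rightarrow> real" and Zn :: "nat \<Rightarrow> 'a \<Rightarrow> real"
  assumes ind: "\<And>n. indep_var borel Y borel (Zn n)"
    and lim: "\<And>\<omega>. \<omega> \<in> space M \<Longrightarrow> (\<lambda>n. Zn n \<omega>) \<longlonglongrightarrow> Z \<omega>"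
  shows "indep_var borel Y borel Z"
proof -
  have Y[measurable]: "Y \<in> borel_measurable M" and Zn[measurable]: "Zn n \<in> borel_measurable M" for n
    using ind[of n] by (auto simp: indep_var_eq)
  have Z[measurable]: "Z \<in> borel_measurable M" using lim Zn by (rule borel_measurable_LIMSEQ_real)
  have main: "prob (Y -` A \<inter> Z -` C \<inter> space M) = prob (Y -` A \<inter> space M) * prob (Z -` C \<inter> space M)"
    if A[measurable]: "A \<in> sets borel" and C[measurable]: "C \<in> sets borel" for A C
  proof (cases "prob (Y -` A \<inter> space M) = 0")
    case True
    have "prob (Y -` A \<inter> Z -` C \<inter> space M) \<le> prob (Y -` A \<inter> space M)"
      by (intro finite_measure_mono) auto
    then have "prob (Y -` A \<inter> Z -` C \<inter> space M) = 0" using True measure_nonneg[of M] by (intro antisym) auto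
    then show ?thesis using True by simp
  next
    case False
    define a where "a = Y -` A \<inter> space M"
    have a[measurable]: "a \<in> events" unfolding a_def by measurable
    define p where "p = prob a"
    have p: "p \<noteq> 0" using False by (simp add: p_def a_def)
    \<comment> \<open>\<open>U\<close> is \<open>M\<close> conditioned on the event
      \<open>a\<close>; its total mass is 1 because \<open>p\<close> is the probability of
      \<open>a\<close>.\<close>
    define U where "U = density M (\<lambda>\<omega>. ennreal (indicator a \<omega> / p))"
    have pp: "0 < p" using p by (simp add: p_def zero_less_measure_iff)
    have U: "prob_space U"
    proof
      have "emeasure U (space U) = (\<integral>\<^sup>+\<omega>. ennreal (1 / p) * indicator a \<omega> \<partial>M)"
        unfolding U_def by (subst emeasure_density) (auto intro!: nn_integral_cong simp: indicator_def)
      also have "\<dots> = ennreal (1 / p) * ennreal p"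
        by (subst nn_integral_cmult_indicator) (auto simp: p_def emeasure_eq_measure)
      also have "\<dots> = 1" using pp by (simp add: ennreal_mult'[symmetric])
      finally show "emeasure U (space U) = 1" .
    qed
    interpret U: prob_space U by fact
    have sU: "sets U = sets M" by (simp add: U_def)
    have ZU: "Z \<in> borel_measurable U" by (simp add: U_def)
    have char_lim: "(\<lambda>n. \<integral>\<omega>. f \<omega> *\<^sub>R iexp (t * Zn n \<omega>) \<partial>M) \<longlonglongrightarrow> (\<integral>\<omega>. f \<omega> *\<^sub>R iexp (t * Z \<omega>) \<partial>M)"
      if [measurable]: "f \<in> borel_measurable M" and f: "\<And>\<omega>. \<bar>f \<omega>\<bar> \<le> 1" for f t
    proof (rule integral_dominated_convergence[where w = "\<lambda>_. 1"])
      show "AE \<omega> in M. (\<lambda>n. f \<omega> *\<^sub>R iexp (t * Zn n \<omega>)) \<longlonglongrightarrow> f \<omega> *\<^sub>R iexp (t * Z \<omega>)"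
        by (intro AE_I2 tendsto_intros lim)
    qed (use f in auto)
    have fac: "(\<integral>\<omega>. indicator a \<omega> *\<^sub>R iexp (t * Zn n \<omega>) \<partial>M) = p *\<^sub>R (\<integral>\<omega>. 1 *\<^sub>R iexp (t * Zn n \<omega>) \<partial>M)" for n t
    proof -
      have i: "indep_var borel ((\<lambda>y. complex_of_real (indicator A y)) \<circ> Y) borel ((\<lambda>z. iexp (t * z)) \<circ> Zn n)"
        by (rule indep_var_compose[OF ind]) auto
      have "(\<integral>\<omega>. indicator a \<omega> *\<^sub>R iexp (t * Zn n \<omega>) \<partial>M) =
          (\<integral>\<omega>. ((\<lambda>y. complex_of_real (indicator A y)) \<circ> Y) \<omega> * ((\<lambda>z. iexp (t * z)) \<circ> Zn n) \<omega> \<partial>M)"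
        by (intro Bochner_Integration.integral_cong) (auto simp: a_def indicator_def)
      also have "\<dots> = (\<integral>\<omega>. ((\<lambda>y. complex_of_real (indicator A y)) \<circ> Y) \<omega> \<partial>M) * (\<integral>\<omega>. ((\<lambda>z. iexp (t * z)) \<circ> Zn n) \<omega> \<partial>M)"
        by (rule indep_var_lebesgue_integral[OF i]) (auto intro!: integrable_const_bound[where B = 1])
      also have "(\<integral>\<omega>. ((\<lambda>y. complex_of_real (indicator A y)) \<circ> Y) \<omega> \<partial>M) = (\<integral>\<omega>. complex_of_real (indicator a \<omega>) \<partial>M)"
        by (intro Bochner_Integration.integral_cong) (auto simp: a_def indicator_def)
      also have "\<dots> = complex_of_real p"
        by (simp add: p_def)
      finally show ?thesis by (simp add: scaleR_conv_of_real)
    qed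
    have ch: "(\<integral>\<omega>. indicator a \<omega> *\<^sub>R iexp (t * Z \<omega>) \<partial>M) = p *\<^sub>R (\<integral>\<omega>. 1 *\<^sub>R iexp (t * Z \<omega>) \<partial>M)" for t
    proof (rule LIMSEQ_unique)
      show "(\<lambda>n. \<integral>\<omega>. indicator a \<omega> *\<^sub>R iexp (t * Zn n \<omega>) \<partial>M) \<longlonglongrightarrow> (\<integral>\<omega>. indicator a \<omega> *\<^sub>R iexp (t * Z \<omega>) \<partial>M)"
        by (rule char_lim) (auto simp: indicator_def)
      show "(\<lambda>n. \<integral>\<omega>. indicator a \<omega> *\<^sub>R iexp (t * Zn n \<omega>) \<partial>M) \<longlonglongrightarrow> p *\<^sub>R (\<integral>\<omega>. 1 *\<^sub>R iexp (t * Z \<omega>) \<partial>M)"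
        unfolding fac by (intro tendsto_intros char_lim) auto
    qed
    have "distr U borel Z = distr M borel Z"
    proof (rule Levy_uniqueness)
      show "real_distribution (distr U borel Z)" by (rule U.real_distribution_distr[OF ZU])
      show "real_distribution (distr M borel Z)" by (rule real_distribution_distr[OF Z])
      show "char (distr U borel Z) = char (distr M borel Z)"
      proof
        fix t
        have "char (distr U borel Z) t = (\<integral>\<omega>. iexp (t * Z \<omega>) \<partial>U)"
          unfolding char_def using ZU by (subst integral_distr) auto
        also have "\<dots> = (\<integral>\<omega>. (indicator a \<omega> / p) *\<^sub>R iexp (t * Z \<omega>) \<partial>M)"
          unfolding U_def by (rule integral_density) (use pp in \<open>auto simp: indicator_def\<close>)
        also have "\<dots> = (\<integral>\<omega>. (1 / p) *\<^sub>R (indicator a \<omega> *\<^sub>R iexp (t * Z \<omega>)) \<partial>M)"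
          by (intro Bochner_Integration.integral_cong) auto
        also have "\<dots> = (1 / p) *\<^sub>R (p *\<^sub>R (\<integral>\<omega>. 1 *\<^sub>R iexp (t * Z \<omega>) \<partial>M))"
          by (simp only: integral_scaleR_right ch)
        also have "\<dots> = (\<integral>\<omega>. iexp (t * Z \<omega>) \<partial>M)" using p by simp
        also have "\<dots> = char (distr M borel Z) t"
          unfolding char_def by (subst integral_distr) auto
        finally show "char (distr U borel Z) t = char (distr M borel Z) t" .
      qed
    qed
    then have "measure (distr U borel Z) C = measure (distr M borel Z) C" by simp
    then have "measure U (Z -` C \<inter> space M) = prob (Z -` C \<inter> space M)"
      using ZU by (simp add: measure_distr U_def)
    moreover have "emeasure U (Z -` C \<inter> space M) = (\<integral>\<^sup>+\<omega>. ennreal (1 / p) * indicator (Y -` A \<inter> Z -` C \<inter> space M) \<omega> \<partial>M)"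
      unfolding U_def by (subst emeasure_density) (auto intro!: nn_integral_cong simp: indicator_def a_def)
    then have "emeasure U (Z -` C \<inter> space M) = ennreal (1 / p) * ennreal (prob (Y -` A \<inter> Z -` C \<inter> space M))"
      by (subst (asm) nn_integral_cmult_indicator) (auto simp: emeasure_eq_measure)
    then have "measure U (Z -` C \<inter> space M) = 1 / p * prob (Y -` A \<inter> Z -` C \<inter> space M)"
      using pp by (simp add: ennreal_mult'[symmetric] U.emeasure_eq_measure)
    ultimately show ?thesis using p by (simp add: p_def a_def field_simps)
  qed
  have stable: "Int_stable {Y -` A \<inter> space M |A. A \<in> sets borel}" for Y :: "'a \<Rightarrow> real"
  proof (rule Int_stableI)
    fix a b assume "a \<in> {Y -` A \<inter> space M |A. A \<in> sets borel}" "b \<in> {Y -` A \<inter> space M |A. A \<in> sets borel}"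
    then obtain A C where "A \<in> sets borel" "C \<in> sets borel" "a = Y -` A \<inter> space M" "b = Y -` C \<inter> space M" by auto
    then show "a \<inter> b \<in> {Y -` A \<inter> space M |A. A \<in> sets borel}"
      by (intro CollectI exI[of _ "A \<inter> C"]) auto
  qed
  show ?thesis
    unfolding indep_var_eq
  proof (intro conjI Y Z)
    show "indep_set (sigma_sets (space M) {Y -` A \<inter> space M |A. A \<in> sets borel})
       (sigma_sets (space M) {Z -` A \<inter> space M |A. A \<in> sets borel})"
    proof (rule indep_set_sigma_sets)
      show "indep_set {Y -` A \<inter> space M |A. A \<in> sets borel} {Z -` A \<inter> space M |A. A \<in> sets borel}"
        unfolding indep_sets2_eq
      proof (intro conjI ballI)
        fix a b assume "a \<in> {Y -` A \<inter> space M |A. A \<in> sets borel}" "b \<in> {Z -` A \<inter> space M |A. A \<in> sets borel}"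
        then obtain A C where [measurable]: "A \<in> sets borel" "C \<in> sets borel"
          and ab: "a = Y -` A \<inter> space M" "b = Z -` C \<inter> space M" by auto
        have "a \<inter> b = Y -` A \<inter> Z -` C \<inter> space M" by (auto simp: ab)
        with main[of A C] show "prob (a \<inter> b) = prob a * prob b" by (simp add: ab)
      qed auto
    qed (rule stable)+
  qed
qed

text \<open>The joint law is a product, so Fubini integrates the tail \<open>q\<close> of
  \<open>Y\<close> over the random threshold.\<close>

lemma (in prob_space) indep_var_tail:
  fixes Y Z :: "'a \<Rightarrow> real"
  assumes ind: "indep_var borel Y borel Z" and f: "f \<in> borel_measurable borel"
    and q: "\<And>x. prob {\<omega>\<in>space M. Y \<omega> > x} = q x" "q \<in> borel_measurable borel"
  shows "prob {\<omega>\<in>space M. Y \<omega> > f (Z \<omega>)} = (\<integral>\<omega>. q (f (Z \<omega>)) \<partial>M)"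
proof -
  have Y[measurable]: "Y \<in> borel_measurable M" and Z[measurable]: "Z \<in> borel_measurable M"
    using ind by (auto simp: indep_var_eq)
  note f[measurable] q(2)[measurable]
  have q01: "0 \<le> q x" "q x \<le> 1" for x using q(1)[of x, symmetric] by auto
  interpret DY: prob_space "distr M borel Y" by (rule prob_space_distr) simp
  interpret DZ: prob_space "distr M borel Z" by (rule prob_space_distr) simp
  interpret pair_sigma_finite "distr M borel Y" "distr M borel Z" ..
  let ?A = "{z\<in>space (borel \<Otimes>\<^sub>M borel). fst z > f (snd z)}"
  have A: "?A \<in> sets (borel \<Otimes>\<^sub>M borel)" by measurable
  have "emeasure M {\<omega>\<in>space M. Y \<omega> > f (Z \<omega>)} = emeasure (distr M (borel \<Otimes>\<^sub>M borel) (\<lambda>\<omega>. (Y \<omega>, Z \<omega>))) ?A"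
    using A by (subst emeasure_distr) (auto intro!: arg_cong[where f = "emeasure M"] simp: space_pair_measure)
  also have "\<dots> = emeasure (distr M borel Y \<Otimes>\<^sub>M distr M borel Z) ?A"
    using ind unfolding indep_var_distribution_eq by simp
  also have "\<dots> = (\<integral>\<^sup>+z. emeasure (distr M borel Y) ((\<lambda>y. (y, z)) -` ?A) \<partial>distr M borel Z)"
    using A by (intro emeasure_pair_measure_alt2) (simp cong: sets_pair_measure_cong)
  also have "\<dots> = (\<integral>\<^sup>+z. ennreal (q (f z)) \<partial>distr M borel Z)"
  proof (rule nn_integral_cong)
    fix z
    have "emeasure (distr M borel Y) ((\<lambda>y. (y, z)) -` ?A) = emeasure M {\<omega>\<in>space M. Y \<omega> > f z}"
      by (subst emeasure_distr) (auto intro!: arg_cong[where f = "emeasure M"] simp: space_pair_measure vimage_def)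
    then show "emeasure (distr M borel Y) ((\<lambda>y. (y, z)) -` ?A) = ennreal (q (f z))"
      by (simp add: emeasure_eq_measure q(1))
  qed
  also have "\<dots> = (\<integral>\<^sup>+\<omega>. ennreal (q (f (Z \<omega>))) \<partial>M)" by (rule nn_integral_distr) auto
  also have "\<dots> = ennreal (\<integral>\<omega>. q (f (Z \<omega>)) \<partial>M)"
    using q01 by (intro nn_integral_eq_integral integrable_const_bound[where B = 1]) auto
  finally show ?thesis using q01 by (simp add: emeasure_eq_measure)
qed

lemma rescaled_indep:
  assumes B: "standard_brownian_motion M B" and h: "0 \<le> h" and u: "0 < u" and G: "shift_mono R G"
  shows "prob_space.indep_var M borel (B h) borel (\<lambda>\<omega>. G (\<lambda>t. rescaled B h u t \<omega>))"
proof -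
  interpret prob_space M by (rule sbmD(1)[OF B])
  let ?W = "rescaled B h u"
  have W: "bm_on M ?W" by (rule bm_on_rescaled[OF B h u])
  show ?thesis
  proof (rule indep_var_real_limit)
    show "(\<lambda>n. G (step_path (Suc n) (sample (Suc n) (\<lambda>t. ?W t \<omega>)))) \<longlonglongrightarrow> G (\<lambda>t. ?W t \<omega>)" if "\<omega> \<in> space M" for \<omega>
      by (rule LIMSEQ_Suc[OF tendsto_step_path[OF G bm_onD(4)[OF W that]]])
    fix n
    define L where "L = nat \<lceil>real (Suc n) * R\<rceil> + 1"
    have L: "real (Suc n) * R \<le> real L" unfolding L_def by linarith
    have "indep_var borel (B h) borel (\<lambda>\<omega>. G (step_path (Suc n) (psum (grid_incr (Suc n) L ?W \<omega>))))"
      by (rule rescaled_indep_grid[OF B h u _ step_psum_measurable[OF G L]]) simp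
    moreover have "G (step_path (Suc n) (psum (grid_incr (Suc n) L ?W \<omega>))) =
        G (step_path (Suc n) (sample (Suc n) (\<lambda>t. ?W t \<omega>)))" for \<omega>
      by (rule step_grid_incr[OF G L]) (simp add: rescaled_def)
    ultimately show "indep_var borel (B h) borel (\<lambda>\<omega>. G (step_path (Suc n) (sample (Suc n) (\<lambda>t. ?W t \<omega>))))"
      by simp
  qed
qed

text \<open>Given the rescaled path, \<open>B h\<close> is still a centred normal variable of
  variance \<open>h\<close>. The law of \<open>G\<close> of the rescaled path does not depend on
  \<open>h\<close> and \<open>u\<close>, so \<open>B\<close> itself can replace it and only
  \<open>f\<close> and \<open>h\<close> still vary with the level.\<close>

lemma rescaled_tail:
  assumes B: "standard_brownian_motion M B" and h: "0 < h" and u: "0 < u" and G: "shift_mono R G"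
    and f: "f \<in> borel_measurable borel"
  shows "measure M {\<omega>\<in>space M. B h \<omega> > f (G (\<lambda>t. rescaled B h u t \<omega>))} =
    (\<integral>\<omega>. gtail (f (G (\<lambda>t. B t \<omega>)) / sqrt h) \<partial>M)"
proof -
  interpret prob_space M by (rule sbmD(1)[OF B])
  let ?W = "rescaled B h u"
  have W: "bm_on M ?W" by (rule bm_on_rescaled[OF B _ u]) (use h in simp)
  have X: "bm_on M B" by (rule bm_on_sbm[OF B])
  note f[measurable]
  have "prob {\<omega>\<in>space M. B h \<omega> > f (G (\<lambda>t. ?W t \<omega>))} = (\<integral>\<omega>. gtail (f (G (\<lambda>t. ?W t \<omega>)) / sqrt h) \<partial>M)"
    using h by (intro indep_var_tail[where q = "\<lambda>x. gtail (x / sqrt h)"] rescaled_indep[OF B _ u G] f sbm_at[OF B]) auto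
  also have "\<dots> = (\<integral>z. gtail (f z / sqrt h) \<partial>distr M borel (\<lambda>\<omega>. G (\<lambda>t. ?W t \<omega>)))"
    by (rule integral_distr[symmetric]) (auto intro!: borel_measurable_shift_mono[OF G bm_onD(2)[OF W] bm_onD(4)[OF W]])
  also have "\<dots> = (\<integral>z. gtail (f z / sqrt h) \<partial>distr M borel (\<lambda>\<omega>. G (\<lambda>t. B t \<omega>)))"
    by (simp only: bm_on_law[OF W X G])
  also have "\<dots> = (\<integral>\<omega>. gtail (f (G (\<lambda>t. B t \<omega>)) / sqrt h) \<partial>M)"
    by (rule integral_distr) (auto intro!: borel_measurable_shift_mono[OF G bm_onD(2)[OF X] bm_onD(4)[OF X]])
  finally show ?thesis .
qed

text \<open>The motion is run backwards from \<open>T / 2\<close> at half speed, which the factor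
  \<open>sqrt 2\<close> compensates. Times \<open>\<tau>\<close> beyond \<open>T\<close> reach the
  negative half of \<open>B\<close>; windows that start before \<open>T\<close> do extend
  there.\<close>

definition reversed_bm :: "(real \<Rightarrow> 'a \<Rightarrow> real) \<Rightarrow> real \<Rightarrow> real \<Rightarrow> 'a \<Rightarrow> real" where
  "reversed_bm B T \<tau> \<omega> = sqrt 2 * (B ((T - \<tau>) / 2) \<omega> - B (T / 2) \<omega>)"

lemma two_sided_path:
  assumes "two_sided_brownian_motion N B"
  shows "\<And>t. B t \<in> borel_measurable N"
    and "\<And>\<omega>. \<omega> \<in> space N \<Longrightarrow> continuous_on UNIV (\<lambda>t. B t \<omega>)"
proof -
  have B: "standard_brownian_motion N B" and B': "standard_brownian_motion N (\<lambda>t. B (- t))"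
    using assms by (auto simp: two_sided_brownian_motion_def)
  show "B t \<in> borel_measurable N" for t
    using sbmD(2)[OF B, of t] sbmD(2)[OF B', of "- t"] by (cases "0 \<le> t") auto
  fix \<omega> assume \<omega>: "\<omega> \<in> space N"
  have "continuous_on {..0} (\<lambda>t. (\<lambda>t. B (- t) \<omega>) (- t))"
    by (rule continuous_on_compose2[OF sbmD(4)[OF B' \<omega>]]) (auto intro!: continuous_intros)
  then have "continuous_on {..0} (\<lambda>t. B t \<omega>)" by simp
  then have "continuous_on ({..0} \<union> {0..}) (\<lambda>t. B t \<omega>)"
    by (intro continuous_on_closed_Un sbmD(4)[OF B \<omega>]) auto
  moreover have "{..0} \<union> {0..} = (UNIV :: real set)" by auto
  ultimately show "continuous_on UNIV (\<lambda>t. B t \<omega>)" by simp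
qed

text \<open>With \<open>T = k\<close> natural, the origin of \<open>B\<close> is the grid point
  number \<open>m = n * k\<close>, so no increment straddles it: those before \<open>m\<close> come
  from the positive half, the others from the negative half. Within a half the increments are
  independent, and the halves are independent of each other.\<close>

lemma two_sided_increments:
  fixes L k n :: nat and N :: "'b measure" and B :: "real \<Rightarrow> 'b \<Rightarrow> real"
  assumes B: "two_sided_brownian_motion N B" and n: "0 < n" and A: "\<And>i. A i \<in> sets borel"
  defines "Z \<equiv> \<lambda>i \<omega>. reversed_bm B (real k) (real (Suc i) / real n) \<omega> - reversed_bm B (real k) (real i / real n) \<omega>"
  defines "\<mu> \<equiv> density lborel (normal_density 0 (sqrt (1 / real n)))"
  shows "measure N {\<omega>\<in>space N. \<forall>i<L. Z i \<omega> \<in> A i} = (\<Prod>i<L. measure \<mu> (A i))"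
proof -
  have B1: "standard_brownian_motion N B" and B2: "standard_brownian_motion N (\<lambda>t. B (- t))"
    and ind: "indep_processes N B (\<lambda>t. B (- t))"
    using B by (auto simp: two_sided_brownian_motion_def)
  interpret prob_space N by (rule sbmD(1)[OF B1])
  define m where "m = n * k"
  \<comment> \<open>Mesh \<open>1 / (2 n)\<close>, because the reversed motion runs at half
    speed.\<close>
  define p where "p j = real j / (2 * real n)" for j
  have p: "0 \<le> p j" "p j < p (Suc j)" for j
    using n by (auto simp: p_def field_simps)
  have law: "indep_vars (\<lambda>_. borel) (\<lambda>j \<omega>. B (p (Suc j)) \<omega> - B (p j) \<omega>) {..<l}"
    "\<And>C s. C \<in> sets borel \<Longrightarrow> \<bar>s\<bar> = sqrt 2 \<Longrightarrow>
        prob {\<omega>\<in>space N. s * (B (p (Suc j)) \<omega> - B (p j) \<omega>) \<in> C} = measure \<mu> C"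
    if B: "standard_brownian_motion N B" for B :: "real \<Rightarrow> 'b \<Rightarrow> real" and l j
  proof -
    show "indep_vars (\<lambda>_. borel) (\<lambda>j \<omega>. B (p (Suc j)) \<omega> - B (p j) \<omega>) {..<l}"
      by (rule sbmD(6)[OF B]) (auto simp: p intro: less_imp_le)
    fix C :: "real set" and s :: real assume C: "C \<in> sets borel" and s: "\<bar>s\<bar> = sqrt 2"
    have pos: "0 < sqrt (p (Suc j) - p j)" using p(2)[of j] by simp
    have "p (Suc j) - p j = 1 / (2 * real n)" by (simp add: p_def diff_divide_distrib[symmetric])
    then have "\<bar>s\<bar> * sqrt (p (Suc j) - p j) = sqrt (1 / real n)"
      using s by (simp add: real_sqrt_divide real_sqrt_mult)
    moreover have "s \<noteq> 0" using s by auto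
    ultimately have d: "distributed N lborel (\<lambda>\<omega>. s * (B (p (Suc j)) \<omega> - B (p j) \<omega>)) (normal_density 0 (sqrt (1 / real n)))"
      using normal_density_affine[OF sbmD(5)[OF B p(1)[of j] p(2)[of j]] pos, of s 0] by simp
    have "prob {\<omega>\<in>space N. s * (B (p (Suc j)) \<omega> - B (p j) \<omega>) \<in> C} =
        measure (distr N lborel (\<lambda>\<omega>. s * (B (p (Suc j)) \<omega> - B (p j) \<omega>))) C"
      using distributed_measurable[OF d] C
      by (subst measure_distr) (auto intro!: arg_cong[where f = prob])
    then show "prob {\<omega>\<in>space N. s * (B (p (Suc j)) \<omega> - B (p j) \<omega>) \<in> C} = measure \<mu> C"
      unfolding distributed_distr_eq_density[OF d] \<mu>_def .
  qed
  have block: "prob {\<omega>\<in>space N. \<forall>j<l. s * (B (p (Suc j)) \<omega> - B (p j) \<omega>) \<in> C j} = (\<Prod>j<l. measure \<mu> (C j))"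
    if B: "standard_brownian_motion N B" and s: "\<bar>s\<bar> = sqrt 2" and C: "\<And>j. C j \<in> sets borel"
    for B :: "real \<Rightarrow> 'b \<Rightarrow> real" and l s and C :: "nat \<Rightarrow> real set"
  proof (cases "l = 0")
    case False
    have [measurable]: "(\<lambda>\<omega>. s * (B (p (Suc j)) \<omega> - B (p j) \<omega>)) \<in> borel_measurable N" for j
      using sbmD(2)[OF B] p by (intro borel_measurable_times borel_measurable_diff) auto
    have iv: "indep_vars (\<lambda>_. borel) (\<lambda>j \<omega>. s * (B (p (Suc j)) \<omega> - B (p j) \<omega>)) {..<l}"
      by (rule indep_vars_compose2[OF law(1)[OF B]]) measurable
    have "prob (\<Inter>j\<in>{..<l}. (\<lambda>\<omega>. s * (B (p (Suc j)) \<omega> - B (p j) \<omega>)) -` C j \<inter> space N) =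
      (\<Prod>j<l. prob ((\<lambda>\<omega>. s * (B (p (Suc j)) \<omega> - B (p j) \<omega>)) -` C j \<inter> space N))"
      by (rule indep_varsD_finite[OF iv]) (use False C in auto)
    moreover have "(\<Inter>j\<in>{..<l}. (\<lambda>\<omega>. s * (B (p (Suc j)) \<omega> - B (p j) \<omega>)) -` C j \<inter> space N) =
        {\<omega>\<in>space N. \<forall>j<l. s * (B (p (Suc j)) \<omega> - B (p j) \<omega>) \<in> C j}"
      using False by auto
    moreover have "(\<lambda>\<omega>. s * (B (p (Suc j)) \<omega> - B (p j) \<omega>)) -` C j \<inter> space N =
        {\<omega>\<in>space N. s * (B (p (Suc j)) \<omega> - B (p j) \<omega>) \<in> C j}" for j by auto
    ultimately show ?thesis using law(2)[OF B C s] by simp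
  qed (simp add: prob_space)
  \<comment> \<open>Reversal of time turns increment \<open>i\<close> of the reversed motion into
    increment \<open>m - Suc i\<close> of \<open>B\<close>. If \<open>L < m\<close>, the increments
    beyond \<open>L\<close> are left free by \<open>UNIV\<close>, which has measure 1.\<close>
  define C where "C j = (if m - Suc j < L then A (m - Suc j) else UNIV)" for j
  define D where "D j = A (m + j)" for j
  have C: "C j \<in> sets borel" and D: "D j \<in> sets borel" for j using A by (auto simp: C_def D_def)
  let ?P = "(\<Pi>\<^sub>M t\<in>{0..}. borel) :: (real \<Rightarrow> real) measure"
  define U where "U = {f\<in>space ?P. \<forall>j\<in>{..<m}. - sqrt 2 * (f (p (Suc j)) - f (p j)) \<in> C j}"
  define V where "V = {f\<in>space ?P. \<forall>j\<in>{..<L - m}. sqrt 2 * (f (p (Suc j)) - f (p j)) \<in> D j}"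
  have [measurable]: "(\<lambda>f. f (p j)) \<in> borel_measurable ?P" for j
    by (rule measurable_component_singleton) (simp add: p)
  note C[measurable] D[measurable]
  have U: "U \<in> sets ?P" and V: "V \<in> sets ?P" unfolding U_def V_def by measurable
  have preU: "(\<lambda>\<omega>. \<lambda>t\<in>{0..}. B t \<omega>) -` U \<inter> space N =
      {\<omega>\<in>space N. \<forall>j<m. - sqrt 2 * (B (p (Suc j)) \<omega> - B (p j) \<omega>) \<in> C j}"
    by (auto simp: U_def space_PiM p)
  have preV: "(\<lambda>\<omega>. \<lambda>t\<in>{0..}. B (- t) \<omega>) -` V \<inter> space N =
      {\<omega>\<in>space N. \<forall>j<L - m. sqrt 2 * (B (- p (Suc j)) \<omega> - B (- p j) \<omega>) \<in> D j}"
    by (auto simp: V_def space_PiM p)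
  have Z1: "Z i \<omega> = - sqrt 2 * (B (p (Suc (m - Suc i))) \<omega> - B (p (m - Suc i)) \<omega>)" if "i < m" for i \<omega>
  proof -
    have e: "(real k - real (Suc i) / real n) / 2 = p (m - Suc i)" "(real k - real i / real n) / 2 = p (Suc (m - Suc i))"
      using n that by (auto simp: p_def m_def of_nat_diff field_simps)
    show ?thesis unfolding Z_def reversed_bm_def e by (simp only: right_diff_distrib; simp)
  qed
  have Z2: "Z (m + j) \<omega> = sqrt 2 * (B (- p (Suc j)) \<omega> - B (- p j) \<omega>)" for j \<omega>
  proof -
    have e: "(real k - real (Suc (m + j)) / real n) / 2 = - p (Suc j)" "(real k - real (m + j) / real n) / 2 = - p j"
      using n by (auto simp: p_def m_def field_simps)
    show ?thesis unfolding Z_def reversed_bm_def e by (simp only: right_diff_distrib; simp)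
  qed
  have split: "{\<omega>\<in>space N. \<forall>i<L. Z i \<omega> \<in> A i} =
    {\<omega>\<in>space N. \<forall>j<m. - sqrt 2 * (B (p (Suc j)) \<omega> - B (p j) \<omega>) \<in> C j} \<inter>
    {\<omega>\<in>space N. \<forall>j<L - m. sqrt 2 * (B (- p (Suc j)) \<omega> - B (- p j) \<omega>) \<in> D j}" (is "?l = ?r1 \<inter> ?r2")
  proof (intro equalityI subsetI IntI)
    fix \<omega> assume \<omega>: "\<omega> \<in> ?l"
    show "\<omega> \<in> ?r1"
    proof (safe, use \<omega> in simp)
      fix j assume j: "j < m"
      then have "m - Suc (m - Suc j) = j" "m - Suc j < m" by auto
      then show "- sqrt 2 * (B (p (Suc j)) \<omega> - B (p j) \<omega>) \<in> C j"
        using Z1[of "m - Suc j" \<omega>] \<omega> by (auto simp: C_def)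
    qed
    have "Z (m + j) \<omega> \<in> A (m + j)" if "j < L - m" for j using \<omega> that by auto
    then show "\<omega> \<in> ?r2" unfolding Z2 D_def using \<omega> by blast
  next
    fix \<omega> assume \<omega>: "\<omega> \<in> ?r1 \<inter> ?r2"
    have "Z i \<omega> \<in> A i" if i: "i < L" for i
    proof (cases "i < m")
      case True
      then have e: "m - Suc (m - Suc i) = i" and l: "m - Suc i < m" by auto
      have "- sqrt 2 * (B (p (Suc (m - Suc i))) \<omega> - B (p (m - Suc i)) \<omega>) \<in> C (m - Suc i)"
        using \<omega> l by blast
      then show ?thesis unfolding Z1[OF True] C_def e using i by simp
    next
      case False
      then obtain j where j: "i = m + j" by (metis le_add_diff_inverse not_less)
      have "sqrt 2 * (B (- p (Suc j)) \<omega> - B (- p j) \<omega>) \<in> D j" using \<omega> i j by auto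
      then show ?thesis unfolding j Z2 D_def .
    qed
    then show "\<omega> \<in> ?l" using \<omega> by auto
  qed
  have fac: "prob (?r1 \<inter> ?r2) = prob ?r1 * prob ?r2"
  proof -
    have "(\<lambda>\<omega>. (f \<omega>, g \<omega>)) -` (U \<times> V) \<inter> space N = (f -` U \<inter> space N) \<inter> (g -` V \<inter> space N)"
      for f g :: "'b \<Rightarrow> real \<Rightarrow> real" by auto
    from indep_varD[OF ind[unfolded indep_processes_def] U V, unfolded this preU preV]
    show ?thesis .
  qed
  have r1: "prob ?r1 = (\<Prod>j<m. measure \<mu> (C j))" by (rule block[OF B1 _ C]) simp
  have r2: "prob ?r2 = (\<Prod>j<L - m. measure \<mu> (D j))" by (rule block[OF B2 _ D]) simp
  have "(\<Prod>j<m. measure \<mu> (C j)) = (\<Prod>i<m. if i < L then measure \<mu> (A i) else 1)"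
  proof -
    interpret \<mu>: prob_space \<mu> unfolding \<mu>_def using n by (intro prob_space_normal_density) auto
    have "measure \<mu> UNIV = 1" using \<mu>.prob_space by (simp add: \<mu>_def)
    then have "(\<Prod>j<m. measure \<mu> (C j)) = (\<Prod>j<m. (\<lambda>i. if i < L then measure \<mu> (A i) else 1) (m - Suc j))"
      by (intro prod.cong) (auto simp: C_def)
    also have "\<dots> = (\<Prod>i<m. if i < L then measure \<mu> (A i) else 1)"
      by (rule prod.nat_diff_reindex)
    finally show ?thesis .
  qed
  also have "\<dots> = (\<Prod>i<min m L. measure \<mu> (A i))"
    by (subst prod.If_cases) (auto intro!: prod.cong)
  finally have C_prod: "(\<Prod>j<m. measure \<mu> (C j)) = (\<Prod>i<min m L. measure \<mu> (A i))" .
  have "(\<Prod>i<min m L. measure \<mu> (A i)) * (\<Prod>j<L - m. measure \<mu> (D j)) = (\<Prod>i<L. measure \<mu> (A i))"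
  proof (cases "L \<le> m")
    case False
    have "x < m \<or> x \<in> (\<lambda>j. m + j) ` {..<L - m}" if "x < L" for x
      using that by (cases "x < m") (auto intro!: image_eqI[of _ _ "x - m"])
    with False have "{..<L} = {..<m} \<union> (\<lambda>j. m + j) ` {..<L - m}" "min m L = m" by auto
    moreover have "(\<Prod>i\<in>(\<lambda>j. m + j) ` {..<L - m}. measure \<mu> (A i)) = (\<Prod>j<L - m. measure \<mu> (D j))"
      by (subst prod.reindex) (auto simp: D_def)
    moreover have "(\<Prod>i\<in>{..<m} \<union> (\<lambda>j. m + j) ` {..<L - m}. measure \<mu> (A i)) =
        (\<Prod>i<m. measure \<mu> (A i)) * (\<Prod>i\<in>(\<lambda>j. m + j) ` {..<L - m}. measure \<mu> (A i))"
      by (rule prod.union_disjoint) auto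
    ultimately show ?thesis by simp
  qed (simp add: min_absorb2)
  then show ?thesis unfolding split fac r1 r2 C_prod .
qed

lemma bm_on_reversed:
  fixes k :: nat and N :: "'b measure" and B :: "real \<Rightarrow> 'b \<Rightarrow> real"
  assumes B: "two_sided_brownian_motion N B"
  shows "bm_on N (reversed_bm B (real k))"
proof -
  interpret prob_space N using B by (auto simp: two_sided_brownian_motion_def standard_brownian_motion_def)
  note BP = two_sided_path[OF B]
  let ?X = "reversed_bm B (real k)"
  have meas: "?X t \<in> borel_measurable N" for t
    unfolding reversed_bm_def by (intro borel_measurable_times borel_measurable_diff borel_measurable_const BP(1))
  have law: "distr N (\<Pi>\<^sub>M i\<in>{..<L}. borel) (grid_incr n L ?X) = grid_law n L" if n: "0 < n" for n L
  proof -
    let ?\<mu> = "density lborel (normal_density 0 (sqrt (1 / real n)))"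
    interpret \<mu>: prob_space ?\<mu> using n by (intro prob_space_normal_density) auto
    interpret P: product_prob_space "\<lambda>_. ?\<mu>" "{..<L}" ..
    show ?thesis
    proof (rule P.PiM_eqI)
      show "sets (distr N (\<Pi>\<^sub>M i\<in>{..<L}. borel) (grid_incr n L ?X)) = sets (grid_law n L)"
        by (simp only: sets_distr sets_grid_law)
      fix A :: "nat \<Rightarrow> real set" assume "\<And>i. i \<in> {..<L} \<Longrightarrow> A i \<in> sets ?\<mu>"
      then have A: "i < L \<Longrightarrow> A i \<in> sets borel" for i by auto
      \<comment> \<open>The sets are known to be Borel only for \<open>i < L\<close>, whereas
        \<open>two_sided_increments\<close> takes a family that is Borel at every index.\<close>
      define A' where "A' i = (if i < L then A i else {})" for i
      have A': "A' i \<in> sets borel" for i using A by (auto simp: A'_def)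
      have box: "grid_incr n L X \<omega> \<in> Pi\<^sub>E {..<L} A \<longleftrightarrow>
          (\<forall>i<L. X (real (Suc i) / real n) \<omega> - X (real i / real n) \<omega> \<in> A' i)" for X :: "real \<Rightarrow> 'b \<Rightarrow> real" and \<omega>
        unfolding grid_incr_def A'_def PiE_iff by auto
      have "grid_incr n L ?X -` Pi\<^sub>E {..<L} A \<inter> space N =
        {\<omega>\<in>space N. \<forall>i<L. ?X (real (Suc i) / real n) \<omega> - ?X (real i / real n) \<omega> \<in> A' i}"
        unfolding box[symmetric] by blast
      then have "emeasure (distr N (\<Pi>\<^sub>M i\<in>{..<L}. borel) (grid_incr n L ?X)) (Pi\<^sub>E {..<L} A) =
         ennreal (prob {\<omega>\<in>space N. \<forall>i<L. ?X (real (Suc i) / real n) \<omega> - ?X (real i / real n) \<omega> \<in> A' i})"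
        using A by (subst emeasure_distr[OF measurable_grid_incr[OF meas]])
          (simp_all only: emeasure_eq_measure, auto intro!: sets_PiM_I_finite)
      also have "\<dots> = ennreal (\<Prod>i<L. measure ?\<mu> (A' i))"
        by (simp only: two_sided_increments[OF B n A'])
      also have "\<dots> = (\<Prod>i<L. ennreal (measure ?\<mu> (A' i)))" by (simp add: prod_ennreal)
      also have "\<dots> = (\<Prod>i<L. emeasure ?\<mu> (A i))"
        by (intro prod.cong refl) (simp add: \<mu>.emeasure_eq_measure A'_def)
      finally show "emeasure (distr N (\<Pi>\<^sub>M i\<in>{..<L}. borel) (grid_incr n L ?X)) (Pi\<^sub>E {..<L} A) =
        (\<Prod>i<L. emeasure ?\<mu> (A i))" .
    qed simp
  qed
  have "continuous_on {0..} (\<lambda>t. ?X t \<omega>)" if "\<omega> \<in> space N" for \<omega>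
    unfolding reversed_bm_def
    by (intro continuous_intros continuous_on_compose2[OF BP(2)[OF that]]) auto
  then show ?thesis
    unfolding bm_on_def using law meas prob_space_axioms by (simp add: reversed_bm_def)
qed

subsection \<open>Asymptotics near the right endpoint\<close>

lemma path_bounded:
  fixes f :: "real \<Rightarrow> real"
  assumes "continuous_on {0..} f"
  shows "bounded (f ` {0..R})"
  by (intro compact_imp_bounded compact_continuous_image continuous_on_subset[OF assms]) auto

lemma window_sup_upper:
  fixes f :: "real \<Rightarrow> real"
  assumes c: "continuous_on {0..} f" and t: "0 \<le> t" "t \<le> R"
  shows "f t \<le> window_sup 0 0 R f"
proof (rule ccontr)
  assume "\<not> f t \<le> window_sup 0 0 R f"
  then have "\<not> (\<exists>t\<in>{0..R}. \<forall>s\<in>{t..t + 0}. window_sup 0 0 R f < f s)"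
    "window_sup 0 0 R f < f t"
    using less_window_sup_iff[OF order_refl _ order_refl c, of R] t by (auto simp del: ex_simps)
  then show False using t by auto
qed

lemma shift_mono_le_sup:
  assumes G: "shift_mono R G" "G (\<lambda>_. 0) = 0" and R: "R \<le> R'" and c: "continuous_on {0..} f"
  shows "G f \<le> window_sup 0 0 R' f"
proof -
  have "G f \<le> G (\<lambda>_. 0) + window_sup 0 0 R' f"
    using R by (intro shift_monoD[OF G(1)] path_bounded[OF c]) (auto intro!: window_sup_upper[OF c] simp: image_constant_conv)
  then show ?thesis using G(2) by simp
qed

text \<open>\<open>G\<close> is at most the running maximum, whose tail is Gaussian by the maximal
  inequality. Cutting at integer levels compares the moment with a geometric series.\<close>

lemma sbm_exp_moment:
  assumes B: "standard_brownian_motion M B" and G: "shift_mono R G" "G (\<lambda>_. 0) = 0"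
  shows "integrable M (\<lambda>\<omega>. exp (2 * max 0 (G (\<lambda>t. B t \<omega>))))"
proof -
  interpret prob_space M by (rule sbmD(1)[OF B])
  define h where "h = max R 1"
  have h: "0 < h" "R \<le> h" by (auto simp: h_def)
  define Y where "Y \<omega> = window_sup 0 0 h (\<lambda>t. B t \<omega>)" for \<omega>
  have Ym[measurable]: "Y \<in> borel_measurable M" unfolding Y_def
    by (rule borel_measurable_shift_mono[OF shift_mono_window_sup sbmD(2)[OF B] sbmD(4)[OF B], of 0 h 0 h]) (use h in auto)
  have [measurable]: "(\<lambda>\<omega>. G (\<lambda>t. B t \<omega>)) \<in> borel_measurable M"
    by (rule borel_measurable_shift_mono[OF G(1) sbmD(2)[OF B] sbmD(4)[OF B]])
  \<comment> \<open>This choice turns the Chernoff bound at level \<open>k\<close> into a multiple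
    of \<open>exp (- 3 k)\<close>, which beats the weight \<open>exp (2 (k + 1))\<close>.\<close>
  define \<theta> where "\<theta> = 3 * sqrt h"
  have \<theta>: "0 < \<theta>" using h by (simp add: \<theta>_def)
  define C where "C = 2 * exp 2 * (std_normal_density \<theta> / \<theta> * exp (\<theta> * \<theta>))"
  have tail: "exp (2 * real (k + 1)) * prob {\<omega>\<in>space M. Y \<omega> > real k} \<le> C * exp (- 1) ^ k" for k
  proof -
    have "{\<omega>\<in>space M. Y \<omega> > real k} = {\<omega>\<in>space M. \<exists>s\<in>{0..h}. B s \<omega> - 0 * s > real k}"
      unfolding Y_def using less_window_sup_iff[OF order_refl _ order_refl sbmD(4)[OF B], of h] h by auto
    then have "1 / 2 * prob {\<omega>\<in>space M. Y \<omega> > real k} \<le> gtail (real k / sqrt h)"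
      using sbm_sup_tail[OF B h(1), of 0 "real k"] by (simp add: gtail_0)
    also have "\<dots> \<le> std_normal_density \<theta> / \<theta> * exp (\<theta> * (\<theta> - real k / sqrt h))"
      by (rule gtail_chernoff[OF \<theta>])
    also have "\<theta> * (\<theta> - real k / sqrt h) = \<theta> * \<theta> - 3 * real k"
      using h by (simp add: \<theta>_def right_diff_distrib)
    finally have "prob {\<omega>\<in>space M. Y \<omega> > real k} \<le> 2 * (std_normal_density \<theta> / \<theta> * exp (\<theta> * \<theta> - 3 * real k))"
      by (simp add: mult_ac)
    then have "exp (2 * real (k + 1)) * prob {\<omega>\<in>space M. Y \<omega> > real k} \<le>
        exp (2 * real (k + 1)) * (2 * (std_normal_density \<theta> / \<theta> * exp (\<theta> * \<theta> - 3 * real k)))"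
      by (intro mult_left_mono) auto
    also have "\<dots> = 2 * (std_normal_density \<theta> / \<theta>) * (exp (2 * real (k + 1)) * exp (\<theta> * \<theta> - 3 * real k))"
      by simp
    also have "exp (2 * real (k + 1)) * exp (\<theta> * \<theta> - 3 * real k) = exp 2 * exp (\<theta> * \<theta>) * exp (real k * (- 1))"
      by (simp add: exp_add[symmetric] algebra_simps)
    also have "exp (real k * (- 1)) = exp (- 1) ^ k" by (rule exp_of_nat_mult)
    also have "2 * (std_normal_density \<theta> / \<theta>) * (exp 2 * exp (\<theta> * \<theta>) * exp (- 1) ^ k) = C * exp (- 1) ^ k"
      by (simp add: C_def)
    finally show ?thesis .
  qed
  have pt: "ennreal (exp (2 * max 0 (G (\<lambda>t. B t \<omega>)))) \<le>
      1 + (\<Sum>k. ennreal (exp (2 * real (k + 1))) * indicator {\<omega>\<in>space M. Y \<omega> > real k} \<omega>)"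
    if \<omega>: "\<omega> \<in> space M" for \<omega>
  proof -
    have GY: "G (\<lambda>t. B t \<omega>) \<le> Y \<omega>"
      unfolding Y_def by (rule shift_mono_le_sup[OF G h(2) sbmD(4)[OF B \<omega>]])
    show ?thesis
    proof (cases "Y \<omega> > 0")
      case False
      with GY have "max 0 (G (\<lambda>t. B t \<omega>)) = 0" by simp
      then show ?thesis by simp
    next
      case True
      define k where "k = nat (\<lceil>Y \<omega>\<rceil> - 1)"
      have k: "real k < Y \<omega>" "Y \<omega> \<le> real (k + 1)" using True unfolding k_def by linarith+
      have "ennreal (exp (2 * max 0 (G (\<lambda>t. B t \<omega>)))) \<le> ennreal (exp (2 * real (k + 1)))"
        using GY k True by (intro ennreal_leI) auto
      also have "\<dots> = ennreal (exp (2 * real (k + 1))) * indicator {\<omega>\<in>space M. Y \<omega> > real k} \<omega>"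
        using k \<omega> by simp
      also have "\<dots> \<le> (\<Sum>k. ennreal (exp (2 * real (k + 1))) * indicator {\<omega>\<in>space M. Y \<omega> > real k} \<omega>)"
      proof -
        have "f k \<le> (\<Sum>k. f k)" for f :: "nat \<Rightarrow> ennreal"
          using sum_le_suminf[of f "{k}"] by simp
        then show ?thesis .
      qed
      also have "\<dots> \<le> 1 + \<dots>" by simp
      finally show ?thesis .
    qed
  qed
  have "(\<integral>\<^sup>+\<omega>. ennreal (exp (2 * max 0 (G (\<lambda>t. B t \<omega>)))) \<partial>M) \<le>
     (\<integral>\<^sup>+\<omega>. 1 + (\<Sum>k. ennreal (exp (2 * real (k + 1))) * indicator {\<omega>\<in>space M. Y \<omega> > real k} \<omega>) \<partial>M)"
    by (intro nn_integral_mono pt)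
  also have "\<dots> = 1 + (\<Sum>k. ennreal (exp (2 * real (k + 1))) * emeasure M {\<omega>\<in>space M. Y \<omega> > real k})"
    by (subst nn_integral_add, measurable, subst nn_integral_suminf, measurable)
      (simp add: emeasure_space_1 nn_integral_cmult_indicator)
  also have "\<dots> \<le> 1 + (\<Sum>k. ennreal (C * exp (- 1) ^ k))"
    using tail by (intro add_mono order_refl suminf_le summableI)
      (simp add: emeasure_eq_measure ennreal_mult'[symmetric] ennreal_leI del: of_nat_add of_nat_Suc)
  also have "\<dots> < \<infinity>"
  proof -
    have "summable (\<lambda>k. C * exp (- 1::real) ^ k)"
      by (intro summable_mult summable_geometric) auto
    moreover have "0 \<le> C" unfolding C_def using \<theta> by simp
    ultimately have "(\<Sum>k. ennreal (C * exp (- 1) ^ k)) \<noteq> top" by (intro ennreal_suminf_neq_top) auto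
    then show ?thesis by (simp add: less_top)
  qed
  finally show ?thesis by (intro integrableI_bounded) auto
qed

text \<open>The integrable majorant for the dominated convergence argument in the local asymptotics.\<close>

lemma gscale_gtail_bound:
  assumes u: "2 * \<bar>c\<bar> + 6 \<le> u" "2 * \<bar>T\<bar> \<le> u" and T: "0 \<le> T"
  shows "gscale c u * gtail ((u + c - (d + e / u) / u) / sqrt (1 - T / u\<^sup>2)) \<le>
    2 * exp (2 * \<bar>e\<bar>) * exp (2 * max 0 d)"
proof -
  define \<theta> where "\<theta> = u + c"
  define g where "g = (d + e / u) / u"
  define s where "s = sqrt (1 - T / u\<^sup>2)"
  have u0: "4 \<le> u" using u by linarith
  have \<theta>: "u / 2 \<le> \<theta>" "\<theta> \<le> 2 * u" "3 \<le> \<theta>" using u by (auto simp: \<theta>_def abs_le_iff)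
  have "T * 2 \<le> u * 1" using u T by simp
  also have "\<dots> \<le> u * u" using u0 by (intro mult_left_mono) auto
  finally have "T < u\<^sup>2" using u0 T by (cases "T = 0") (auto simp: power2_eq_square)
  then have s: "0 < s" "s \<le> 1" using T u0 by (auto simp: s_def)
  have ph: "0 < std_normal_density \<theta>" by (auto intro: normal_density_pos)
  have key: "gtail ((\<theta> - g) / s) \<le> std_normal_density \<theta> / \<theta> * exp (\<theta> * max 0 g)"
  proof (cases "g \<le> \<theta>")
    case True
    \<comment> \<open>Dividing a nonnegative threshold by \<open>s \<le> 1\<close> only raises it,
      so \<open>s\<close> may be dropped.\<close>
    have "(\<theta> - g) * s \<le> (\<theta> - g) * 1" using True s by (intro mult_left_mono) auto
    then have "\<theta> - g \<le> (\<theta> - g) / s" using s by (simp add: field_simps)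
    then have "gtail ((\<theta> - g) / s) \<le> gtail (\<theta> - g)" by (rule gtail_antimono)
    also have "\<dots> \<le> std_normal_density \<theta> / \<theta> * exp (\<theta> * (\<theta> - (\<theta> - g)))"
      using \<theta> by (intro gtail_chernoff) auto
    also have "\<dots> \<le> std_normal_density \<theta> / \<theta> * exp (\<theta> * max 0 g)"
      using \<theta> ph by (intro mult_left_mono) auto
    finally show ?thesis .
  next
    case False
    have "gtail ((\<theta> - g) / s) \<le> 1" by simp
    \<comment> \<open>The threshold is negative here, so the trivial bound 1 has to be absorbed. It
      is, because \<open>exp (\<theta>\<^sup>2 / 2)\<close> exceeds
      \<open>sqrt (2 * pi) * \<theta>\<close> as soon as \<open>3 \<le> \<theta>\<close>.\<close>
    also have "1 \<le> std_normal_density \<theta> / \<theta> * exp (\<theta> * \<theta>)"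
    proof -
      have "sqrt (2 * pi) \<le> sqrt (2 * 4)" using pi_less_4 by (intro real_sqrt_le_mono) auto
      also have "\<dots> \<le> 3" by (rule real_le_lsqrt) auto
      finally have p: "sqrt (2 * pi) \<le> 3" .
      have "sqrt (2 * pi) * \<theta> \<le> 3 * \<theta>" using p \<theta> by (intro mult_right_mono) auto
      also have "\<dots> \<le> 1 + \<theta>\<^sup>2 / 2 + (\<theta>\<^sup>2 / 2)\<^sup>2 / 2"
      proof -
        have t: "3 * \<theta> \<le> \<theta> * \<theta>" using \<theta>(3) by (intro mult_right_mono) auto
        have "9 * (\<theta> * \<theta>) \<le> (\<theta> * \<theta>) * (\<theta> * \<theta>)"
          using mult_mono[of 3 \<theta> 3 \<theta>] \<theta>(3) by (intro mult_right_mono) auto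
        moreover have "\<theta>\<^sup>2 / 2 = \<theta> * \<theta> / 2" "(\<theta>\<^sup>2 / 2)\<^sup>2 / 2 = (\<theta> * \<theta>) * (\<theta> * \<theta>) / 8"
          by (simp_all add: power2_eq_square)
        ultimately show ?thesis using t \<theta>(3) by linarith
      qed
      also have "\<dots> \<le> exp (\<theta>\<^sup>2 / 2)"
        by (rule exp_lower_Taylor_quadratic) auto
      finally have "1 \<le> exp (\<theta>\<^sup>2 / 2) / (sqrt (2 * pi) * \<theta>)" using \<theta> by (simp add: field_simps)
      also have "\<dots> = std_normal_density \<theta> / \<theta> * exp (\<theta> * \<theta>)"
      proof -
        have "exp (- \<theta>\<^sup>2 / 2) * exp (\<theta> * \<theta>) = exp (\<theta>\<^sup>2 / 2)"
          by (simp add: exp_add[symmetric] power2_eq_square)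
        then show ?thesis using \<theta> by (simp add: std_normal_density_def field_simps)
      qed
      finally show ?thesis .
    qed
    also have "\<dots> \<le> std_normal_density \<theta> / \<theta> * exp (\<theta> * max 0 g)"
      using \<theta> ph False by (intro mult_left_mono) (auto intro!: mult_left_mono)
    finally show ?thesis .
  qed
  have "gscale c u * gtail ((\<theta> - g) / s) \<le> gscale c u * (std_normal_density \<theta> / \<theta> * exp (\<theta> * max 0 g))"
    using key u0 by (intro mult_left_mono gscale_nonneg) auto
  also have "\<dots> = u / \<theta> * exp (\<theta> * max 0 g)"
    using ph by (simp add: gscale_def \<theta>_def)
  also have "\<dots> \<le> 2 * exp (2 * \<bar>e\<bar> + 2 * max 0 d)"
  proof (rule mult_mono)
    show "u / \<theta> \<le> 2" using \<theta> u0 by (simp add: field_simps)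
    \<comment> \<open>The crude bound \<open>\<theta> \<le> 2 * u\<close> is the source of the
      factor 2 in front of \<open>d\<close>, and hence of the order 2 of the exponential
      moment.\<close>
    have "\<theta> * max 0 g \<le> 2 * u * max 0 g" using \<theta> by (intro mult_right_mono) auto
    also have "\<dots> = 2 * max 0 (d + e / u)" using u0 by (auto simp: g_def max_def divide_le_0_iff zero_le_divide_iff)
    also have "\<dots> \<le> 2 * (max 0 d + \<bar>e\<bar>)"
    proof -
      have "e / u \<le> \<bar>e\<bar> / u" using u0 by (intro divide_right_mono) auto
      also have "\<dots> \<le> \<bar>e\<bar>" using u0 by (simp add: divide_le_eq mult_le_cancel_left1)
      finally have "e / u \<le> \<bar>e\<bar>" .
      then show ?thesis by (auto simp: max_def)
    qed
    finally show "exp (\<theta> * max 0 g) \<le> exp (2 * \<bar>e\<bar> + 2 * max 0 d)" by simp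
  qed (use \<theta> u0 in auto)
  also have "\<dots> = 2 * exp (2 * \<bar>e\<bar>) * exp (2 * max 0 d)" by (simp add: exp_add)
  finally show ?thesis by (simp add: \<theta>_def g_def s_def)
qed

text \<open>Up to \<open>o(1)\<close>, the square of the numerator is
  \<open>(u + c)^2 - 2 d\<close>, and division by \<open>1 - T / u^2\<close> adds \<open>T\<close>.
  The term \<open>e / u\<close> disappears.\<close>

lemma local_exponent_limit:
  fixes c d e T :: real
  shows "((\<lambda>u. (u + c)\<^sup>2 / 2 - ((u + c - (d + e / u) / u) / sqrt (1 - T / u\<^sup>2))\<^sup>2 / 2) \<longlongrightarrow> d - T / 2) at_top"
      (is ?A)
    and "((\<lambda>u. u / ((u + c - (d + e / u) / u) / sqrt (1 - T / u\<^sup>2))) \<longlongrightarrow> 1) at_top"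
    and "filterlim (\<lambda>u. (u + c - (d + e / u) / u) / sqrt (1 - T / u\<^sup>2)) at_top at_top"
proof -
  show ?A by (real_asymp, simp add: field_simps)
qed real_asymp+

text \<open>\<open>B h\<close> is integrated out given the rescaled path; the resulting Gaussian
  tails converge pointwise and are dominated through \<open>sbm_exp_moment\<close>. The term
  \<open>e / u\<close> makes room for the drift within the windows, which is of order
  \<open>1 / u\<close> after rescaling.\<close>

lemma local_asymptotics:
  assumes B: "standard_brownian_motion M B" and G: "shift_mono R G" "G (\<lambda>_. 0) = 0" and T: "0 \<le> T"
  shows "((\<lambda>u. gscale c u * measure M {\<omega>\<in>space M. B (1 - T / u\<^sup>2) \<omega> >
      u + c - (G (\<lambda>t. rescaled B (1 - T / u\<^sup>2) u t \<omega>) + e / u) / u}) \<longlongrightarrow>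
    (\<integral>\<omega>. exp (G (\<lambda>t. B t \<omega>) - T / 2) \<partial>M)) at_top"
proof -
  interpret prob_space M by (rule sbmD(1)[OF B])
  define D where "D \<omega> = G (\<lambda>t. B t \<omega>)" for \<omega>
  have [measurable]: "D \<in> borel_measurable M" unfolding D_def
    by (rule borel_measurable_shift_mono[OF G(1) sbmD(2)[OF B] sbmD(4)[OF B]])
  define s where "s u \<omega> = gscale c u * gtail ((u + c - (D \<omega> + e / u) / u) / sqrt (1 - T / u\<^sup>2))" for u \<omega>
  have "((\<lambda>u. \<integral>\<omega>. s u \<omega> \<partial>M) \<longlongrightarrow> (\<integral>\<omega>. exp (D \<omega> - T / 2) \<partial>M)) at_top"
  proof (rule integral_dominated_convergence_at_top[where w = "\<lambda>\<omega>. 2 * exp (2 * \<bar>e\<bar>) * exp (2 * max 0 (D \<omega>))"])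
    show "integrable M (\<lambda>\<omega>. 2 * exp (2 * \<bar>e\<bar>) * exp (2 * max 0 (D \<omega>)))"
      unfolding D_def by (intro integrable_mult_right sbm_exp_moment[OF B G])
    show "s u \<in> borel_measurable M" for u unfolding s_def by measurable
    show "AE \<omega> in M. ((\<lambda>u. s u \<omega>) \<longlongrightarrow> exp (D \<omega> - T / 2)) at_top"
      unfolding s_def by (intro AE_I2 gscale_gtail_tendsto local_exponent_limit)
    show "\<forall>\<^sub>F u in at_top. AE \<omega> in M. norm (s u \<omega>) \<le> 2 * exp (2 * \<bar>e\<bar>) * exp (2 * max 0 (D \<omega>))"
      using eventually_ge_at_top[of "2 * \<bar>c\<bar> + 6"] eventually_ge_at_top[of "2 * \<bar>T\<bar>"] eventually_ge_at_top[of 0]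
    proof eventually_elim
      case (elim u)
      have "0 \<le> s u \<omega>" for \<omega> unfolding s_def using elim gscale_nonneg[of u] by simp
      then show ?case
        using gscale_gtail_bound[OF elim(1,2) T] by (intro AE_I2) (simp add: s_def)
    qed
  qed measurable
  moreover have "\<forall>\<^sub>F u in at_top. (\<integral>\<omega>. s u \<omega> \<partial>M) =
    gscale c u * measure M {\<omega>\<in>space M. B (1 - T / u\<^sup>2) \<omega> > u + c - (G (\<lambda>t. rescaled B (1 - T / u\<^sup>2) u t \<omega>) + e / u) / u}"
    using eventually_gt_at_top[of "1 + T"]
  proof eventually_elim
    case (elim u)
    have u: "1 < u" using elim T by simp
    have "T * 1 < u * u" using elim T u by (intro mult_strict_mono) auto
    then have h: "0 < 1 - T / u\<^sup>2" using u by (simp add: power2_eq_square)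
    have u0: "0 < u" using u by simp
    have "measure M {\<omega>\<in>space M. B (1 - T / u\<^sup>2) \<omega> > u + c - (G (\<lambda>t. rescaled B (1 - T / u\<^sup>2) u t \<omega>) + e / u) / u} =
        (\<integral>\<omega>. gtail ((u + c - (D \<omega> + e / u) / u) / sqrt (1 - T / u\<^sup>2)) \<partial>M)"
      unfolding D_def
      by (rule rescaled_tail[OF B h u0 G(1), where f = "\<lambda>d. u + c - (d + e / u) / u"]) measurable
    then show ?case by (simp add: s_def)
  qed
  ultimately show ?thesis unfolding D_def by (rule Lim_transform_eventually)
qed

section \<open>Crossings of a single motion: from events to the rescaled path\<close>

definition crossing :: "'a measure \<Rightarrow> (real \<Rightarrow> 'a \<Rightarrow> real) \<Rightarrow> real \<Rightarrow> real \<Rightarrow> real \<Rightarrow> 'a set" where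
  "crossing M B c S u = {\<omega>\<in>space M. \<exists>t\<in>{0..1}. \<forall>s\<in>{t..t + S / u\<^sup>2}. B s \<omega> - c * s > u}"

text \<open>An auxiliary condition on the first component alone: it lets the window of the second
  component start at time 1. In the limit it costs nothing.\<close>

definition staying :: "'a measure \<Rightarrow> (real \<Rightarrow> 'a \<Rightarrow> real) \<Rightarrow> real \<Rightarrow> real \<Rightarrow> real \<Rightarrow> real \<Rightarrow> 'a set" where
  "staying M B c S \<eta> u = {\<omega>\<in>space M. \<forall>s\<in>{1..1 + S / u\<^sup>2}. B s \<omega> - c * s > u - \<eta>}"

lemma crossing_measurable:
  assumes B: "standard_brownian_motion M B" and "0 \<le> S"
  shows "crossing M B c S u \<in> sets M"
  unfolding crossing_def using assms(2)
  by (intro exceed_event_measurable sbm_drift[OF B]) auto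

lemma staying_measurable:
  assumes B: "standard_brownian_motion M B" and "0 \<le> S"
  shows "staying M B c S \<eta> u \<in> sets M"
proof -
  have "staying M B c S \<eta> u = {\<omega>\<in>space M. \<exists>t\<in>{1..1}. \<forall>s\<in>{t..t + S / u\<^sup>2}. B s \<omega> - c * s > u - \<eta>}"
    by (auto simp: staying_def)
  also have "\<dots> \<in> sets M"
    using assms(2) by (intro exceed_event_measurable sbm_drift[OF B]) auto
  finally show ?thesis .
qed

lemma rescale_bounds:
  fixes h t S \<sigma> q :: real
  assumes "0 < q"
  shows "t \<le> h + \<sigma> / q \<longleftrightarrow> (t - h) * q \<le> \<sigma>" and "h + \<sigma> / q \<le> t + S / q \<longleftrightarrow> \<sigma> \<le> (t - h) * q + S"
proof -
  have "t \<le> h + \<sigma> / q \<longleftrightarrow> t - h \<le> \<sigma> / q" by linarith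
  then show "t \<le> h + \<sigma> / q \<longleftrightarrow> (t - h) * q \<le> \<sigma>" using assms by (simp only: pos_le_divide_eq)
  have "h + \<sigma> / q \<le> t + S / q \<longleftrightarrow> (\<sigma> - S) / q \<le> t - h" by (simp only: diff_divide_distrib) linarith
  then show "h + \<sigma> / q \<le> t + S / q \<longleftrightarrow> \<sigma> \<le> (t - h) * q + S"
    using assms by (simp only: pos_divide_le_eq) linarith
qed

text \<open>Put \<open>s = h + \<sigma> / u^2\<close>. Then \<open>b s - c * s > u\<close> reads
  \<open>w \<sigma> > u * (u + c - b h) + c * (\<sigma> - T) / u\<close>, and
  \<open>\<bar>\<sigma> - T\<bar> \<le> T + S\<close> bounds the last term.\<close>

lemma local_window_upper:
  fixes b :: "real \<Rightarrow> real"
  assumes b: "continuous_on {0..} b" and u: "0 < u" and T: "0 \<le> T" "T \<le> u\<^sup>2" and S: "0 \<le> S"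
  defines "h \<equiv> 1 - T / u\<^sup>2"
  defines "w \<equiv> \<lambda>\<tau>. u * (b (h + \<tau> / u\<^sup>2) - b h)"
  assumes t: "h \<le> t" "t \<le> 1" and ex: "\<forall>s\<in>{t..t + S / u\<^sup>2}. b s - c * s > u"
  shows "b h > u + c - (window_sup S 0 T w + \<bar>c\<bar> * (T + S) / u) / u"
proof -
  define k where "k = \<bar>c\<bar> * (T + S)"
  have h: "0 \<le> h" using T u by (simp add: h_def divide_le_eq)
  have w: "continuous_on {0..} w"
    unfolding w_def using h u by (intro continuous_intros continuous_on_compose2[OF b]) auto
  have "(t - h) * u\<^sup>2 \<le> T / u\<^sup>2 * u\<^sup>2" using t by (intro mult_right_mono) (auto simp: h_def)
  then have t': "0 \<le> (t - h) * u\<^sup>2" "(t - h) * u\<^sup>2 \<le> T" using t u by auto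
  have "u * (u + c - b h) - k / u < window_sup S 0 T w"
    unfolding less_window_sup_iff[OF order_refl T(1) S w]
  proof (intro bexI[of _ "(t - h) * u\<^sup>2"] ballI)
    show "(t - h) * u\<^sup>2 \<in> {0..T}" using t' by simp
    fix \<sigma> assume \<sigma>: "\<sigma> \<in> {(t - h) * u\<^sup>2..(t - h) * u\<^sup>2 + S}"
    define s where "s = h + \<sigma> / u\<^sup>2"
    have "s \<in> {t..t + S / u\<^sup>2}" using \<sigma> u rescale_bounds[of "u\<^sup>2"] by (auto simp: s_def)
    then have gt: "b s - c * s > u" using ex by blast
    have "0 \<le> \<sigma>" "\<sigma> \<le> T + S" using \<sigma> t' by auto
    then have "\<bar>c * (\<sigma> - T)\<bar> \<le> k" unfolding k_def abs_mult using T S by (intro mult_left_mono) auto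
    then have "- k \<le> c * (\<sigma> - T)" by linarith
    then have "- k / u \<le> c * (\<sigma> - T) / u" using u by (intro divide_right_mono) auto
    moreover have "u * (c * s) = u * c + c * (\<sigma> - T) / u"
      using u by (simp add: s_def h_def field_simps power2_eq_square)
    moreover have "w \<sigma> = u * b s - u * b h" by (simp add: w_def s_def right_diff_distrib)
    moreover have "u * u < u * b s - u * (c * s)" using gt u by (simp add: right_diff_distrib[symmetric])
    ultimately show "u * (u + c - b h) - k / u < w \<sigma>" by (simp add: algebra_simps)
  qed
  then have "u * (u + c - b h) < window_sup S 0 T w + k / u" by simp
  then have "u + c - b h < (window_sup S 0 T w + k / u) / u" using u by (simp add: field_simps)
  then show ?thesis by (simp add: k_def)
qed

text \<open>The same computation read backwards, with the drift error now on the unfavourable side.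
  The second argument of \<open>min\<close> keeps the rescaled path after \<open>T\<close> at most
  \<open>K\<close> below the level required for a crossing, that is at most \<open>K / u\<close> in
  the original scale.\<close>

lemma local_window_lower:
  fixes b :: "real \<Rightarrow> real"
  assumes b: "continuous_on {0..} b" and u: "0 < u" and T: "0 \<le> T" "T \<le> u\<^sup>2" and S: "0 \<le> S" "0 \<le> S'"
    and K: "K / u \<le> \<eta>"
  defines "h \<equiv> 1 - T / u\<^sup>2"
  defines "w \<equiv> \<lambda>\<tau>. u * (b (h + \<tau> / u\<^sup>2) - b h)"
  assumes gt: "b h > u + c - (min (window_sup S 0 T w) (K + window_sup S' T T w) + - (\<bar>c\<bar> * (T + S + S')) / u) / u"
  shows "\<exists>t\<in>{0..1}. \<forall>s\<in>{t..t + S / u\<^sup>2}. b s - c * s > u"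
    and "\<forall>s\<in>{1..1 + S' / u\<^sup>2}. b s - c * s > u - \<eta>"
proof -
  define k where "k = \<bar>c\<bar> * (T + S + S')"
  have h: "0 \<le> h" using T u by (simp add: h_def divide_le_eq)
  have w: "continuous_on {0..} w"
    unfolding w_def using h u by (intro continuous_intros continuous_on_compose2[OF b]) auto
  define x where "x = u * (u + c - b h) + k / u"
  have "u + c - b h < (min (window_sup S 0 T w) (K + window_sup S' T T w) + - k / u) / u"
    using gt by (simp add: k_def)
  then have "(u + c - b h) * u < min (window_sup S 0 T w) (K + window_sup S' T T w) + - k / u"
    unfolding pos_less_divide_eq[OF u] .
  moreover have "x = (u + c - b h) * u + k / u" by (simp add: x_def)
  ultimately have "x < min (window_sup S 0 T w) (K + window_sup S' T T w)" by linarith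
  then have x: "x < window_sup S 0 T w" "x - K < window_sup S' T T w" by auto
  \<comment> \<open>\<open>x\<close> is the rescaled level that guarantees a crossing whatever the
    drift error. It is used with \<open>y = x\<close> for the crossing and with
    \<open>y = x - K\<close> for the stay above \<open>u - \<eta>\<close>.\<close>
  have unscale: "u + (y - x) / u < b s - c * s"
    if \<sigma>: "0 \<le> \<sigma>" "\<sigma> \<le> T + S + S'" "s = h + \<sigma> / u\<^sup>2" and y: "y < w \<sigma>" for \<sigma> s y
  proof -
    have "\<bar>c * (\<sigma> - T)\<bar> \<le> k" unfolding k_def abs_mult using \<sigma> T S by (intro mult_left_mono) auto
    then have "c * (\<sigma> - T) \<le> k" by linarith
    then have "c * (\<sigma> - T) / u \<le> k / u" using u by (intro divide_right_mono) auto
    moreover have "u * (c * s) = u * c + c * (\<sigma> - T) / u"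
      using u by (simp add: \<sigma> h_def field_simps power2_eq_square)
    moreover have "w \<sigma> = u * b s - u * b h" by (simp add: w_def \<sigma> right_diff_distrib)
    ultimately have "u * u + (y - x) < u * (b s - c * s)" using y by (simp add: x_def algebra_simps)
    then show ?thesis using u by (simp add: field_simps)
  qed
  show "\<exists>t\<in>{0..1}. \<forall>s\<in>{t..t + S / u\<^sup>2}. b s - c * s > u"
  proof -
    obtain t' where t': "0 \<le> t'" "t' \<le> T" "\<And>\<sigma>. \<sigma> \<in> {t'..t'+S} \<Longrightarrow> x < w \<sigma>"
      using x(1) unfolding less_window_sup_iff[OF order_refl T(1) S(1) w] by auto
    have "b s - c * s > u" if s: "s \<in> {h + t' / u\<^sup>2..h + t' / u\<^sup>2 + S / u\<^sup>2}" for s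
    proof -
      define \<sigma> where "\<sigma> = (s - h) * u\<^sup>2"
      have \<sigma>: "\<sigma> \<in> {t'..t'+S}" "s = h + \<sigma> / u\<^sup>2"
      proof -
        show "s = h + \<sigma> / u\<^sup>2" using u by (simp add: \<sigma>_def)
        have "(h + t' / u\<^sup>2 - h) * u\<^sup>2 = t'" using u by simp
        then show "\<sigma> \<in> {t'..t'+S}"
          using s u rescale_bounds[where q = "u\<^sup>2" and t = "h + t' / u\<^sup>2" and h = h and \<sigma> = \<sigma>] \<open>s = h + \<sigma> / u\<^sup>2\<close> by auto
      qed
      show ?thesis using unscale[of \<sigma> s x] \<sigma> t' S by auto
    qed
    moreover have "h + t' / u\<^sup>2 \<in> {0..1}" using h t' u by (auto simp: h_def field_simps)
    ultimately show ?thesis by blast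
  qed
  show "\<forall>s\<in>{1..1 + S' / u\<^sup>2}. b s - c * s > u - \<eta>"
  proof
    fix s assume s: "s \<in> {1..1 + S' / u\<^sup>2}"
    define \<sigma> where "\<sigma> = (s - h) * u\<^sup>2"
    have \<sigma>: "\<sigma> \<in> {T..T+S'}" "s = h + \<sigma> / u\<^sup>2"
    proof -
      show "s = h + \<sigma> / u\<^sup>2" using u by (simp add: \<sigma>_def)
      have "(1 - h) * u\<^sup>2 = T" using u by (simp add: h_def)
      then show "\<sigma> \<in> {T..T+S'}"
        using s u rescale_bounds[where q = "u\<^sup>2" and t = 1 and h = h and \<sigma> = \<sigma>] \<open>s = h + \<sigma> / u\<^sup>2\<close> by auto
    qed
    have "x - K < w \<sigma>"
      using x(2) \<sigma>(1) unfolding less_window_sup_iff[OF T(1) order_refl S(2) w] by auto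
    then have "b s - c * s > u + (x - K - x) / u" using \<sigma> S T by (intro unscale) auto
    moreover have "(x - K - x) / u = - (K / u)" by simp
    ultimately show "b s - c * s > u - \<eta>" using K by linarith
  qed
qed

definition truncated_constant :: "'a measure \<Rightarrow> (real \<Rightarrow> 'a \<Rightarrow> real) \<Rightarrow> real \<Rightarrow> real \<Rightarrow> real" where
  "truncated_constant M B S T = (\<integral>\<omega>. exp (window_sup S 0 T (\<lambda>t. B t \<omega>) - T / 2) \<partial>M)"

lemma gtail_early_limit:
  fixes c T :: real
  shows "((\<lambda>u. gscale c u * gtail ((u + c * (1 - T / u\<^sup>2)) / sqrt (1 - T / u\<^sup>2))) \<longlongrightarrow> exp (- T / 2)) at_top"
proof (rule gscale_gtail_tendsto)
  show "((\<lambda>u. (u + c)\<^sup>2 / 2 - ((u + c * (1 - T / u\<^sup>2)) / sqrt (1 - T / u\<^sup>2))\<^sup>2 / 2) \<longlongrightarrow> - T / 2) at_top"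
    by (real_asymp, simp add: field_simps)
  show "((\<lambda>u. u / ((u + c * (1 - T / u\<^sup>2)) / sqrt (1 - T / u\<^sup>2))) \<longlongrightarrow> 1) at_top"
    by real_asymp
  show "filterlim (\<lambda>u. (u + c * (1 - T / u\<^sup>2)) / sqrt (1 - T / u\<^sup>2)) at_top at_top"
    by real_asymp
qed

lemma eventually_local_scale:
  assumes "0 \<le> T"
  shows "eventually (\<lambda>u::real. 1 < u \<and> T < u\<^sup>2) at_top"
  using eventually_gt_at_top[of "1 + T"]
proof eventually_elim
  case (elim u)
  have u: "1 < u" using elim assms by simp
  have "T * 1 < u * u" using elim assms u by (intro mult_strict_mono) auto
  then show ?case using u by (simp add: power2_eq_square)
qed

text \<open>The window starts either after \<open>1 - T / u^2\<close>, which forces the local event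
  \<open>L u\<close>, or before, where the path already exceeds the level early;
  \<open>sbm_sup_tail\<close> bounds that event \<open>E u\<close> at the price of the factor
  \<open>1 / gtail \<bar>c\<bar>\<close>.\<close>

lemma crossing_upper_T:
  assumes B: "standard_brownian_motion M B" and S: "0 \<le> S" and T: "0 \<le> T" and \<epsilon>: "0 < \<epsilon>"
  shows "\<forall>\<^sub>F u in at_top. gscale c u * measure M (crossing M B c S u) \<le> truncated_constant M B S T + exp (- T / 2) / gtail \<bar>c\<bar> + \<epsilon>"
proof -
  interpret prob_space M by (rule sbmD(1)[OF B])
  define G where "G = window_sup S 0 T"
  define e where "e = \<bar>c\<bar> * (T + S)"
  have G: "shift_mono (T + S) G" "G (\<lambda>_. 0) = 0"
    unfolding G_def using S T by (auto intro: shift_mono_window_sup)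
  define L where "L u = {\<omega>\<in>space M. B (1 - T / u\<^sup>2) \<omega> > u + c - (G (\<lambda>t. rescaled B (1 - T / u\<^sup>2) u t \<omega>) + e / u) / u}" for u
  define E where "E u = {\<omega>\<in>space M. \<exists>s\<in>{0..1 - T / u\<^sup>2}. B s \<omega> - c * s > u}" for u
  have lim: "((\<lambda>u. gscale c u * prob (L u) + gscale c u * gtail ((u + c * (1 - T / u\<^sup>2)) / sqrt (1 - T / u\<^sup>2)) / gtail \<bar>c\<bar>)
     \<longlongrightarrow> truncated_constant M B S T + exp (- T / 2) / gtail \<bar>c\<bar>) at_top"
    unfolding L_def truncated_constant_def G_def[symmetric]
    by (intro tendsto_add tendsto_divide tendsto_const gtail_early_limit local_asymptotics[OF B G T])
      (use gtail_pos[of "\<bar>c\<bar>"] in simp)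
  then have "\<forall>\<^sub>F u in at_top. gscale c u * prob (L u) + gscale c u * gtail ((u + c * (1 - T / u\<^sup>2)) / sqrt (1 - T / u\<^sup>2)) / gtail \<bar>c\<bar>
      < truncated_constant M B S T + exp (- T / 2) / gtail \<bar>c\<bar> + \<epsilon>"
    by (rule order_tendstoD(2)) (use \<epsilon> in simp)
  then show ?thesis
    using eventually_local_scale[OF T]
  proof eventually_elim
    case (elim u)
    have u: "0 < u" "T < u\<^sup>2" "1 < u" using elim by auto
    have h: "0 < 1 - T / u\<^sup>2" "1 - T / u\<^sup>2 \<le> 1" using u T by (auto simp: divide_less_eq)
    have W: "bm_on M (rescaled B (1 - T / u\<^sup>2) u)" by (rule bm_on_rescaled[OF B less_imp_le[OF h(1)] u(1)])
    have [measurable]: "(\<lambda>\<omega>. G (\<lambda>t. rescaled B (1 - T / u\<^sup>2) u t \<omega>)) \<in> borel_measurable M"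
      by (rule borel_measurable_shift_mono[OF G(1) bm_onD(2)[OF W] bm_onD(4)[OF W]])
    have [measurable]: "B (1 - T / u\<^sup>2) \<in> borel_measurable M" using h by (intro sbmD(2)[OF B]) auto
    have L: "L u \<in> events" unfolding L_def by measurable
    have E: "E u \<in> events" unfolding E_def using h by (intro sup_event_measurable sbm_drift[OF B]) auto
    have "crossing M B c S u \<subseteq> L u \<union> E u"
    proof
      fix \<omega> assume "\<omega> \<in> crossing M B c S u"
      then obtain t where \<omega>: "\<omega> \<in> space M" and t: "0 \<le> t" "t \<le> 1" and ex: "\<forall>s\<in>{t..t + S / u\<^sup>2}. B s \<omega> - c * s > u"
        by (auto simp: crossing_def)
      show "\<omega> \<in> L u \<union> E u"
      proof (cases "t \<le> 1 - T / u\<^sup>2")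
        case True
        have "B t \<omega> - c * t > u" using ex S u by auto
        with True t \<omega> show ?thesis by (auto simp: E_def)
      next
        case False
        have "B (1 - T / u\<^sup>2) \<omega> > u + c - (window_sup S 0 T (\<lambda>\<tau>. u * (B (1 - T / u\<^sup>2 + \<tau> / u\<^sup>2) \<omega> - B (1 - T / u\<^sup>2) \<omega>)) + \<bar>c\<bar> * (T + S) / u) / u"
          by (rule local_window_upper[OF sbmD(4)[OF B \<omega>] u(1) T _ S _ t(2) ex]) (use False u in auto)
        then show ?thesis using \<omega> by (simp add: L_def G_def e_def rescaled_def)
      qed
    qed
    then have "prob (crossing M B c S u) \<le> prob (L u \<union> E u)"
      using L E by (intro finite_measure_mono) auto
    also have "\<dots> \<le> prob (L u) + prob (E u)" by (rule measure_Un_le[OF L E])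
    also have "prob (E u) \<le> gtail ((u + c * (1 - T / u\<^sup>2)) / sqrt (1 - T / u\<^sup>2)) / gtail \<bar>c\<bar>"
    proof -
      have "\<bar>c\<bar> * sqrt (1 - T / u\<^sup>2) \<le> \<bar>c\<bar> * 1" using h by (intro mult_left_mono) auto
      then have "gtail \<bar>c\<bar> * prob (E u) \<le> gtail (\<bar>c\<bar> * sqrt (1 - T / u\<^sup>2)) * prob (E u)"
        by (intro mult_right_mono gtail_antimono) auto
      also have "\<dots> \<le> gtail ((u + c * (1 - T / u\<^sup>2)) / sqrt (1 - T / u\<^sup>2))"
        unfolding E_def by (rule sbm_sup_tail[OF B h(1)])
      finally show ?thesis using gtail_pos[of "\<bar>c\<bar>"] by (simp add: field_simps)
    qed
    finally have "prob (crossing M B c S u) \<le> prob (L u) + gtail ((u + c * (1 - T / u\<^sup>2)) / sqrt (1 - T / u\<^sup>2)) / gtail \<bar>c\<bar>" by simp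
    then have "gscale c u * prob (crossing M B c S u) \<le>
        gscale c u * (prob (L u) + gtail ((u + c * (1 - T / u\<^sup>2)) / sqrt (1 - T / u\<^sup>2)) / gtail \<bar>c\<bar>)"
      using u by (intro mult_left_mono gscale_nonneg) auto
    with elim show ?case by (simp add: distrib_left)
  qed
qed

lemma crossing_lower_TK:
  assumes B: "standard_brownian_motion M B" and S: "0 \<le> S" "0 \<le> S'" and T: "0 \<le> T"
    and K: "0 \<le> K" and \<eta>: "0 < \<eta>" and \<epsilon>: "0 < \<epsilon>"
  shows "\<forall>\<^sub>F u in at_top. gscale c u * measure M (crossing M B c S u \<inter> staying M B c S' \<eta> u) \<ge>
    (\<integral>\<omega>. exp (min (window_sup S 0 T (\<lambda>t. B t \<omega>)) (K + window_sup S' T T (\<lambda>t. B t \<omega>)) - T / 2) \<partial>M) - \<epsilon>"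
proof -
  interpret prob_space M by (rule sbmD(1)[OF B])
  define G where "G f = min (window_sup S 0 T f) (K + window_sup S' T T f)" for f
  define e where "e = - (\<bar>c\<bar> * (T + S + S'))"
  have G1: "shift_mono (T + S + S') G"
    unfolding G_def[abs_def] using S T by (intro shift_mono_min shift_mono_window_sup) auto
  have G: "shift_mono (T + S + S') G" "G (\<lambda>_. 0) = 0"
    using G1 S T K by (auto simp: G_def)
  define L where "L u = {\<omega>\<in>space M. B (1 - T / u\<^sup>2) \<omega> > u + c - (G (\<lambda>t. rescaled B (1 - T / u\<^sup>2) u t \<omega>) + e / u) / u}" for u
  have "\<forall>\<^sub>F u in at_top. (\<integral>\<omega>. exp (G (\<lambda>t. B t \<omega>) - T / 2) \<partial>M) - \<epsilon> < gscale c u * prob (L u)"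
    unfolding L_def by (rule order_tendstoD(1)[OF local_asymptotics[OF B G T]]) (use \<epsilon> in simp)
  then show ?thesis
    using eventually_local_scale[OF T] eventually_ge_at_top[of "K / \<eta>"]
  proof eventually_elim
    case (elim u)
    have u: "0 < u" "T < u\<^sup>2" "1 < u" using elim by auto
    have Ku: "K / u \<le> \<eta>" using elim u \<eta> by (simp add: field_simps)
    have "L u \<subseteq> crossing M B c S u \<inter> staying M B c S' \<eta> u"
    proof
      fix \<omega> assume "\<omega> \<in> L u"
      then have \<omega>: "\<omega> \<in> space M" and gt: "B (1 - T / u\<^sup>2) \<omega> > u + c - (min
          (window_sup S 0 T (\<lambda>\<tau>. u * (B (1 - T / u\<^sup>2 + \<tau> / u\<^sup>2) \<omega> - B (1 - T / u\<^sup>2) \<omega>)))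
          (K + window_sup S' T T (\<lambda>\<tau>. u * (B (1 - T / u\<^sup>2 + \<tau> / u\<^sup>2) \<omega> - B (1 - T / u\<^sup>2) \<omega>))) + - (\<bar>c\<bar> * (T + S + S')) / u) / u"
        by (auto simp: L_def G_def e_def rescaled_def)
      show "\<omega> \<in> crossing M B c S u \<inter> staying M B c S' \<eta> u"
        using local_window_lower[OF sbmD(4)[OF B \<omega>] u(1) T less_imp_le[OF u(2)] S Ku gt] \<omega>
        by (auto simp: crossing_def staying_def)
    qed
    then have "prob (L u) \<le> prob (crossing M B c S u \<inter> staying M B c S' \<eta> u)"
      by (intro finite_measure_mono) (auto intro: crossing_measurable[OF B] staying_measurable[OF B] S)
    then have "gscale c u * prob (L u) \<le> gscale c u * prob (crossing M B c S u \<inter> staying M B c S' \<eta> u)"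
      using u by (intro mult_left_mono gscale_nonneg) auto
    with elim show ?case by (simp add: G_def)
  qed
qed

lemma window_sup_integrable:
  assumes B: "standard_brownian_motion M B" and "0 \<le> S" "0 \<le> T"
  shows "(\<lambda>\<omega>. window_sup S 0 T (\<lambda>t. B t \<omega>)) \<in> borel_measurable M"
    and "integrable M (\<lambda>\<omega>. exp (window_sup S 0 T (\<lambda>t. B t \<omega>) - T / 2))"
proof -
  have G: "shift_mono (T + S) (window_sup S 0 T)" "window_sup S 0 T (\<lambda>_. 0) = 0"
    using assms by (auto intro: shift_mono_window_sup)
  show [measurable]: "(\<lambda>\<omega>. window_sup S 0 T (\<lambda>t. B t \<omega>)) \<in> borel_measurable M"
    by (rule borel_measurable_shift_mono[OF G(1) sbmD(2)[OF B] sbmD(4)[OF B]])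
  show "integrable M (\<lambda>\<omega>. exp (window_sup S 0 T (\<lambda>t. B t \<omega>) - T / 2))"
    using assms(3) by (intro Bochner_Integration.integrable_bound[OF sbm_exp_moment[OF B G]] AE_I2) (auto simp: max_def)
qed

text \<open>As \<open>K\<close> grows, the minimum equals its first argument from some point on, for
  every path. A single large \<open>K\<close> is fixed before \<open>u\<close> tends to infinity, so
  that \<open>K / u \<le> \<eta>\<close> holds eventually.\<close>

lemma crossing_lower_T:
  assumes B: "standard_brownian_motion M B" and S: "0 \<le> S" "0 \<le> S'" and T: "0 \<le> T"
    and \<eta>: "0 < \<eta>" and \<epsilon>: "0 < \<epsilon>"
  shows "\<forall>\<^sub>F u in at_top. gscale c u * measure M (crossing M B c S u \<inter> staying M B c S' \<eta> u) \<ge> truncated_constant M B S T - \<epsilon>"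
proof -
  interpret prob_space M by (rule sbmD(1)[OF B])
  define D where "D \<omega> = window_sup S 0 T (\<lambda>t. B t \<omega>)" for \<omega>
  define I where "I \<omega> = window_sup S' T T (\<lambda>t. B t \<omega>)" for \<omega>
  have [measurable]: "D \<in> borel_measurable M" unfolding D_def by (rule window_sup_integrable[OF B S(1) T])
  have [measurable]: "I \<in> borel_measurable M" unfolding I_def
    by (rule borel_measurable_shift_mono[OF shift_mono_window_sup sbmD(2)[OF B] sbmD(4)[OF B], of T T S' "T + S'"])
      (use T S in auto)
  have "(\<lambda>K::nat. \<integral>\<omega>. exp (min (D \<omega>) (real K + I \<omega>) - T / 2) \<partial>M) \<longlonglongrightarrow> (\<integral>\<omega>. exp (D \<omega> - T / 2) \<partial>M)"
  proof (rule integral_dominated_convergence[where w = "\<lambda>\<omega>. exp (D \<omega> - T / 2)"])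
    show "integrable M (\<lambda>\<omega>. exp (D \<omega> - T / 2))" unfolding D_def by (rule window_sup_integrable[OF B S(1) T])
    show "AE \<omega> in M. (\<lambda>K. exp (min (D \<omega>) (real K + I \<omega>) - T / 2)) \<longlonglongrightarrow> exp (D \<omega> - T / 2)"
    proof (intro AE_I2 tendsto_eventually)
      fix \<omega>
      obtain N :: nat where "D \<omega> - I \<omega> \<le> real N" using real_arch_simple by blast
      then show "\<forall>\<^sub>F K in sequentially. exp (min (D \<omega>) (real K + I \<omega>) - T / 2) = exp (D \<omega> - T / 2)"
        by (intro eventually_sequentiallyI[of N]) (simp add: min_def)
    qed
  qed auto
  then have "\<forall>\<^sub>F K in sequentially. (\<integral>\<omega>. exp (D \<omega> - T / 2) \<partial>M) - \<epsilon> / 2 < (\<integral>\<omega>. exp (min (D \<omega>) (real K + I \<omega>) - T / 2) \<partial>M)"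
    by (rule order_tendstoD(1)) (use \<epsilon> in simp)
  then obtain K :: nat where K: "(\<integral>\<omega>. exp (D \<omega> - T / 2) \<partial>M) - \<epsilon> / 2 < (\<integral>\<omega>. exp (min (D \<omega>) (real K + I \<omega>) - T / 2) \<partial>M)"
    by (auto simp: eventually_sequentially)
  have "0 < \<epsilon> / 2" using \<epsilon> by simp
  from crossing_lower_TK[OF B S T of_nat_0_le_iff \<eta> this, of K c]
  show ?thesis
    by eventually_elim (use K in \<open>simp add: D_def I_def truncated_constant_def\<close>)
qed

text \<open>The constant does not contain the drift, so the asymptotics may be read at
  \<open>c = 0\<close>, where the crossing probability is at most \<open>2 * gtail u\<close> and
  \<open>gscale 0 u * gtail u\<close> tends to 1.\<close>

lemma truncated_constant_0_le_2:
  assumes B: "standard_brownian_motion M B" and T: "0 \<le> T"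
  shows "truncated_constant M B 0 T \<le> 2"
proof (rule field_le_epsilon)
  fix \<epsilon> :: real assume \<epsilon>: "0 < \<epsilon>"
  interpret prob_space M by (rule sbmD(1)[OF B])
  have "((\<lambda>u. gscale 0 u * gtail u) \<longlongrightarrow> exp 0) at_top"
    using gtail_early_limit[of 0 0] by simp
  then have "\<forall>\<^sub>F u in at_top. gscale 0 u * gtail u < 1 + \<epsilon> / 4"
    by (rule order_tendstoD(2)) (use \<epsilon> in simp)
  moreover have "\<forall>\<^sub>F u in at_top. gscale 0 u * prob (crossing M B 0 0 u \<inter> staying M B 0 0 1 u) \<ge> truncated_constant M B 0 T - \<epsilon> / 2"
    by (rule crossing_lower_T[OF B]) (use T \<epsilon> in auto)
  moreover have "\<forall>\<^sub>F u in at_top. 0 < (u::real)" by (rule eventually_gt_at_top)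
  ultimately have "\<forall>\<^sub>F u::real in at_top. truncated_constant M B 0 T \<le> 2 + \<epsilon>"
  proof eventually_elim
    case (elim u)
    have "prob (crossing M B 0 0 u \<inter> staying M B 0 0 1 u) \<le> prob (crossing M B 0 0 u)"
      by (intro finite_measure_mono crossing_measurable[OF B]) auto
    also have "\<dots> \<le> 2 * gtail u"
      using sbm_sup_tail[OF B zero_less_one, of 0 u] by (simp add: gtail_0 crossing_def)
    finally have "gscale 0 u * prob (crossing M B 0 0 u \<inter> staying M B 0 0 1 u) \<le> gscale 0 u * (2 * gtail u)"
      using elim by (intro mult_left_mono gscale_nonneg) auto
    then show ?case using elim by simp
  qed
  then show "truncated_constant M B 0 T \<le> 2 + \<epsilon>" by (simp add: eventually_const_iff)
qed

text \<open>Again at \<open>c = 0\<close>, now with the lower half of the reflection principle. The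
  error term is the weight of early crossings, \<open>exp (- T / 2) / gtail 0\<close> with
  \<open>gtail 0 = 1 / 2\<close>.\<close>

lemma truncated_constant_0_ge:
  assumes B: "standard_brownian_motion M B" and T: "0 \<le> T"
  shows "2 - 2 * exp (- T / 2) \<le> truncated_constant M B 0 T"
proof (rule field_le_epsilon)
  fix \<epsilon> :: real assume \<epsilon>: "0 < \<epsilon>"
  interpret prob_space M by (rule sbmD(1)[OF B])
  have "((\<lambda>u. gscale 0 u * gtail u) \<longlongrightarrow> exp 0) at_top"
    using gtail_early_limit[of 0 0] by simp
  then have "\<forall>\<^sub>F u in at_top. 1 - \<epsilon> / 4 < gscale 0 u * gtail u"
    by (rule order_tendstoD(1)) (use \<epsilon> in simp)
  moreover have "\<forall>\<^sub>F u in at_top. gscale 0 u * prob (crossing M B 0 0 u) \<le> truncated_constant M B 0 T + exp (- T / 2) / gtail \<bar>0\<bar> + \<epsilon> / 2"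
    by (rule crossing_upper_T[OF B]) (use T \<epsilon> in auto)
  moreover have "\<forall>\<^sub>F u in at_top. 0 < (u::real)" by (rule eventually_gt_at_top)
  ultimately have "\<forall>\<^sub>F u::real in at_top. 2 - 2 * exp (- T / 2) \<le> truncated_constant M B 0 T + \<epsilon>"
  proof eventually_elim
    case (elim u)
    have "2 * gtail u \<le> prob (crossing M B 0 0 u)"
      using sbm_reflection_lower[OF B, of u] elim by (simp add: crossing_def)
    then have "gscale 0 u * (2 * gtail u) \<le> gscale 0 u * prob (crossing M B 0 0 u)"
      using elim by (intro mult_left_mono gscale_nonneg) auto
    then show ?case using elim by (simp add: gtail_0)
  qed
  then show "2 - 2 * exp (- T / 2) \<le> truncated_constant M B 0 T + \<epsilon>" by (simp add: eventually_const_iff)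
qed

lemma window_sup_antimono:
  fixes f :: "real \<Rightarrow> real"
  assumes "continuous_on {0..} f" "0 \<le> T" "0 \<le> S"
  shows "window_sup S 0 T f \<le> window_sup 0 0 T f"
proof (rule dense_le)
  fix x assume "x < window_sup S 0 T f"
  then have "x < window_sup 0 0 T f"
    unfolding less_window_sup_iff[OF order_refl assms(2,3,1)] less_window_sup_iff[OF order_refl assms(2) order_refl assms(1)]
    using assms(3) by fastforce
  then show "x \<le> window_sup 0 0 T f" by simp
qed

text \<open>Longer windows only lower the functional, so \<open>S = 0\<close> is the worst case. The
  bound is uniform in \<open>T\<close>, which makes the constant of the theorem finite.\<close>

lemma truncated_constant_le_2:
  assumes B: "standard_brownian_motion M B" and "0 \<le> T" "0 \<le> S"
  shows "truncated_constant M B S T \<le> 2"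
proof -
  have "truncated_constant M B S T \<le> truncated_constant M B 0 T"
    unfolding truncated_constant_def using window_sup_antimono[OF sbmD(4)[OF B] assms(2,3)]
    by (intro integral_mono window_sup_integrable[OF B]) (use assms in auto)
  also have "\<dots> \<le> 2" by (rule truncated_constant_0_le_2[OF B assms(2)])
  finally show ?thesis .
qed

text \<open>\<open>T\<close> is natural so that it lies on every grid, as the change of measure and
  the time reversal require. A supremum is the right form because every \<open>T\<close> gives a
  lower bound for crossings, and an upper bound up to an error that vanishes as \<open>T\<close>
  grows.\<close>

definition limit_constant :: "'a measure \<Rightarrow> (real \<Rightarrow> 'a \<Rightarrow> real) \<Rightarrow> real \<Rightarrow> real" where
  "limit_constant M B S = (SUP T::nat. truncated_constant M B S (real T))"

lemma truncated_constant_bdd_above: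
  assumes B: "standard_brownian_motion M B" and "0 \<le> S"
  shows "bdd_above (range (\<lambda>T::nat. truncated_constant M B S (real T)))"
  by (intro bdd_aboveI2[where M = 2] truncated_constant_le_2[OF B] assms(2)) auto

lemma limit_constant_0:
  assumes B: "standard_brownian_motion M B"
  shows "limit_constant M B 0 = 2"
proof (rule antisym)
  show "limit_constant M B 0 \<le> 2" unfolding limit_constant_def by (intro cSUP_least truncated_constant_le_2[OF B]) auto
  have "(\<lambda>T::nat. 2 - 2 * exp (- real T / 2)) \<longlonglongrightarrow> 2" by real_asymp
  then show "2 \<le> limit_constant M B 0"
  proof (rule LIMSEQ_le_const2, intro exI allI impI)
    fix T :: nat
    have "2 - 2 * exp (- real T / 2) \<le> truncated_constant M B 0 (real T)" by (rule truncated_constant_0_ge[OF B]) simp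
    also have "\<dots> \<le> limit_constant M B 0" unfolding limit_constant_def by (intro cSUP_upper truncated_constant_bdd_above[OF B]) auto
    finally show "2 - 2 * exp (- real T / 2) \<le> limit_constant M B 0" .
  qed
qed

lemma crossing_upper:
  assumes B: "standard_brownian_motion M B" and S: "0 \<le> S" and \<epsilon>: "0 < \<epsilon>"
  shows "\<forall>\<^sub>F u in at_top. gscale c u * measure M (crossing M B c S u) \<le> limit_constant M B S + \<epsilon>"
proof -
  have "(\<lambda>T::nat. exp (- real T / 2) / gtail \<bar>c\<bar>) \<longlonglongrightarrow> 0 / gtail \<bar>c\<bar>"
  proof (intro tendsto_divide tendsto_const)
    show "(\<lambda>T::nat. exp (- real T / 2)) \<longlonglongrightarrow> 0" by real_asymp
  qed (use gtail_pos[of "\<bar>c\<bar>"] in simp)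
  then have "\<forall>\<^sub>F T::nat in sequentially. exp (- real T / 2) / gtail \<bar>c\<bar> < \<epsilon> / 2"
    by (rule order_tendstoD(2)) (use \<epsilon> in simp)
  then obtain T :: nat where T: "exp (- real T / 2) / gtail \<bar>c\<bar> < \<epsilon> / 2"
    by (auto simp: eventually_sequentially)
  have "truncated_constant M B S (real T) \<le> limit_constant M B S"
    unfolding limit_constant_def by (intro cSUP_upper truncated_constant_bdd_above[OF B] S) auto
  moreover have "\<forall>\<^sub>F u in at_top. gscale c u * measure M (crossing M B c S u) \<le> truncated_constant M B S (real T) + exp (- real T / 2) / gtail \<bar>c\<bar> + \<epsilon> / 2"
    by (rule crossing_upper_T[OF B S]) (use \<epsilon> in auto)
  ultimately show ?thesis using T by (elim eventually_mono) linarith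
qed

lemma crossing_lower:
  assumes B: "standard_brownian_motion M B" and S: "0 \<le> S" "0 \<le> S'" and \<eta>: "0 < \<eta>" and \<epsilon>: "0 < \<epsilon>"
  shows "\<forall>\<^sub>F u in at_top. gscale c u * measure M (crossing M B c S u \<inter> staying M B c S' \<eta> u) \<ge> limit_constant M B S - \<epsilon>"
proof -
  have "limit_constant M B S - \<epsilon> / 2 < limit_constant M B S" using \<epsilon> by simp
  then obtain T :: nat where T: "limit_constant M B S - \<epsilon> / 2 < truncated_constant M B S (real T)"
    unfolding limit_constant_def less_cSUP_iff[OF UNIV_not_empty truncated_constant_bdd_above[OF B S(1)]] by auto
  have "\<forall>\<^sub>F u in at_top. gscale c u * measure M (crossing M B c S u \<inter> staying M B c S' \<eta> u) \<ge> truncated_constant M B S (real T) - \<epsilon> / 2"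
    by (rule crossing_lower_T[OF B S _ \<eta>]) (use \<epsilon> in auto)
  then show ?thesis using T by (elim eventually_mono) linarith
qed

subsection \<open>Identification of the constant\<close>

text \<open>The process inside the constant of the theorem, written in forward window time:
  \<open>\<tau> = T - 2 t\<close> turns it into \<open>sqrt 2 * B t - 2 * max 0 t\<close>.\<close>

definition drifted_two_sided :: "(real \<Rightarrow> 'b \<Rightarrow> real) \<Rightarrow> real \<Rightarrow> 'b \<Rightarrow> real \<Rightarrow> real" where
  "drifted_two_sided B T \<omega> \<tau> = sqrt 2 * B ((T - \<tau>) / 2) \<omega> - max 0 (T - \<tau>)"

lemma drifted_two_sided_continuous:
  assumes "two_sided_brownian_motion N B" "\<omega> \<in> space N"
  shows "continuous_on A (drifted_two_sided B T \<omega>)"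
  unfolding drifted_two_sided_def
  by (intro continuous_intros continuous_on_compose2[OF two_sided_path(2)[OF assms]]) auto

text \<open>Only the law of the functional matters, so the reversed two-sided motion
  \<open>X\<close> may replace \<open>B1\<close>. After the shift the path is rebased at
  \<open>T\<close>: since \<open>X T\<close> equals \<open>- sqrt 2 * B (T / 2)\<close>, subtracting
  it cancels the base point of the reversal, and \<open>min t T - T\<close> becomes
  \<open>- max 0 (T - t)\<close>.\<close>

lemma drifted_two_sided_integral:
  fixes T :: nat
  assumes M: "standard_brownian_motion M B1" and N: "two_sided_brownian_motion N B" and S: "0 \<le> S"
  shows "(\<integral>\<^sup>+\<omega>. ennreal (exp (window_sup S 0 T (drifted_two_sided B T \<omega>))) \<partial>N) = ennreal (truncated_constant M B1 S T)"
proof -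
  define X where "X = reversed_bm B (real T)"
  have X: "bm_on N X" unfolding X_def by (rule bm_on_reversed[OF N])
  have B1: "bm_on M B1" by (rule bm_on_sbm[OF M])
  have B0: "\<omega> \<in> space N \<Longrightarrow> B 0 \<omega> = 0" for \<omega>
    using N sbmD(3) by (auto simp: two_sided_brownian_motion_def)
  have G: "shift_mono (T + S) (window_sup S 0 T)" using S by (intro shift_mono_window_sup) auto
  have shift: "window_sup S 0 T (\<lambda>t. X t \<omega> + min t T) - X T \<omega> - T = window_sup S 0 T (drifted_two_sided B T \<omega>)"
    if "\<omega> \<in> space N" for \<omega>
  proof -
    have "window_sup S 0 T (\<lambda>t. (X t \<omega> + min t T) + (- X T \<omega> - T)) = window_sup S 0 T (\<lambda>t. X t \<omega> + min t T) + (- X T \<omega> - T)"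
      by (intro shift_mono_add[OF G] path_bounded continuous_add_min bm_onD(4)[OF X that])
    moreover have "(\<lambda>t. (X t \<omega> + min t T) + (- X T \<omega> - T)) = drifted_two_sided B T \<omega>"
      using B0[OF that] by (auto simp: fun_eq_iff X_def reversed_bm_def drifted_two_sided_def right_diff_distrib min_def max_def)
    ultimately show ?thesis by simp
  qed
  have "ennreal (truncated_constant M B1 S T) = (\<integral>\<^sup>+\<omega>. ennreal (exp (window_sup S 0 T (\<lambda>t. B1 t \<omega>) - T / 2)) \<partial>M)"
    unfolding truncated_constant_def using window_sup_integrable(2)[OF M S, of T] by (intro nn_integral_eq_integral[symmetric]) auto
  also have "\<dots> = (\<integral>\<^sup>+\<omega>. ennreal (exp (window_sup S 0 T (\<lambda>t. X t \<omega>) - T / 2)) \<partial>N)"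
    by (rule bm_on_nn_integral_eq[OF B1 X G]) measurable
  also have "\<dots> = (\<integral>\<^sup>+\<omega>. ennreal (exp (window_sup S 0 T (\<lambda>t. X t \<omega> + min t T) - X T \<omega> - T)) \<partial>N)"
    by (rule bm_girsanov[OF X G]) (use S in simp)
  also have "\<dots> = (\<integral>\<^sup>+\<omega>. ennreal (exp (window_sup S 0 T (drifted_two_sided B T \<omega>))) \<partial>N)"
    by (intro nn_integral_cong) (simp only: shift)
  finally show ?thesis by simp
qed

text \<open>Substitute \<open>t = (T - \<tau>) / 2\<close>: a window of length \<open>S\<close> to
  the right of \<open>\<tau>\<close> becomes one of length \<open>S / 2\<close> to the left of
  \<open>t\<close>.\<close>

lemma less_drifted_window_iff:
  assumes N: "two_sided_brownian_motion N B" and \<omega>: "\<omega> \<in> space N" and S: "0 \<le> S" and T: "0 \<le> T"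
  shows "x < window_sup S 0 T (drifted_two_sided B T \<omega>) \<longleftrightarrow>
    (\<exists>t\<in>{0..T / 2}. \<forall>s\<in>{0..S / 2}. x < sqrt 2 * B (t - s) \<omega> - 2 * max 0 (t - s))"
proof -
  have eq: "drifted_two_sided B T \<omega> \<tau> = sqrt 2 * B ((T - \<tau>) / 2) \<omega> - 2 * max 0 ((T - \<tau>) / 2)" for \<tau>
    by (simp add: drifted_two_sided_def max_def)
  show ?thesis
    unfolding less_window_sup_iff[OF order_refl T S drifted_two_sided_continuous[OF N \<omega>]] eq
  proof safe
    fix \<tau> assume \<tau>: "\<tau> \<in> {0..T}" and *: "\<forall>s\<in>{\<tau>..\<tau> + S}. x < sqrt 2 * B ((T - s) / 2) \<omega> - 2 * max 0 ((T - s) / 2)"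
    show "\<exists>t\<in>{0..T / 2}. \<forall>s\<in>{0..S / 2}. x < sqrt 2 * B (t - s) \<omega> - 2 * max 0 (t - s)"
    proof (intro bexI ballI)
      show "(T - \<tau>) / 2 \<in> {0..T / 2}" using \<tau> by auto
      fix s assume s: "s \<in> {0..S / 2}"
      have "(T - (\<tau> + 2 * s)) / 2 = (T - \<tau>) / 2 - s" by simp
      moreover have "\<tau> + 2 * s \<in> {\<tau>..\<tau> + S}" using s by auto
      ultimately show "x < sqrt 2 * B ((T - \<tau>) / 2 - s) \<omega> - 2 * max 0 ((T - \<tau>) / 2 - s)" using * by metis
    qed
  next
    fix t assume t: "t \<in> {0..T / 2}" and *: "\<forall>s\<in>{0..S / 2}. x < sqrt 2 * B (t - s) \<omega> - 2 * max 0 (t - s)"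
    show "\<exists>t\<in>{0..T}. \<forall>s\<in>{t..t + S}. x < sqrt 2 * B ((T - s) / 2) \<omega> - 2 * max 0 ((T - s) / 2)"
    proof (intro bexI ballI)
      show "T - 2 * t \<in> {0..T}" using t by auto
      fix s assume s: "s \<in> {T - 2 * t..T - 2 * t + S}"
      have "t - (s - (T - 2 * t)) / 2 = (T - s) / 2" by (simp only: diff_divide_distrib)
      moreover have "(s - (T - 2 * t)) / 2 \<in> {0..S / 2}" using s by auto
      ultimately show "x < sqrt 2 * B ((T - s) / 2) \<omega> - 2 * max 0 ((T - s) / 2)" using * by metis
    qed
  qed
qed

lemma less_sup_inf_iff:
  assumes N: "two_sided_brownian_motion N B" and \<omega>: "\<omega> \<in> space N" and S: "0 \<le> S"
  shows "ereal x < (SUP t\<in>{0..}. INF s\<in>{0..S / 2}. ereal (sqrt 2 * B (t - s) \<omega> - 2 * \<bar>t - s\<bar> * of_bool (t > s))) \<longleftrightarrow>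
    (\<exists>t\<in>{0..}. \<forall>s\<in>{0..S / 2}. x < sqrt 2 * B (t - s) \<omega> - 2 * max 0 (t - s))"
proof -
  define g where "g t = sqrt 2 * B t \<omega> - 2 * max 0 t" for t
  \<comment> \<open>The absolute value with its indicator is the positive part of
    \<open>t - s\<close>, so everything depends on the difference only, and continuously.\<close>
  have eq: "sqrt 2 * B (t - s) \<omega> - 2 * \<bar>t - s\<bar> * of_bool (t > s) = g (t - s)" for t s
    by (auto simp: g_def max_def abs_if)
  have inf: "ereal x < (INF s\<in>{0..S / 2}. ereal (g (t - s))) \<longleftrightarrow> (\<forall>s\<in>{0..S / 2}. x < g (t - s))" for t
  proof
    assume "ereal x < (INF s\<in>{0..S / 2}. ereal (g (t - s)))"
    then show "\<forall>s\<in>{0..S / 2}. x < g (t - s)"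
      by (auto dest: less_INF_D)
  next
    assume gt: "\<forall>s\<in>{0..S / 2}. x < g (t - s)"
    have "continuous_on {0..S / 2} (\<lambda>s. g (t - s))"
      unfolding g_def by (intro continuous_intros continuous_on_compose2[OF two_sided_path(2)[OF N \<omega>]]) auto
    then obtain r where r: "r \<in> {0..S / 2}" "\<And>s. s \<in> {0..S / 2} \<Longrightarrow> g (t - r) \<le> g (t - s)"
      using continuous_attains_inf[of "{0..S / 2}" "\<lambda>s. g (t - s)"] S by auto
    have "ereal (g (t - r)) \<le> (INF s\<in>{0..S / 2}. ereal (g (t - s)))"
      using r by (intro INF_greatest) auto
    moreover have "ereal x < ereal (g (t - r))" using gt r by simp
    ultimately show "ereal x < (INF s\<in>{0..S / 2}. ereal (g (t - s)))" by (rule less_le_trans[rotated])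
  qed
  show ?thesis
    unfolding eq less_SUP_iff inf by (simp add: g_def)
qed

text \<open>Reals are dense in the extended reals. Strict lower bounds thus settle the equality
  without separating infinite values.\<close>

lemma ereal_eqI_real:
  assumes "\<And>x::real. ereal x < a \<longleftrightarrow> ereal x < b"
  shows "a = b"
proof (rule antisym; rule ccontr)
  assume "\<not> a \<le> b"
  then obtain z where "b < ereal z" "ereal z < a" using ereal_dense2[of b a] by (auto simp: not_le)
  with assms[of z] show False by auto
next
  assume "\<not> b \<le> a"
  then obtain z where "a < ereal z" "ereal z < b" using ereal_dense2[of a b] by (auto simp: not_le)
  with assms[of z] show False by auto
qed

lemma exp_ereal_SUP:
  fixes m :: "nat \<Rightarrow> real"
  assumes "incseq m"
  shows "exp_ereal (SUP T. ereal (m T)) = (SUP T. ennreal (exp (m T)))"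
proof -
  have inc: "incseq (\<lambda>T. ereal (m T))" using assms by (auto simp: incseq_def)
  have lim: "(\<lambda>T. ereal (m T)) \<longlonglongrightarrow> (SUP T. ereal (m T))" by (rule LIMSEQ_SUP[OF inc])
  have ne: "(SUP T. ereal (m T)) \<noteq> - \<infinity>"
    by (metis MInfty_neq_ereal(1) SUP_upper UNIV_I ereal_infty_less_eq(2))
  show ?thesis
  proof (cases "(SUP T. ereal (m T)) = \<infinity>")
    case True
    have "(SUP T. ennreal (exp (m T))) = top"
    proof (rule ennreal_SUP_eq_top)
      fix n :: nat
      have "ereal (real n) < (SUP T. ereal (m T))" using True by simp
      then obtain T where "real n < m T" by (auto simp: less_SUP_iff)
      moreover have "m T \<le> exp (m T)" using exp_ge_add_one_self[of "m T"] by linarith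
      ultimately have "of_nat n \<le> ennreal (exp (m T))"
        by (subst ennreal_of_nat_eq_real_of_nat) (intro ennreal_leI, simp)
      then show "\<exists>T\<in>UNIV. of_nat n \<le> ennreal (exp (m T))" by blast
    qed
    moreover have "exp_ereal \<infinity> = top" by (simp add: exp_ereal_def)
    ultimately show ?thesis using True by (simp only:)
  next
    case False
    with ne obtain l where l: "(SUP T. ereal (m T)) = ereal l" by (cases "SUP T. ereal (m T)") auto
    have "m \<longlonglongrightarrow> l" using lim unfolding l by simp
    then have "(\<lambda>T. ennreal (exp (m T))) \<longlonglongrightarrow> ennreal (exp l)" by (intro tendsto_intros)
    moreover have "(\<lambda>T. ennreal (exp (m T))) \<longlonglongrightarrow> (SUP T. ennreal (exp (m T)))"
      using assms by (intro LIMSEQ_SUP) (auto simp: incseq_def intro!: ennreal_leI)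
    ultimately have "(SUP T. ennreal (exp (m T))) = ennreal (exp l)" by (rule LIMSEQ_unique[rotated])
    then show ?thesis by (simp add: l exp_ereal_def)
  qed
qed

text \<open>Restricting to \<open>t \<le> T / 2\<close> gives functionals \<open>m T\<close> that
  increase with \<open>T\<close> to the full supremum. Monotone convergence moves the supremum
  outside the integral, and the bound by 2 allows the return from \<open>ennreal\<close> to real
  numbers.\<close>

lemma parisian_constant_eq:
  assumes M: "standard_brownian_motion M B1" and N: "two_sided_brownian_motion N B" and S: "0 \<le> S"
  shows "parisian_constant N B S = ennreal (limit_constant M B1 S)"
proof -
  define m where "m T \<omega> = window_sup S 0 (real T) (drifted_two_sided B (real T) \<omega>)" for T :: nat and \<omega>
  have m_meas [measurable]: "m T \<in> borel_measurable N" for T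
  proof -
    have "(\<lambda>\<omega>. window_sup S 0 (real T) (\<lambda>\<tau>. (\<lambda>\<tau> \<omega>. drifted_two_sided B (real T) \<omega> \<tau>) \<tau> \<omega>)) \<in> borel_measurable N"
    proof (rule borel_measurable_shift_mono[OF shift_mono_window_sup])
      show "(\<lambda>\<omega>. drifted_two_sided B (real T) \<omega> t) \<in> borel_measurable N" for t
        unfolding drifted_two_sided_def
        by (intro borel_measurable_diff borel_measurable_times borel_measurable_const two_sided_path(1)[OF N])
      show "continuous_on {0..} (drifted_two_sided B (real T) \<omega>)" if "\<omega> \<in> space N" for \<omega>
        by (rule drifted_two_sided_continuous[OF N that])
    qed (use S in auto)
    then show ?thesis by (simp add: m_def[abs_def])
  qed
  have m_less: "x < m T \<omega> \<longleftrightarrow> (\<exists>t\<in>{0..real T / 2}. \<forall>s\<in>{0..S / 2}. x < sqrt 2 * B (t - s) \<omega> - 2 * max 0 (t - s))"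
    if "\<omega> \<in> space N" for x T \<omega>
    unfolding m_def by (rule less_drifted_window_iff[OF N that S]) simp
  have inc: "incseq (\<lambda>T. m T \<omega>)" if \<omega>: "\<omega> \<in> space N" for \<omega>
  proof (rule incseq_SucI, rule dense_le)
    fix T x assume "x < m T \<omega>"
    then have "x < m (Suc T) \<omega>" unfolding m_less[OF \<omega>]
      by (elim bexE) (rule bexI, assumption, auto)
    then show "x \<le> m (Suc T) \<omega>" by simp
  qed
  have SUP: "(SUP t\<in>{0..}. INF s\<in>{0..S / 2}. ereal (sqrt 2 * B (t - s) \<omega> - 2 * \<bar>t - s\<bar> * of_bool (t > s))) =
      (SUP T. ereal (m T \<omega>))" if \<omega>: "\<omega> \<in> space N" for \<omega>
  proof (rule ereal_eqI_real)
    fix x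
    let ?P = "\<lambda>t. \<forall>s\<in>{0..S / 2}. x < sqrt 2 * B (t - s) \<omega> - 2 * max 0 (t - s)"
    have "ereal x < (SUP T. ereal (m T \<omega>)) \<longleftrightarrow> (\<exists>T::nat. \<exists>t\<in>{0..real T / 2}. ?P t)"
      by (simp add: less_SUP_iff m_less[OF \<omega>])
    also have "\<dots> \<longleftrightarrow> (\<exists>t\<in>{0..}. ?P t)"
    proof safe
      fix t assume t: "0 \<le> t" "?P t"
      obtain T :: nat where "2 * t \<le> real T" using real_arch_simple by blast
      with t show "\<exists>T::nat. \<exists>t\<in>{0..real T / 2}. ?P t" by (intro exI[of _ T] bexI[of _ t]) auto
    qed auto
    finally show "ereal x < (SUP t\<in>{0..}. INF s\<in>{0..S / 2}. ereal (sqrt 2 * B (t - s) \<omega> - 2 * \<bar>t - s\<bar> * of_bool (t > s)))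
      \<longleftrightarrow> ereal x < (SUP T. ereal (m T \<omega>))"
      using less_sup_inf_iff[OF N \<omega> S] by simp
  qed
  have "parisian_constant N B S = (\<integral>\<^sup>+\<omega>. (SUP T. ennreal (exp (m T \<omega>))) \<partial>N)"
    unfolding parisian_constant_def by (intro nn_integral_cong) (simp only: SUP exp_ereal_SUP[OF inc])
  also have "\<dots> = (SUP T. \<integral>\<^sup>+\<omega>. ennreal (exp (m T \<omega>)) \<partial>N)"
    by (rule nn_integral_monotone_convergence_SUP_AE) (use inc in \<open>auto intro!: AE_I2 ennreal_leI simp: incseq_Suc_iff\<close>)
  also have "\<dots> = (SUP T. ennreal (truncated_constant M B1 S (real T)))"
    unfolding m_def by (simp only: drifted_two_sided_integral[OF M N S])
  also have "\<dots> = ennreal (limit_constant M B1 S)"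
    unfolding limit_constant_def
  proof (rule ennreal_SUP[symmetric])
    have "(SUP T. ennreal (truncated_constant M B1 S (real T))) \<le> ennreal 2"
      by (intro SUP_least ennreal_leI truncated_constant_le_2[OF M _ S]) auto
    then show "(SUP T. ennreal (truncated_constant M B1 S (real T))) \<noteq> top"
      using ennreal_less_top[of 2] by (metis leD)
  qed (auto simp: truncated_constant_def intro!: integral_nonneg_AE)
  finally show ?thesis .
qed

text \<open>Already the term \<open>T = 0\<close> is the expectation of a strictly positive
  variable.\<close>

lemma limit_constant_pos:
  assumes B: "standard_brownian_motion M B" and S: "0 \<le> S"
  shows "0 < limit_constant M B S"
proof -
  interpret prob_space M by (rule sbmD(1)[OF B])
  have "truncated_constant M B S (real 0) > 0"
    unfolding truncated_constant_def
  proof -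
    have i: "integrable M (\<lambda>\<omega>. exp (window_sup S 0 (real 0) (\<lambda>t. B t \<omega>) - real 0 / 2))"
      by (rule window_sup_integrable(2)[OF B S]) simp
    have "(\<integral>\<omega>. exp (window_sup S 0 (real 0) (\<lambda>t. B t \<omega>) - real 0 / 2) \<partial>M) \<noteq> 0"
      by (subst integral_nonneg_eq_0_iff_AE[OF i]) (auto simp: AE_False)
    moreover have "0 \<le> (\<integral>\<omega>. exp (window_sup S 0 (real 0) (\<lambda>t. B t \<omega>) - real 0 / 2) \<partial>M)"
      by (rule integral_nonneg_AE) auto
    ultimately show "0 < (\<integral>\<omega>. exp (window_sup S 0 (real 0) (\<lambda>t. B t \<omega>) - real 0 / 2) \<partial>M)" by linarith
  qed
  also have "truncated_constant M B S (real 0) \<le> limit_constant M B S"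
    unfolding limit_constant_def by (intro cSUP_upper truncated_constant_bdd_above[OF B S]) auto
  finally show ?thesis .
qed

subsection \<open>The two-dimensional problem\<close>

text \<open>The sigma-algebra generated by the whole path. Independence of the processes gives the
  product rule for events from the two path algebras.\<close>

definition path_algebra :: "'a measure \<Rightarrow> (real \<Rightarrow> 'a \<Rightarrow> real) \<Rightarrow> 'a measure" where
  "path_algebra M B = vimage_algebra (space M) (\<lambda>\<omega>. \<lambda>t\<in>{0..}. B t \<omega>) (\<Pi>\<^sub>M t\<in>{0..}. borel)"

lemma space_path_algebra [simp]: "space (path_algebra M B) = space M"
  by (simp add: path_algebra_def)

lemma path_algebra_at:
  assumes "0 \<le> t"
  shows "B t \<in> borel_measurable (path_algebra M B)"
proof -
  have "(\<lambda>\<omega>. \<lambda>t\<in>{0..}. B t \<omega>) \<in> measurable (path_algebra M B) (\<Pi>\<^sub>M t\<in>{0..}. borel)"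
    unfolding path_algebra_def by (rule measurable_vimage_algebra1) (auto simp: space_PiM)
  from measurable_compose[OF this measurable_component_singleton[of t]]
  show ?thesis using assms by simp
qed

lemma path_algebra_indep:
  assumes M: "prob_space M" and ind: "indep_processes M X Y"
    and "A \<in> sets (path_algebra M X)" "C \<in> sets (path_algebra M Y)"
  shows "measure M (A \<inter> C) = measure M A * measure M C"
proof -
  interpret prob_space M by fact
  let ?P = "(\<Pi>\<^sub>M t\<in>{0..}. borel) :: (real \<Rightarrow> real) measure"
  have sets: "sets (path_algebra M X) = {(\<lambda>\<omega>. \<lambda>t\<in>{0..}. X t \<omega>) -` U \<inter> space M |U. U \<in> sets ?P}" for X
    unfolding path_algebra_def by (rule sets_vimage_algebra2) (auto simp: space_PiM)
  from assms(3,4) obtain U V where U: "U \<in> sets ?P" and V: "V \<in> sets ?P"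
    and A: "A = (\<lambda>\<omega>. \<lambda>t\<in>{0..}. X t \<omega>) -` U \<inter> space M" and C: "C = (\<lambda>\<omega>. \<lambda>t\<in>{0..}. Y t \<omega>) -` V \<inter> space M"
    unfolding sets by blast
  have eq: "(\<lambda>\<omega>. (f \<omega>, g \<omega>)) -` (U \<times> V) \<inter> space M = (f -` U \<inter> space M) \<inter> (g -` V \<inter> space M)"
    for f g :: "'a \<Rightarrow> real \<Rightarrow> real" by auto
  show ?thesis
    using indep_varD[OF ind[unfolded indep_processes_def] U V, unfolded eq] unfolding A C .
qed

section \<open>Negligible behaviour of the first component\<close>

lemma gtail_shift_null:
  assumes "0 < \<eta>"
  shows "((\<lambda>u. gscale c u * gtail (u + c + \<eta>)) \<longlongrightarrow> 0) at_top"
proof (rule gscale_gtail_null[where k = "1/2"])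
  show "\<forall>\<^sub>F u in at_top. u + c + \<eta> \<ge> 1 / 2 * u"
    using eventually_ge_at_top[of "- 2 * (c + \<eta>)"] by eventually_elim simp
  show "filterlim (\<lambda>u. (u + c)\<^sup>2 / 2 - (u + c + \<eta>)\<^sup>2 / 2) at_bot at_top"
    using assms by real_asymp
qed simp

lemma sup_prob_le:
  assumes B: "standard_brownian_motion M B" and h: "0 < h"
  shows "measure M {\<omega>\<in>space M. \<exists>s\<in>{0..h}. B s \<omega> - c * s > x} \<le> gtail ((x + c * h) / sqrt h) / gtail (\<bar>c\<bar> * sqrt h)"
  using sbm_sup_tail[OF B h, of c x] gtail_pos[of "\<bar>c\<bar> * sqrt h"] by (simp add: field_simps)

text \<open>Raising the level by a fixed \<open>\<eta>\<close> costs a factor of order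
  \<open>exp (- \<eta> * u)\<close>, whereas genuine overshoots are of order
  \<open>1 / u\<close>.\<close>

lemma sup_exceeds_null:
  assumes B: "standard_brownian_motion M B" and "0 < \<eta>"
  shows "((\<lambda>u. gscale c u * measure M {\<omega>\<in>space M. \<exists>s\<in>{0..1}. B s \<omega> - c * s > u + \<eta>}) \<longlongrightarrow> 0) at_top"
proof (rule tendsto_sandwich[where f = "\<lambda>_. 0"])
  have "((\<lambda>u. gscale c u * gtail (u + c + \<eta>) / gtail \<bar>c\<bar>) \<longlongrightarrow> 0 / gtail \<bar>c\<bar>) at_top"
    by (intro tendsto_divide gtail_shift_null assms tendsto_const) (use gtail_pos[of "\<bar>c\<bar>"] in simp)
  then show "((\<lambda>u. gscale c u * gtail (u + c + \<eta>) / gtail \<bar>c\<bar>) \<longlongrightarrow> 0) at_top" by simp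
  show "\<forall>\<^sub>F u in at_top. gscale c u * measure M {\<omega>\<in>space M. \<exists>s\<in>{0..1}. B s \<omega> - c * s > u + \<eta>} \<le>
      gscale c u * gtail (u + c + \<eta>) / gtail \<bar>c\<bar>"
    using eventually_ge_at_top[of 0]
  proof eventually_elim
    case (elim u)
    have "measure M {\<omega>\<in>space M. \<exists>s\<in>{0..1}. B s \<omega> - c * s > u + \<eta>} \<le> gtail (u + c + \<eta>) / gtail \<bar>c\<bar>"
      using sup_prob_le[OF B zero_less_one, where c = c and x = "u + \<eta>"] by (simp add: add_ac)
    then have "gscale c u * measure M {\<omega>\<in>space M. \<exists>s\<in>{0..1}. B s \<omega> - c * s > u + \<eta>} \<le>
        gscale c u * (gtail (u + c + \<eta>) / gtail \<bar>c\<bar>)"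
      using elim by (intro mult_left_mono gscale_nonneg)
    then show ?case by simp
  qed
  show "\<forall>\<^sub>F u in at_top. 0 \<le> gscale c u * measure M {\<omega>\<in>space M. \<exists>s\<in>{0..1}. B s \<omega> - c * s > u + \<eta>}"
    using eventually_ge_at_top[of 0] by eventually_elim (simp add: gscale_nonneg)
qed simp

text \<open>Up to time \<open>h < 1\<close> the standard deviation is at most
  \<open>sqrt h < 1\<close>. Lowering the level by a constant cannot make up for this.\<close>

lemma early_exceeds_null:
  assumes B: "standard_brownian_motion M B" and h: "0 < h" "h < 1"
  shows "((\<lambda>u. gscale c u * measure M {\<omega>\<in>space M. \<exists>s\<in>{0..h}. B s \<omega> - c * s > u - K}) \<longlongrightarrow> 0) at_top"
proof (rule tendsto_sandwich[where f = "\<lambda>_. 0"])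
  define g where "g = gtail (\<bar>c\<bar> * sqrt h)"
  have g: "0 < g" unfolding g_def by (rule gtail_pos)
  have "((\<lambda>u. gscale c u * gtail (u + c + 1) / g) \<longlongrightarrow> 0 / g) at_top"
    by (intro tendsto_divide gtail_shift_null tendsto_const) (use g in simp_all)
  then show "((\<lambda>u. gscale c u * gtail (u + c + 1) / g) \<longlongrightarrow> 0) at_top" by simp
  define v where "v = sqrt h"
  have v: "0 < v" "v < 1" using h by (auto simp: v_def)
  show "\<forall>\<^sub>F u in at_top. gscale c u * measure M {\<omega>\<in>space M. \<exists>s\<in>{0..h}. B s \<omega> - c * s > u - K} \<le>
      gscale c u * gtail (u + c + 1) / g"
    \<comment> \<open>The threshold solves \<open>(u + c + 1) * v \<le> u - K + c * h\<close> for
      \<open>u\<close>; beyond it the comparison with an overshoot of size 1 applies.\<close>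
    using eventually_ge_at_top[of 0] eventually_ge_at_top[of "((c + 1) * v + K - c * h) / (1 - v)"]
  proof eventually_elim
    case (elim u)
    have "(c + 1) * v + K - c * h \<le> u * (1 - v)" using elim(2) v by (simp add: pos_divide_le_eq)
    then have "(u + c + 1) * v \<le> u - K + c * h" by (simp add: algebra_simps)
    then have "u + c + 1 \<le> (u - K + c * h) / v" using v by (simp add: pos_le_divide_eq)
    then have "gtail ((u - K + c * h) / v) \<le> gtail (u + c + 1)" by (rule gtail_antimono)
    then have "gtail ((u - K + c * h) / v) / g \<le> gtail (u + c + 1) / g" using g by (intro divide_right_mono) auto
    then have "measure M {\<omega>\<in>space M. \<exists>s\<in>{0..h}. B s \<omega> - c * s > u - K} \<le> gtail (u + c + 1) / g"
      using sup_prob_le[OF B h(1), where c = c and x = "u - K"] unfolding g_def v_def by linarith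
    then have "gscale c u * measure M {\<omega>\<in>space M. \<exists>s\<in>{0..h}. B s \<omega> - c * s > u - K} \<le>
        gscale c u * (gtail (u + c + 1) / g)"
      using elim by (intro mult_left_mono gscale_nonneg)
    then show ?case by simp
  qed
  show "\<forall>\<^sub>F u in at_top. 0 \<le> gscale c u * measure M {\<omega>\<in>space M. \<exists>s\<in>{0..h}. B s \<omega> - c * s > u - K}"
    using eventually_ge_at_top[of 0] by eventually_elim (simp add: gscale_nonneg)
qed simp

lemma crossing_tendsto:
  assumes B: "standard_brownian_motion M B" and S: "0 \<le> S"
  shows "((\<lambda>u. gscale c u * measure M (crossing M B c S u)) \<longlongrightarrow> limit_constant M B S) at_top"
proof (rule tendstoI)
  fix \<epsilon> :: real assume \<epsilon>: "0 < \<epsilon>"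
  interpret prob_space M by (rule sbmD(1)[OF B])
  have e2: "0 < \<epsilon> / 2" using \<epsilon> by simp
  show "\<forall>\<^sub>F u in at_top. dist (gscale c u * prob (crossing M B c S u)) (limit_constant M B S) < \<epsilon>"
    using crossing_upper[OF B S e2, of c] crossing_lower[OF B S order_refl zero_less_one e2, of c] eventually_ge_at_top[of 0]
  proof eventually_elim
    case (elim u)
    have "prob (crossing M B c S u \<inter> staying M B c 0 1 u) \<le> prob (crossing M B c S u)"
      by (intro finite_measure_mono crossing_measurable[OF B S]) auto
    then have "gscale c u * prob (crossing M B c S u \<inter> staying M B c 0 1 u) \<le> gscale c u * prob (crossing M B c S u)"
      using elim by (intro mult_left_mono gscale_nonneg) auto
    then show ?case using elim \<epsilon> by (simp add: dist_real_def abs_less_iff)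
  qed
qed

definition joint_crossing ::
  "'a measure \<Rightarrow> (real \<Rightarrow> 'a \<Rightarrow> real) \<Rightarrow> (real \<Rightarrow> 'a \<Rightarrow> real) \<Rightarrow> real \<Rightarrow> real \<Rightarrow> real \<Rightarrow> real \<Rightarrow> real \<Rightarrow> real \<Rightarrow> real \<Rightarrow> 'a set" where
  "joint_crossing M B1 B2 \<rho> a c1 c2 S1 S2 u = crossing M B1 c1 S1 u \<inter>
    {\<omega>\<in>space M. \<exists>t'\<in>{0..1}. \<forall>t\<in>{t'..t' + S2 / u\<^sup>2}. with_drift c2 (correlated_bm \<rho> B1 B2) t \<omega> > a * u}"

section \<open>Factorisation of the joint crossing probability\<close>

locale correlated_pair =
  fixes M :: "'a measure" and B1 B2 :: "real \<Rightarrow> 'a \<Rightarrow> real" and \<rho> a c1 c2 :: real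
  assumes B1: "standard_brownian_motion M B1" and B2: "standard_brownian_motion M B2"
    and ind: "indep_processes M B1 B2" and \<rho>: "\<rho> < 1" and a: "0 < a" "a \<le> \<rho>"
begin

sublocale prob_space M by (rule sbmD(1)[OF B1])

definition "r = sqrt (1 - \<rho>\<^sup>2)"
definition "d = \<rho> * c1 - c2"
definition "Y t \<omega> = r * B2 t \<omega> + d * t"
definition "p = (if a < \<rho> then 1 else gtail (- d / r))"

lemma rho_pos: "0 < \<rho>" using a by simp

lemma r_pos: "0 < r"
proof -
  have "\<rho>\<^sup>2 < 1" using \<rho> rho_pos by (simp add: power_less_one_iff abs_square_less_1)
  then show ?thesis by (simp add: r_def)
qed

lemma p_bounds: "0 < p" "p \<le> 1"
  using gtail_pos[of "- d / r"] by (auto simp: p_def)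

lemma second_crossing_iff:
  "with_drift c2 (correlated_bm \<rho> B1 B2) t \<omega> > a * u \<longleftrightarrow> \<rho> * (B1 t \<omega> - c1 * t - u) + (\<rho> - a) * u + Y t \<omega> > 0"
  by (simp add: with_drift_def correlated_bm_def Y_def r_def d_def algebra_simps)

lemma Y_continuous: "\<omega> \<in> space M \<Longrightarrow> continuous_on {0..} (\<lambda>t. Y t \<omega>)"
  unfolding Y_def using sbmD(4)[OF B2] by (intro continuous_intros) auto

lemma Y_path: "0 \<le> t \<Longrightarrow> Y t \<in> borel_measurable (path_algebra M B2)"
  unfolding Y_def using path_algebra_at[of t B2 M] by measurable

lemma path_algebra_B2_sets: "A \<in> sets (path_algebra M B2) \<Longrightarrow> A \<in> events"
proof -
  assume "A \<in> sets (path_algebra M B2)"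
  then obtain U where "U \<in> sets ((\<Pi>\<^sub>M t\<in>{0..}. borel) :: (real \<Rightarrow> real) measure)"
    "A = (\<lambda>\<omega>. \<lambda>t\<in>{0..}. B2 t \<omega>) -` U \<inter> space M"
    unfolding path_algebra_def by (subst (asm) sets_vimage_algebra2) (auto simp: space_PiM)
  then show "A \<in> events"
    using measurable_restrict[of "{0..}" B2 M "\<lambda>_. borel"] sbmD(2)[OF B2] by (auto intro: measurable_sets)
qed

lemma Y_meas: "0 \<le> t \<Longrightarrow> Y t \<in> borel_measurable M"
  unfolding Y_def using sbmD(2)[OF B2, of t] by measurable

lemma Y_1_gt: "prob {\<omega>\<in>space M. Y 1 \<omega> > 0} = gtail (- d / r)"
  and Y_1_lt: "prob {\<omega>\<in>space M. Y 1 \<omega> < 0} = 1 - gtail (- d / r)"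
proof -
  have N: "distributed M lborel (\<lambda>\<omega>. B2 1 \<omega> - B2 0 \<omega>) (normal_density 0 (sqrt (1 - 0)))"
    by (rule sbmD(5)[OF B2]) auto
  have 1: "Y 1 \<omega> > 0 \<longleftrightarrow> B2 1 \<omega> - B2 0 \<omega> > - d / r" "Y 1 \<omega> \<ge> 0 \<longleftrightarrow> B2 1 \<omega> - B2 0 \<omega> \<ge> - d / r" if "\<omega> \<in> space M" for \<omega>
    using r_pos sbmD(3)[OF B2 that] by (auto simp: Y_def field_simps)
  have "prob {\<omega>\<in>space M. Y 1 \<omega> > 0} = prob {\<omega>\<in>space M. B2 1 \<omega> - B2 0 \<omega> > - d / r}"
    using 1(1) by (intro arg_cong[where f = prob]) auto
  then show "prob {\<omega>\<in>space M. Y 1 \<omega> > 0} = gtail (- d / r)"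
    using distributed_normal_tail(1)[OF N _ prob_space_axioms] by simp
  have ge: "prob {\<omega>\<in>space M. Y 1 \<omega> \<ge> 0} = prob {\<omega>\<in>space M. B2 1 \<omega> - B2 0 \<omega> \<ge> - d / r}"
    using 1(2) by (intro arg_cong[where f = prob]) auto
  have [measurable]: "Y 1 \<in> borel_measurable M" by (rule Y_meas) simp
  have "{\<omega>\<in>space M. Y 1 \<omega> < 0} = space M - {\<omega>\<in>space M. Y 1 \<omega> \<ge> 0}" by auto
  also have "prob \<dots> = 1 - prob {\<omega>\<in>space M. Y 1 \<omega> \<ge> 0}" by (rule prob_compl) measurable
  finally show "prob {\<omega>\<in>space M. Y 1 \<omega> < 0} = 1 - gtail (- d / r)"
    using ge distributed_normal_tail(2)[OF N _ prob_space_axioms] by simp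
qed

lemma crossing_path: "0 \<le> S \<Longrightarrow> crossing M B1 c1 S u \<in> sets (path_algebra M B1)"
  unfolding crossing_def
  using exceed_event_measurable[of "\<lambda>t \<omega>. B1 t \<omega> - c1 * t" "path_algebra M B1" 0 1 "S / u\<^sup>2" u]
    path_algebra_at[of _ B1 M] sbm_drift(2)[OF B1] by auto

lemma staying_path: "0 \<le> S \<Longrightarrow> staying M B1 c1 S \<eta> u \<in> sets (path_algebra M B1)"
  unfolding staying_def
  using exceed_event_measurable[of "\<lambda>t \<omega>. B1 t \<omega> - c1 * t" "path_algebra M B1" 1 1 "S / u\<^sup>2" "u - \<eta>"]
    path_algebra_at[of _ B1 M] sbm_drift(2)[OF B1] by auto

lemma joint_crossing_measurable:
  assumes "0 \<le> S1" "0 \<le> S2"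
  shows "joint_crossing M B1 B2 \<rho> a c1 c2 S1 S2 u \<in> events"
  unfolding joint_crossing_def
proof (intro sets.Int crossing_measurable[OF B1 assms(1)] exceed_event_measurable)
  show "with_drift c2 (correlated_bm \<rho> B1 B2) t \<in> borel_measurable M" if "0 \<le> t" for t
    unfolding with_drift_def correlated_bm_def using sbmD(2)[OF B1 that] sbmD(2)[OF B2 that] by measurable
  show "continuous_on {0..} (\<lambda>t. with_drift c2 (correlated_bm \<rho> B1 B2) t \<omega>)" if "\<omega> \<in> space M" for \<omega>
    unfolding with_drift_def correlated_bm_def
    by (intro continuous_intros sbmD(4)[OF B1 that] sbmD(4)[OF B2 that])
qed (use assms in auto)

text \<open>The second window is placed at time 1. There \<open>staying\<close> with
  \<open>\<eta> = 1 / n\<close> loses at most \<open>\<rho> / n\<close>, and for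
  \<open>u \<ge> n\<close> the event \<open>F n\<close> compensates this loss. \<open>F n\<close>
  concerns \<open>B2\<close> only, so the probabilities multiply, and its probability comes as close
  to \<open>p\<close> as desired.\<close>

lemma joint_lower:
  assumes S: "0 \<le> S1" "0 \<le> S2" and \<epsilon>: "0 < \<epsilon>"
  shows "\<forall>\<^sub>F u in at_top. p * limit_constant M B1 S1 - \<epsilon> < gscale c1 u * prob (joint_crossing M B1 B2 \<rho> a c1 c2 S1 S2 u)"
proof -
  define F where "F n = {\<omega>\<in>space M. \<exists>t'\<in>{1..1}. \<forall>t\<in>{t'..t' + S2 / (real n)\<^sup>2}. \<rho> / real n - (\<rho> - a) * real n < Y t \<omega>}" for n
  have F_path: "F n \<in> sets (path_algebra M B2)" for n
    unfolding F_def using exceed_event_measurable[of Y "path_algebra M B2" 1 1 "S2 / (real n)\<^sup>2"] Y_path Y_continuous S by auto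
  have F: "F n \<in> events" for n by (rule path_algebra_B2_sets[OF F_path])
  \<comment> \<open>On \<open>E\<close> the events \<open>F n\<close> hold eventually. For
    \<open>a < \<rho>\<close> their level tends to minus infinity; for \<open>a = \<rho>\<close> it
    tends to 0 while the window shrinks to the point 1, where \<open>Y\<close> is positive.\<close>
  define E where "E = (if a < \<rho> then space M else {\<omega>\<in>space M. Y 1 \<omega> > 0})"
  have pE: "prob E = p" by (simp add: E_def p_def Y_1_gt prob_space)
  have ev: "eventually (\<lambda>n. \<omega> \<in> F n) sequentially" if "\<omega> \<in> E" for \<omega>
  proof -
    have \<omega>: "\<omega> \<in> space M" using that by (auto simp: E_def split: if_splits)
    obtain r1 where r1: "r1 \<in> {1..1 + S2}" "\<And>t. t \<in> {1..1 + S2} \<Longrightarrow> Y r1 \<omega> \<le> Y t \<omega>"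
      using continuous_attains_inf[of "{1..1 + S2}" "\<lambda>t. Y t \<omega>"] continuous_on_subset[OF Y_continuous[OF \<omega>], of "{1..1 + S2}"] S by auto
    show ?thesis
    proof (cases "a < \<rho>")
      case True
      have "filterlim (\<lambda>n. \<rho> / real n - (\<rho> - a) * real n) at_bot sequentially"
        using True by real_asymp
      then have "\<forall>\<^sub>F n in sequentially. \<rho> / real n - (\<rho> - a) * real n < Y r1 \<omega>"
        by (simp add: filterlim_at_bot_dense)
      then show ?thesis
        using eventually_ge_at_top[of 1]
      proof eventually_elim
        case (elim n)
        have "S2 / (real n)\<^sup>2 \<le> S2" using elim S by (simp add: divide_le_eq mult_le_cancel_left1)
        then have "\<forall>t\<in>{1..1 + S2 / (real n)\<^sup>2}. \<rho> / real n - (\<rho> - a) * real n < Y t \<omega>"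
          using r1(2) elim by (force intro: less_le_trans)
        then show ?case using \<omega> by (simp add: F_def)
      qed
    next
      case False
      then have \<rho>a: "\<rho> = a" using a by simp
      have pos: "Y 1 \<omega> > 0" using that False by (simp add: E_def)
      have "isCont (\<lambda>t. Y t \<omega>) 1"
        using Y_continuous[OF \<omega>] continuous_on_interior[of "{0..}" "\<lambda>t. Y t \<omega>" 1] by simp
      then have "\<exists>\<delta>>0. \<forall>t. dist t 1 < \<delta> \<longrightarrow> dist (Y t \<omega>) (Y 1 \<omega>) < Y 1 \<omega> / 2"
        using pos unfolding continuous_at_eps_delta by (metis half_gt_zero)
      then obtain \<delta> where \<delta>: "0 < \<delta>" "\<And>t. dist t 1 < \<delta> \<Longrightarrow> dist (Y t \<omega>) (Y 1 \<omega>) < Y 1 \<omega> / 2" by blast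
      have lim: "(\<lambda>n. S2 / (real n)\<^sup>2) \<longlonglongrightarrow> 0" "(\<lambda>n. \<rho> / real n) \<longlonglongrightarrow> 0" by real_asymp+
      have "0 < Y 1 \<omega> / 2" using pos by simp
      from order_tendstoD(2)[OF lim(1) \<delta>(1)] order_tendstoD(2)[OF lim(2) this]
      show ?thesis
      proof eventually_elim
        case (elim n)
        have "\<rho> / real n - (\<rho> - a) * real n < Y t \<omega>" if "t \<in> {1..1 + S2 / (real n)\<^sup>2}" for t
        proof -
          have "dist t 1 < \<delta>" using that elim(1) by (auto simp: dist_real_def)
          then have "\<bar>Y t \<omega> - Y 1 \<omega>\<bar> < Y 1 \<omega> / 2" using \<delta>(2) by (simp only: dist_real_def)
          moreover have "(\<rho> - a) * real n = 0" using \<rho>a by simp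
          ultimately show ?thesis using elim(2) by linarith
        qed
        then show ?case using \<omega> by (simp add: F_def)
      qed
    qed
  qed
  \<comment> \<open>Three quarters of the budget are spent: the factor \<open>p - e\<close> costs at
    most \<open>2 * e\<close> because the constant is at most 2, and the crossing estimate costs at
    most \<open>e\<close>.\<close>
  define e where "e = min 1 (\<epsilon> / 4)"
  have e: "0 < e" "4 * e \<le> \<epsilon>" using \<epsilon> by (auto simp: e_def)
  have "\<exists>n. p - e < prob (F (Suc n))"
  proof (rule ccontr)
    assume "\<nexists>n. p - e < prob (F (Suc n))"
    then have le: "prob (F (Suc n)) \<le> p - e" for n by (simp add: not_less)
    have "prob E \<le> p - e" by (rule prob_eventually_le) (fact F, erule ev, rule le)
    then show False using pE e by simp
  qed
  then obtain n where n: "p - e < prob (F (Suc n))" ..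
  define m where "m = real (Suc n)"
  have m: "1 \<le> m" by (simp add: m_def)
  have \<eta>: "0 < 1 / m" using m by simp
  have K: "0 \<le> limit_constant M B1 S1" "limit_constant M B1 S1 \<le> 2"
    using limit_constant_pos[OF B1 S(1)] by (auto simp: limit_constant_def intro!: cSUP_least truncated_constant_le_2[OF B1 _ S(1)])
  show ?thesis
    using crossing_lower[OF B1 S \<eta> e(1), of c1] eventually_ge_at_top[of m]
  proof eventually_elim
    case (elim u)
    define A where "A = crossing M B1 c1 S1 u \<inter> staying M B1 c1 S2 (1 / m) u"
    have u: "1 \<le> u" "m \<le> u" using elim m by auto
    have "A \<inter> F (Suc n) \<subseteq> joint_crossing M B1 B2 \<rho> a c1 c2 S1 S2 u"
    proof
      fix \<omega> assume \<omega>: "\<omega> \<in> A \<inter> F (Suc n)"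
      have "with_drift c2 (correlated_bm \<rho> B1 B2) t \<omega> > a * u" if t: "t \<in> {1..1 + S2 / u\<^sup>2}" for t
      proof -
        have "u - 1 / m < B1 t \<omega> - c1 * t" using \<omega> t by (auto simp: A_def staying_def)
        then have 1: "B1 t \<omega> - c1 * t - u > - (1 / m)" by linarith
        have "m\<^sup>2 \<le> u\<^sup>2" using u m by (intro power_mono) auto
        then have "S2 / u\<^sup>2 \<le> S2 / m\<^sup>2" using S u m by (intro divide_left_mono) auto
        then have "t \<in> {1..1 + S2 / m\<^sup>2}" using t by auto
        then have 2: "\<rho> / m - (\<rho> - a) * m < Y t \<omega>" using \<omega> unfolding m_def F_def by auto
        have 3: "(\<rho> - a) * m \<le> (\<rho> - a) * u" using u a by (intro mult_left_mono) auto
        have "\<rho> * (- (1 / m)) < \<rho> * (B1 t \<omega> - c1 * t - u)" using 1 rho_pos by (intro mult_strict_left_mono)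
        with 2 3 show ?thesis unfolding second_crossing_iff by simp
      qed
      then show "\<omega> \<in> joint_crossing M B1 B2 \<rho> a c1 c2 S1 S2 u"
        using \<omega> by (auto simp: joint_crossing_def A_def crossing_def intro!: bexI[of _ 1])
    qed
    then have "prob (A \<inter> F (Suc n)) \<le> prob (joint_crossing M B1 B2 \<rho> a c1 c2 S1 S2 u)"
      by (intro finite_measure_mono joint_crossing_measurable S)
    moreover have "prob (A \<inter> F (Suc n)) = prob A * prob (F (Suc n))"
      unfolding A_def
      by (intro path_algebra_indep[OF prob_space_axioms ind] sets.Int crossing_path staying_path S F_path)
    ultimately have "gscale c1 u * prob A * prob (F (Suc n)) \<le> gscale c1 u * prob (joint_crossing M B1 B2 \<rho> a c1 c2 S1 S2 u)"
      using u by (simp add: mult.assoc mult_left_mono gscale_nonneg)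
    moreover have "(limit_constant M B1 S1 - e) * prob (F (Suc n)) \<le> gscale c1 u * prob A * prob (F (Suc n))"
      using elim unfolding A_def by (intro mult_right_mono) auto
    moreover have "limit_constant M B1 S1 * (p - e) \<le> limit_constant M B1 S1 * prob (F (Suc n))"
      using n K by (intro mult_left_mono) auto
    moreover have "e * prob (F (Suc n)) \<le> e * 1" using e by (intro mult_left_mono) auto
    moreover have "limit_constant M B1 S1 * e \<le> 2 * e" using K e by (intro mult_right_mono) auto
    moreover have "p * limit_constant M B1 S1 = limit_constant M B1 S1 * p" by (rule mult.commute)
    ultimately show ?case using e unfolding left_diff_distrib right_diff_distrib by linarith
  qed
qed

text \<open>For \<open>a < \<rho>\<close> the second condition is simply dropped, as
  \<open>p = 1\<close>. For \<open>a = \<rho>\<close> a second crossing at \<open>t'\<close> needs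
  \<open>\<rho> * (B1 t' - c1 * t' - u) + Y t' > 0\<close>. Outside two negligible events,
  \<open>B1\<close> with drift is at most \<open>u + q m\<close> near time 1 and at most
  \<open>u - m\<close> earlier, so the event \<open>E m\<close>, which concerns \<open>Y\<close>
  alone, must occur.\<close>

lemma joint_upper:
  assumes S: "0 \<le> S1" "0 \<le> S2" and \<epsilon>: "0 < \<epsilon>"
  shows "\<forall>\<^sub>F u in at_top. gscale c1 u * prob (joint_crossing M B1 B2 \<rho> a c1 c2 S1 S2 u) < p * limit_constant M B1 S1 + \<epsilon>"
proof (cases "a < \<rho>")
  case True
  have "\<forall>\<^sub>F u in at_top. gscale c1 u * prob (crossing M B1 c1 S1 u) < limit_constant M B1 S1 + \<epsilon>"
    by (rule order_tendstoD(2)[OF crossing_tendsto[OF B1 S(1)]]) (use \<epsilon> in simp)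
  then show ?thesis
    using eventually_ge_at_top[of 0]
  proof eventually_elim
    case (elim u)
    have "prob (joint_crossing M B1 B2 \<rho> a c1 c2 S1 S2 u) \<le> prob (crossing M B1 c1 S1 u)"
      by (intro finite_measure_mono crossing_measurable[OF B1 S(1)]) (auto simp: joint_crossing_def)
    then have "gscale c1 u * prob (joint_crossing M B1 B2 \<rho> a c1 c2 S1 S2 u) \<le> gscale c1 u * prob (crossing M B1 c1 S1 u)"
      using elim by (intro mult_left_mono gscale_nonneg)
    then show ?case using elim True by (simp add: p_def)
  qed
next
  case False
  then have \<rho>a: "\<rho> = a" using a by simp
  define q where "q n = 1 / real (Suc n)" for n
  have q: "0 < q n" "q n \<le> 1" for n by (auto simp: q_def)
  \<comment> \<open>The first part shrinks to a condition at time 1, the second disappears because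
    paths are bounded: a path with \<open>Y 1 < 0\<close> leaves \<open>E n\<close> for
    good.\<close>
  define E where "E n = {\<omega>\<in>space M. \<exists>t\<in>{1 - q n..1}. - \<rho> * q n < Y t \<omega>} \<union> {\<omega>\<in>space M. \<exists>t\<in>{0..1}. \<rho> * real n < Y t \<omega>}" for n
  have E_path: "E n \<in> sets (path_algebra M B2)" for n
    unfolding E_def
    using sup_event_measurable[of Y "path_algebra M B2" "1 - q n" 1 "- \<rho> * q n"]
      sup_event_measurable[of Y "path_algebra M B2" 0 1 "\<rho> * real n"] Y_path Y_continuous q[of n] by (intro sets.Un) auto
  have E: "E n \<in> events" for n by (rule path_algebra_B2_sets[OF E_path])
  have ev: "eventually (\<lambda>n. \<omega> \<in> space M - E n) sequentially" if "\<omega> \<in> {\<omega>\<in>space M. Y 1 \<omega> < 0}" for \<omega>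
  proof -
    have \<omega>: "\<omega> \<in> space M" and neg: "Y 1 \<omega> < 0" using that by auto
    have "continuous_on {0..1} (\<lambda>t. Y t \<omega>)"
      by (rule continuous_on_subset[OF Y_continuous[OF \<omega>]]) auto
    then have "\<exists>r1\<in>{0..1}. \<forall>t\<in>{0..1}. Y t \<omega> \<le> Y r1 \<omega>"
      by (intro continuous_attains_sup) auto
    then obtain r1 where r1: "\<And>t. t \<in> {0..1} \<Longrightarrow> Y t \<omega> \<le> Y r1 \<omega>" by blast
    have "isCont (\<lambda>t. Y t \<omega>) 1"
      using Y_continuous[OF \<omega>] continuous_on_interior[of "{0..}" "\<lambda>t. Y t \<omega>" 1] by simp
    then have "\<exists>\<delta>>0. \<forall>t. dist t 1 < \<delta> \<longrightarrow> dist (Y t \<omega>) (Y 1 \<omega>) < - Y 1 \<omega> / 2"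
      using neg unfolding continuous_at_eps_delta by (metis divide_pos_pos neg_0_less_iff_less zero_less_numeral)
    then obtain \<delta> where \<delta>: "0 < \<delta>" "\<And>t. dist t 1 < \<delta> \<Longrightarrow> dist (Y t \<omega>) (Y 1 \<omega>) < - Y 1 \<omega> / 2" by blast
    have "(\<lambda>n. q n) \<longlonglongrightarrow> 0" "(\<lambda>n. \<rho> * q n) \<longlonglongrightarrow> 0" unfolding q_def by real_asymp+
    then have "\<forall>\<^sub>F n in sequentially. q n < \<delta>" "\<forall>\<^sub>F n in sequentially. \<rho> * q n < - Y 1 \<omega> / 2"
      using \<delta>(1) neg by (auto intro: order_tendstoD(2))
    moreover have "filterlim (\<lambda>n. \<rho> * real n) at_top sequentially" using rho_pos by real_asymp
    then have "\<forall>\<^sub>F n in sequentially. Y r1 \<omega> \<le> \<rho> * real n" by (simp add: filterlim_at_top)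
    ultimately show ?thesis
    proof eventually_elim
      case (elim n)
      have "Y t \<omega> \<le> - \<rho> * q n" if "t \<in> {1 - q n..1}" for t
      proof -
        have "dist t 1 < \<delta>" using that elim(1) by (auto simp: dist_real_def)
        from \<delta>(2)[OF this] elim(2) show ?thesis by (simp add: dist_real_def abs_less_iff)
      qed
      moreover have "Y t \<omega> \<le> \<rho> * real n" if "t \<in> {0..1}" for t using r1[OF that] elim by simp
      ultimately show ?case using \<omega> by (auto simp: E_def not_less)
    qed
  qed
  have K: "0 \<le> limit_constant M B1 S1" "limit_constant M B1 S1 \<le> 2"
    using limit_constant_pos[OF B1 S(1)] by (auto simp: limit_constant_def intro!: cSUP_least truncated_constant_le_2[OF B1 _ S(1)])
  define e where "e = \<epsilon> / 4"
  have e: "0 < e" using \<epsilon> by (simp add: e_def)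
  have "\<exists>n. prob (E (Suc n)) < p + e"
  proof (rule ccontr)
    assume "\<nexists>n. prob (E (Suc n)) < p + e"
    then have "p + e \<le> prob (E (Suc n))" for n by (simp add: not_less)
    then have le: "prob (space M - E (Suc n)) \<le> 1 - (p + e)" for n
      by (simp only: prob_compl[OF E] diff_left_mono)
    \<comment> \<open>An upper bound for \<open>E\<close> is obtained from its complement, which
      eventually contains every path with \<open>Y 1 < 0\<close>; that event has probability exactly
      \<open>1 - p\<close>.\<close>
    have "prob {\<omega>\<in>space M. Y 1 \<omega> < 0} \<le> 1 - (p + e)"
      by (rule prob_eventually_le) (rule sets.compl_sets[OF E], erule ev, rule le)
    moreover have "p = gtail (- d / r)" using False by (simp add: p_def)
    ultimately show False using Y_1_lt e by linarith
  qed
  then obtain n where n: "prob (E (Suc n)) < p + e" ..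
  \<comment> \<open>An index of at least 1 makes \<open>1 - q m\<close> positive, as
    \<open>early_exceeds_null\<close> demands.\<close>
  define m where "m = Suc n"
  define V where "V u = {\<omega>\<in>space M. \<exists>s\<in>{0..1}. B1 s \<omega> - c1 * s > u + q m}" for u
  define Z where "Z u = {\<omega>\<in>space M. \<exists>s\<in>{0..1 - q m}. B1 s \<omega> - c1 * s > u - real m}" for u
  have qm: "0 < 1 - q m" "1 - q m < 1" by (auto simp: q_def m_def field_simps)
  have V: "V u \<in> events" and Z: "Z u \<in> events" for u
    unfolding V_def Z_def using qm by (auto intro!: sup_event_measurable sbm_drift[OF B1])
  have "((\<lambda>u. gscale c1 u * prob (crossing M B1 c1 S1 u) * prob (E m) + gscale c1 u * prob (V u) + gscale c1 u * prob (Z u))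
      \<longlongrightarrow> limit_constant M B1 S1 * prob (E m) + 0 + 0) at_top"
    unfolding V_def Z_def
    by (intro tendsto_add tendsto_mult_right crossing_tendsto[OF B1 S(1)] sup_exceeds_null[OF B1 q(1)] early_exceeds_null[OF B1 qm])
  moreover have "limit_constant M B1 S1 * prob (E m) + 0 + 0 < p * limit_constant M B1 S1 + \<epsilon>"
  proof -
    have "limit_constant M B1 S1 * prob (E m) \<le> limit_constant M B1 S1 * (p + e)" using n K by (intro mult_left_mono) (auto simp: m_def)
    moreover have "limit_constant M B1 S1 * e \<le> 2 * e" using K e by (intro mult_right_mono) auto
    moreover have "p * limit_constant M B1 S1 = limit_constant M B1 S1 * p" by (rule mult.commute)
    moreover have "\<epsilon> = 4 * e" by (simp add: e_def)
    ultimately show ?thesis using e unfolding distrib_left by linarith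
  qed
  ultimately have "\<forall>\<^sub>F u in at_top. gscale c1 u * prob (crossing M B1 c1 S1 u) * prob (E m) + gscale c1 u * prob (V u) + gscale c1 u * prob (Z u)
      < p * limit_constant M B1 S1 + \<epsilon>"
    by (rule order_tendstoD(2))
  then show ?thesis
    using eventually_gt_at_top[of 0]
  proof eventually_elim
    case (elim u)
    have C: "crossing M B1 c1 S1 u \<in> events" by (rule crossing_measurable[OF B1 S(1)])
    have "joint_crossing M B1 B2 \<rho> a c1 c2 S1 S2 u \<subseteq> (crossing M B1 c1 S1 u \<inter> E m) \<union> V u \<union> Z u"
    proof
      fix \<omega> assume J: "\<omega> \<in> joint_crossing M B1 B2 \<rho> a c1 c2 S1 S2 u"
      then have \<omega>: "\<omega> \<in> space M" "\<omega> \<in> crossing M B1 c1 S1 u" by (auto simp: joint_crossing_def)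
      obtain t' where t': "t' \<in> {0..1}" "\<forall>t\<in>{t'..t' + S2 / u\<^sup>2}. with_drift c2 (correlated_bm \<rho> B1 B2) t \<omega> > a * u"
        using J by (auto simp: joint_crossing_def)
      then have "with_drift c2 (correlated_bm \<rho> B1 B2) t' \<omega> > a * u" using S by auto
      then have pos: "\<rho> * (B1 t' \<omega> - c1 * t' - u) + Y t' \<omega> > 0" unfolding second_crossing_iff using \<rho>a by simp
      show "\<omega> \<in> (crossing M B1 c1 S1 u \<inter> E m) \<union> V u \<union> Z u"
      proof (rule ccontr)
        assume no: "\<omega> \<notin> (crossing M B1 c1 S1 u \<inter> E m) \<union> V u \<union> Z u"
        then have "\<omega> \<notin> E m" using \<omega> by auto
        show False
        proof (cases "1 - q m \<le> t'")
          case True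
          have "B1 t' \<omega> - c1 * t' \<le> u + q m" using no \<omega> t' by (auto simp: V_def not_less)
          then have "B1 t' \<omega> - c1 * t' - u \<le> q m" by linarith
          then have "\<rho> * (B1 t' \<omega> - c1 * t' - u) \<le> \<rho> * q m" using rho_pos by (intro mult_left_mono) auto
          with pos have "- \<rho> * q m < Y t' \<omega>" by simp
          then show False using \<open>\<omega> \<notin> E m\<close> \<omega> t' True by (auto simp: E_def)
        next
          case False
          have "B1 t' \<omega> - c1 * t' \<le> u - real m" using no \<omega> t' False by (auto simp: Z_def not_less)
          then have "B1 t' \<omega> - c1 * t' - u \<le> - real m" by linarith
          then have "\<rho> * (B1 t' \<omega> - c1 * t' - u) \<le> \<rho> * (- real m)" using rho_pos by (intro mult_left_mono) auto
          with pos have "\<rho> * real m < Y t' \<omega>" by simp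
          then show False using \<open>\<omega> \<notin> E m\<close> \<omega> t' by (auto simp: E_def)
        qed
      qed
    qed
    then have "prob (joint_crossing M B1 B2 \<rho> a c1 c2 S1 S2 u) \<le> prob ((crossing M B1 c1 S1 u \<inter> E m) \<union> V u \<union> Z u)"
      using C E V Z by (intro finite_measure_mono) auto
    also have "\<dots> \<le> prob ((crossing M B1 c1 S1 u \<inter> E m) \<union> V u) + prob (Z u)"
      using C E V Z by (intro measure_Un_le) auto
    also have "prob ((crossing M B1 c1 S1 u \<inter> E m) \<union> V u) \<le> prob (crossing M B1 c1 S1 u \<inter> E m) + prob (V u)"
      using C E V by (intro measure_Un_le) auto
    also have "prob (crossing M B1 c1 S1 u \<inter> E m) = prob (crossing M B1 c1 S1 u) * prob (E m)"
      by (rule path_algebra_indep[OF prob_space_axioms ind crossing_path[OF S(1)] E_path])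
    finally have "gscale c1 u * prob (joint_crossing M B1 B2 \<rho> a c1 c2 S1 S2 u) \<le>
        gscale c1 u * (prob (crossing M B1 c1 S1 u) * prob (E m) + prob (V u) + prob (Z u))"
      using elim by (intro mult_left_mono gscale_nonneg) auto
    then show ?case using elim by (simp add: distrib_left mult.assoc)
  qed
qed

lemma joint_tendsto:
  assumes "0 \<le> S1" "0 \<le> S2"
  shows "((\<lambda>u. gscale c1 u * prob (joint_crossing M B1 B2 \<rho> a c1 c2 S1 S2 u)) \<longlongrightarrow> p * limit_constant M B1 S1) at_top"
proof (rule order_tendstoI)
  fix x assume "x < p * limit_constant M B1 S1"
  then have "\<forall>\<^sub>F u in at_top. p * limit_constant M B1 S1 - (p * limit_constant M B1 S1 - x) < gscale c1 u * prob (joint_crossing M B1 B2 \<rho> a c1 c2 S1 S2 u)"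
    by (intro joint_lower[OF assms]) simp
  then show "\<forall>\<^sub>F u in at_top. x < gscale c1 u * prob (joint_crossing M B1 B2 \<rho> a c1 c2 S1 S2 u)" by simp
next
  fix x assume "p * limit_constant M B1 S1 < x"
  then have "\<forall>\<^sub>F u in at_top. gscale c1 u * prob (joint_crossing M B1 B2 \<rho> a c1 c2 S1 S2 u) < p * limit_constant M B1 S1 + (x - p * limit_constant M B1 S1)"
    by (intro joint_upper[OF assms]) simp
  then show "\<forall>\<^sub>F u in at_top. gscale c1 u * prob (joint_crossing M B1 B2 \<rho> a c1 c2 S1 S2 u) < x" by simp
qed

lemma cond_prob_eq:
  assumes "0 \<le> S1" "0 \<le> S2"
  shows "cond_parisian_ruin_prob M B1 B2 \<rho> S1 S2 c1 c2 u (a * u) =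
    prob (joint_crossing M B1 B2 \<rho> a c1 c2 S1 S2 u) / prob (joint_crossing M B1 B2 \<rho> a c1 c2 0 0 u)"
proof -
  let ?W = "with_drift c2 (correlated_bm \<rho> B1 B2)"
  have nonneg: "0 \<le> S1 / u\<^sup>2" "0 \<le> S2 / u\<^sup>2" using assms by auto
  \<comment> \<open>Windows contain their starting points. They are therefore nonempty, so the two
    components separate under the quantifiers, and the Parisian event implies the conditioning
    event.\<close>
  have num: "(\<exists>s'\<in>{0..1}. \<exists>t'\<in>{0..1}. \<forall>s\<in>{s'..s' + S1 / u\<^sup>2}. \<forall>t\<in>{t'..t' + S2 / u\<^sup>2}.
        with_drift c1 B1 s \<omega> > u \<and> ?W t \<omega> > a * u) \<and>
      (\<exists>s\<in>{0..1}. \<exists>t\<in>{0..1}. with_drift c1 B1 s \<omega> > u \<and> ?W t \<omega> > a * u) \<longleftrightarrow>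
    (\<exists>s'\<in>{0..1}. \<forall>s\<in>{s'..s' + S1 / u\<^sup>2}. B1 s \<omega> - c1 * s > u) \<and>
    (\<exists>t'\<in>{0..1}. \<forall>t\<in>{t'..t' + S2 / u\<^sup>2}. ?W t \<omega> > a * u)" for \<omega>
  proof -
    have "s' \<in> {s'..s' + S1 / u\<^sup>2}" "s' \<in> {s'..s' + S2 / u\<^sup>2}" for s' using nonneg by auto
    then show ?thesis unfolding with_drift_def[of c1] by blast
  qed
  have "{\<omega>\<in>space M. (\<exists>s'\<in>{0..1}. \<forall>s\<in>{s'..s' + S1 / u\<^sup>2}. B1 s \<omega> - c1 * s > u) \<and>
    (\<exists>t'\<in>{0..1}. \<forall>t\<in>{t'..t' + S2 / u\<^sup>2}. ?W t \<omega> > a * u)} = joint_crossing M B1 B2 \<rho> a c1 c2 S1 S2 u"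
    unfolding joint_crossing_def crossing_def by blast
  moreover have "{\<omega>\<in>space M. \<exists>s\<in>{0..1}. \<exists>t\<in>{0..1}. with_drift c1 B1 s \<omega> > u \<and> ?W t \<omega> > a * u} =
      joint_crossing M B1 B2 \<rho> a c1 c2 0 0 u"
    by (auto simp: joint_crossing_def crossing_def with_drift_def[of c1])
  ultimately show ?thesis
    unfolding cond_parisian_ruin_prob_def Let_def cond_prob_def num by simp
qed

lemma cond_prob_tendsto:
  assumes "0 \<le> S1" "0 \<le> S2"
  shows "((\<lambda>u. cond_parisian_ruin_prob M B1 B2 \<rho> S1 S2 c1 c2 u (a * u)) \<longlongrightarrow> limit_constant M B1 S1 / 2) at_top"
proof -
  have "((\<lambda>u. (gscale c1 u * prob (joint_crossing M B1 B2 \<rho> a c1 c2 S1 S2 u)) /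
      (gscale c1 u * prob (joint_crossing M B1 B2 \<rho> a c1 c2 0 0 u))) \<longlongrightarrow> (p * limit_constant M B1 S1) / (p * limit_constant M B1 0)) at_top"
    using p_bounds by (intro tendsto_divide joint_tendsto assms order_refl) (simp add: limit_constant_0[OF B1])
  also have "(p * limit_constant M B1 S1) / (p * limit_constant M B1 0) = limit_constant M B1 S1 / 2"
    using p_bounds by (simp add: limit_constant_0[OF B1])
  finally show ?thesis
  proof (rule Lim_transform_eventually)
    show "\<forall>\<^sub>F u in at_top. (gscale c1 u * prob (joint_crossing M B1 B2 \<rho> a c1 c2 S1 S2 u)) /
      (gscale c1 u * prob (joint_crossing M B1 B2 \<rho> a c1 c2 0 0 u)) = cond_parisian_ruin_prob M B1 B2 \<rho> S1 S2 c1 c2 u (a * u)"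
      using eventually_gt_at_top[of 0]
    proof eventually_elim
      case (elim u)
      have "0 < gscale c1 u" unfolding gscale_def using elim by (intro divide_pos_pos normal_density_pos) auto
      then show ?case by (simp add: cond_prob_eq[OF assms])
    qed
  qed
qed

end

theorem theorem2p1:
  fixes M :: "'a measure" and N :: "'b measure"
    and B1 B2 :: "real \<Rightarrow> 'a \<Rightarrow> real" and B :: "real \<Rightarrow> 'b \<Rightarrow> real"
    and \<rho> a c1 c2 S1 S2 :: real
  assumes "standard_brownian_motion M B1" and "standard_brownian_motion M B2"
    and "indep_processes M B1 B2"
    and "two_sided_brownian_motion N B"
    and "-1 < \<rho>" and "\<rho> < 1" and "a > 0" and "S1 > 0" and "S2 > 0"
    and "a \<le> \<rho>"
  shows "0 < parisian_constant N B S1 \<and> parisian_constant N B S1 < \<infinity> \<and>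
    ((\<lambda>u. cond_parisian_ruin_prob M B1 B2 \<rho> S1 S2 c1 c2 u (a * u))
       \<longlongrightarrow> enn2real (parisian_constant N B S1) / 2) at_top"
proof -
  interpret correlated_pair M B1 B2 \<rho> a c1 c2
    by standard (use assms in auto)
  have S: "0 \<le> S1" "0 \<le> S2" using assms by auto
  have "parisian_constant N B S1 = ennreal (limit_constant M B1 S1)"
    by (rule parisian_constant_eq[OF assms(1,4) S(1)])
  moreover have "0 < limit_constant M B1 S1" by (rule limit_constant_pos[OF assms(1) S(1)])
  ultimately show ?thesis
    using cond_prob_tendsto[OF S] by (simp add: ennreal_less_zero_iff)
qed

end
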